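(* Let $\Omega\subset\mathbb{R}^n$ be a bounded domain. Let $G(t)=\int_0^t g(s)s\,ds$ be an N-function satisfying conditions (A1), (A2) and (A3) of the context, and let $u\in W^{2,G}_{loc}(\Omega)$ be a local weak solution in $\Omega$ of the equation $\Delta(g(\Delta u)\Delta u)=\Delta(g(f)f)$. Then, if $G(f)\in L^q_{loc}(\Omega)$ for some $q\ge 1$, we also have $G(\Delta u)\in L^q_{loc}(\Omega)$. Moreover, the following estimate holds: there is $C>0$ such that $$\int_{B_r(x_0)}\big(G(\Delta u)\big)^q\,dx\le C\left[\left(\int_{B_{2r}(x_0)}G\Big(\frac{1}{r^2}u\Big)\,dx+\int_{B_{2r}(x_0)}G\Big(\frac1r|\nabla u|\Big)\,dx\right)^q+\int_{B_{2r}(x_0)}\big(G(f)\big)^q\,dx\right]$$ for any $r>0$ and $x_0\in\Omega$ such that $B_{4r}(x_0)\subset\Omega$.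
   Context: N-function: $G(t)=\int_0^t g(\tau)\tau\,d\tau$ for $t\ge0$, where $g$ is right-continuous for $t\ge 0$, even, positive for $t>0$, non-decreasing on $[0,\infty)$, with $g(0)=0$ and $\lim_{t\to\infty}g(t)t=\infty$. $G$ is extended to $\mathbb{R}$ as an even function. Conditions on $G$: (A1) $g$ is twice differentiable on $(0,\infty)$ with $g'>0$ there, and there are constants $1<p^-\le p^+$ with $p^--3\le \dfrac{t g''(t)}{g'(t)}\le p^+-3$ for all $t>0$. (A2) The function $t\mapsto G(\sqrt t)$ is convex on $[0,\infty)$. (A3) $\displaystyle\int_0^1\frac{G^{-1}(s)}{s^{(n+1)/n}}\,ds<\infty$ and $\displaystyle\int_1^\infty\frac{G^{-1}(s)}{s^{(n+1)/n}}\,ds=\infty$. Spaces: $L^G(\Omega)$ is the set of measurable $u:\Omega\to\mathbb{R}$ with $\int_\Omega G(u)\,dx<\infty$ (under (A1) this is a Banach space with the Luxemburg norm $\|u\|_G=\inf\{\lambda>0:\int_\Omega G(u/\lambda)\,dx\le 1\}$). $W^{2,G}(\Omega)$ is the set of $u\in L^G(\Omega)$ whose weak derivatives $D^\alpha u$ belong to $L^G(\Omega)$ for all $|\alpha|\le 2$. The subscript $loc$ means that the property holds on every open set compactly contained in $\Omega$. Local weak solution: given $f:\Omega\to\mathbb{R}$ measurable (with $g(f)f\in L^1_{loc}(\Omega)$, so that the formula makes sense), $u\in W^{2,G}_{loc}(\Omega)$ is a local weak solution of $\Delta(g(\Delta u)\Delta u)=\Delta(g(f)f)$ in $\Omega$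 if $\int_\Omega g(\Delta u)\Delta u\,\Delta\varphi\,dx=\int_\Omega g(f)f\,\Delta\varphi\,dx$ for every $\varphi\in C_0^\infty(\Omega)$. $B_r(x_0)$ is the ball of radius $r$ centered at $x_0$.
   Formalization: The constant C may depend on a lower bound ρ>0 for r (estimate for all r≥ρ, C uniform in u, f, x_0); one C for all r>0 is impossible when q>1, e.g. f=0, u=|x|^2, G=|t|^3/3, n=4, r→0. *)

theory Defs
  imports "HOL-Analysis.Analysis"
begin

definition N_function_generator :: "(real \<Rightarrow> real) \<Rightarrow> bool" where
  "N_function_generator g \<longleftrightarrow>
     (\<forall>t\<ge>0. continuous (at_right t) g) \<and>
     (\<forall>t. g (- t) = g t) \<and>
     (\<forall>t>0. g t > 0) \<and>
     mono_on {0..} g \<and>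
     g 0 = 0 \<and>
     filterlim (\<lambda>t. g t * t) at_top at_top"

text \<open>The absolute value is the even extension of the N-function to the real line.\<close>

definition N_function :: "(real \<Rightarrow> real) \<Rightarrow> real \<Rightarrow> real" where
  "N_function g t = integral {0..\<bar>t\<bar>} (\<lambda>\<tau>. g \<tau> * \<tau>)"

definition condition_A1 :: "(real \<Rightarrow> real) \<Rightarrow> bool" where
  "condition_A1 g \<longleftrightarrow>
     (\<forall>t>0. g differentiable (at t) \<and> deriv g differentiable (at t) \<and> deriv g t > 0) \<and>
     (\<exists>p_minus p_plus. 1 < p_minus \<and> p_minus \<le> p_plus \<and>
        (\<forall>t>0. p_minus - 3 \<le> t * deriv (deriv g) t / deriv g t \<and>
               t * deriv (deriv g) t / deriv g t \<le> p_plus - 3))"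

definition condition_A2 :: "(real \<Rightarrow> real) \<Rightarrow> bool" where
  "condition_A2 g \<longleftrightarrow> convex_on {0..} (\<lambda>t. N_function g (sqrt t))"

text \<open>The inverse is that of the restriction of the N-function to the nonnegative half-line.\<close>

definition N_function_inverse :: "(real \<Rightarrow> real) \<Rightarrow> real \<Rightarrow> real" where
  "N_function_inverse g = the_inv_into {0..} (N_function g)"

definition condition_A3 :: "nat \<Rightarrow> (real \<Rightarrow> real) \<Rightarrow> bool" where
  "condition_A3 n g \<longleftrightarrow>
     (\<integral>\<^sup>+ s \<in> {0<..1}. ennreal (N_function_inverse g s / s powr ((real n + 1) / real n)) \<partial>lborel) < \<infinity> \<and>
     (\<integral>\<^sup>+ s \<in> {1..}. ennreal (N_function_inverse g s / s powr ((real n + 1) / real n)) \<partial>lborel) = \<infinity>"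

definition bounded_domain :: "'a::real_normed_vector set \<Rightarrow> bool" where
  "bounded_domain \<Omega> \<longleftrightarrow> open \<Omega> \<and> connected \<Omega> \<and> \<Omega> \<noteq> {} \<and> bounded \<Omega>"

definition compactly_contained :: "'a::topological_space set \<Rightarrow> 'a set \<Rightarrow> bool" where
  "compactly_contained U \<Omega> \<longleftrightarrow> open U \<and> compact (closure U) \<and> closure U \<subseteq> \<Omega>"

definition Lq :: "real \<Rightarrow> 'a::euclidean_space set \<Rightarrow> ('a \<Rightarrow> real) set" where
  "Lq q \<Omega> = {u. u \<in> borel_measurable (lebesgue_on \<Omega>) \<and>
                integrable (lebesgue_on \<Omega>) (\<lambda>x. \<bar>u x\<bar> powr q)}"

definition Lq_loc :: "real \<Rightarrow> 'a::euclidean_space set \<Rightarrow> ('a \<Rightarrow> real) set" where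
  "Lq_loc q \<Omega> = {u. \<forall>U. compactly_contained U \<Omega> \<longrightarrow> u \<in> Lq q U}"

definition LG :: "(real \<Rightarrow> real) \<Rightarrow> 'a::euclidean_space set \<Rightarrow> ('a \<Rightarrow> real) set" where
  "LG g \<Omega> = {u. u \<in> borel_measurable (lebesgue_on \<Omega>) \<and>
                integrable (lebesgue_on \<Omega>) (\<lambda>x. N_function g (u x))}"

text \<open>A multi-index is encoded by a list of coordinates, of length the order of the derivative;
  for smooth functions the order of the entries is immaterial.\<close>

definition partial :: "'n \<Rightarrow> (real^'n::finite \<Rightarrow> real) \<Rightarrow> real^'n \<Rightarrow> real" where
  "partial i \<phi> x = frechet_derivative \<phi> (at x) (axis i 1)"

definition partials :: "'n list \<Rightarrow> (real^'n::finite \<Rightarrow> real) \<Rightarrow> real^'n \<Rightarrow> real" where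
  "partials \<alpha> \<phi> = foldr partial \<alpha> \<phi>"

definition laplacian :: "(real^'n::finite \<Rightarrow> real) \<Rightarrow> real^'n \<Rightarrow> real" where
  "laplacian \<phi> x = (\<Sum>i\<in>UNIV. partials [i, i] \<phi> x)"

definition test_functions :: "(real^'n::finite) set \<Rightarrow> (real^'n \<Rightarrow> real) set" where
  "test_functions \<Omega> =
     {\<phi>. (\<forall>\<alpha> x. partials \<alpha> \<phi> differentiable (at x)) \<and>
         compact (closure {x. \<phi> x \<noteq> 0}) \<and> closure {x. \<phi> x \<noteq> 0} \<subseteq> \<Omega>}"

definition has_weak_derivative ::
    "(real^'n::finite) set \<Rightarrow> 'n list \<Rightarrow> (real^'n \<Rightarrow> real) \<Rightarrow> (real^'n \<Rightarrow> real) \<Rightarrow> bool" where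
  "has_weak_derivative \<Omega> \<alpha> u v \<longleftrightarrow>
     u \<in> Lq_loc 1 \<Omega> \<and> v \<in> Lq_loc 1 \<Omega> \<and>
     (\<forall>\<phi>\<in>test_functions \<Omega>.
        (LINT x|lebesgue_on \<Omega>. u x * partials \<alpha> \<phi> x) =
        (-1) ^ length \<alpha> * (LINT x|lebesgue_on \<Omega>. v x * \<phi> x))"

text \<open>Weak derivatives are unique up to null sets; the choice below picks a representative.\<close>

definition weak_derivative ::
    "(real^'n::finite) set \<Rightarrow> 'n list \<Rightarrow> (real^'n \<Rightarrow> real) \<Rightarrow> real^'n \<Rightarrow> real" where
  "weak_derivative \<Omega> \<alpha> u = (SOME v. has_weak_derivative \<Omega> \<alpha> u v)"

definition weak_gradient ::
    "(real^'n::finite) set \<Rightarrow> (real^'n \<Rightarrow> real) \<Rightarrow> real^'n \<Rightarrow> real^'n" where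
  "weak_gradient \<Omega> u x = (\<chi> i. weak_derivative \<Omega> [i] u x)"

definition weak_laplacian ::
    "(real^'n::finite) set \<Rightarrow> (real^'n \<Rightarrow> real) \<Rightarrow> real^'n \<Rightarrow> real" where
  "weak_laplacian \<Omega> u x = (\<Sum>i\<in>UNIV. weak_derivative \<Omega> [i, i] u x)"

definition W2G :: "(real \<Rightarrow> real) \<Rightarrow> (real^'n::finite) set \<Rightarrow> (real^'n \<Rightarrow> real) set" where
  "W2G g \<Omega> = {u \<in> LG g \<Omega>. \<forall>\<alpha>. length \<alpha> \<le> 2 \<longrightarrow> (\<exists>v\<in>LG g \<Omega>. has_weak_derivative \<Omega> \<alpha> u v)}"

definition W2G_loc :: "(real \<Rightarrow> real) \<Rightarrow> (real^'n::finite) set \<Rightarrow> (real^'n \<Rightarrow> real) set" where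
  "W2G_loc g \<Omega> = {u. \<forall>U. compactly_contained U \<Omega> \<longrightarrow> u \<in> W2G g U}"

definition local_weak_solution ::
    "(real \<Rightarrow> real) \<Rightarrow> (real^'n::finite) set \<Rightarrow> (real^'n \<Rightarrow> real) \<Rightarrow> (real^'n \<Rightarrow> real) \<Rightarrow> bool" where
  "local_weak_solution g \<Omega> f u \<longleftrightarrow>
     f \<in> borel_measurable (lebesgue_on \<Omega>) \<and>
     (\<lambda>x. g (f x) * f x) \<in> Lq_loc 1 \<Omega> \<and>
     u \<in> W2G_loc g \<Omega> \<and>
     (\<forall>\<phi>\<in>test_functions \<Omega>.
        (LINT x|lebesgue_on \<Omega>. g (weak_laplacian \<Omega> u x) * weak_laplacian \<Omega> u x * laplacian \<phi> x) =
        (LINT x|lebesgue_on \<Omega>. g (f x) * f x * laplacian \<phi> x))"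

end

theory Submission
  imports Defs
begin

text \<open>
  With \<open>A t = g t * t\<close>, the difference \<open>W = A (\<Delta>u) - A f\<close> is weakly harmonic, so by Weyl's lemma it
  coincides almost everywhere with its mollifications and is locally bounded by its mean over a
  slightly larger ball. Hence pointwise either \<open>A (\<Delta>u)\<close> is controlled by \<open>A f\<close> or by a mean of
  \<open>|A (\<Delta>u)| + |A f|\<close>; as \<open>g\<close> is increasing and \<open>G\<close> is doubling, this gives
  \<open>G (\<Delta>u) \<le> C (G f + mean (G (\<Delta>u) + G f))\<close>, and raising this to the power \<open>q\<close> yields the
  \<open>L\<^sup>q\<close> estimate. The mean of \<open>G (\<Delta>u)\<close> is bounded by testing harmonicity of \<open>W\<close> with \<open>\<eta> u\<close>,
  where \<open>\<eta>\<close> is a cut-off function, and absorbing terms by Young's inequality.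
\<close>

section \<open>Smooth functions and test functions\<close>

text \<open>The main obstacle is regularity: the equation may be tested only with smooth functions,
  whereas the energy argument wants \<eta> u. The remedy is to mollify W and not u: on the support
  of \<eta> the function W is its own mollification, and Fubini moves the kernel to the other
  factor. Weyl's lemma itself rests on one explicit kernel whose derivative in the radius is the
  Laplacian of a compactly supported bump, so that averages of a harmonic function do not depend on
  the radius. Young's inequality and the comparison of means use
  \<open>Phi t = g t * t\<^sup>2\<close> in place of G, because flux times argument is exactly
  \<open>Phi\<close>; conjugate functions and norms do not enter. The q-th power of an integral over
  a ball and the integral of a q-th power scale differently in r when q > 1; moreover the kernel and
  the cut-off are not rescaled with the ball. Hence all constants depend on a lower bound \<rho> of
  the radii, and on an upper bound R that comes from the boundedness of \<Omega>; they are fixed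
  before u, f, r and x0.\<close>

definition flat_exp :: "nat \<Rightarrow> real \<Rightarrow> real" where
  "flat_exp m t = (if t > 0 then exp (- 1 / t) / t ^ m else 0)"

lemma flat_exp_nonneg: "0 \<le> flat_exp m t"
  by (simp add: flat_exp_def)

lemma flat_exp_nonpos_arg: "t \<le> 0 \<Longrightarrow> flat_exp m t = 0"
  by (simp add: flat_exp_def)

lemma flat_exp_pos: "0 < t \<Longrightarrow> 0 < flat_exp m t"
  by (simp add: flat_exp_def)

text \<open>The exponential series at 1 / t dominates its single term of order m. Having m! as an
  explicit bound keeps all later constants explicit.\<close>

lemma flat_exp_le_fact: "flat_exp m t \<le> fact m"
proof (cases "t > 0")
  case True
  have "(1 / t) ^ m / fact m \<le> exp (1 / t)"
  proof -
    have s: "(\<lambda>n. inverse (fact n) *\<^sub>R (1 / t) ^ n) sums exp (1 / t)"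
      by (rule exp_converges)
    have "(\<Sum>n\<in>{m}. inverse (fact n) *\<^sub>R (1 / t) ^ n) \<le> (\<Sum>n. inverse (fact n) *\<^sub>R (1 / t) ^ n)"
      using True by (intro sum_le_suminf[OF sums_summable[OF s]]) auto
    then show ?thesis using sums_unique[OF s] by (simp add: field_simps)
  qed
  then have "(1 / t) ^ m \<le> exp (1 / t) * fact m"
    by (simp add: pos_divide_le_eq)
  then have "(1 / t) ^ m / exp (1 / t) \<le> fact m"
    by (simp add: pos_divide_le_eq mult.commute)
  then have "exp (- (1 / t)) * (1 / t) ^ m \<le> fact m"
    by (simp add: exp_minus divide_inverse mult.commute)
  with True show ?thesis
    by (simp add: flat_exp_def power_one_over field_simps)
qed (simp add: flat_exp_def)

text \<open>Raising the index by k costs a factor \<open>t ^ k\<close>. Together with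
  \<open>flat_exp_le_fact\<close> this gives vanishing to every order at 0, and it lets a cut-off
  absorb negative powers of its argument.\<close>

lemma flat_exp_shift: "flat_exp m t = flat_exp (m + k) t * t ^ k"
  by (simp add: flat_exp_def power_add)

text \<open>The index m is there because differentiation only raises it, so the family is closed
  under derivatives. At 0, shifting the index by 2 bounds the difference quotient by (m + 2)! |h|,
  hence the derivative is 0 there.\<close>

lemma DERIV_flat_exp:
  "(flat_exp m has_real_derivative flat_exp (m + 2) t - real m * flat_exp (m + 1) t) (at t)"
proof -
  consider "t > 0" | "t < 0" | "t = 0" by linarith
  then show ?thesis
  proof cases
    case 1
    have "((\<lambda>t. exp (- 1 / t) / t ^ m) has_real_derivative
        flat_exp (m + 2) t - real m * flat_exp (m + 1) t) (at t)"
      using 1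
      by (auto intro!: derivative_eq_intros simp: flat_exp_def)
        (cases m; simp add: field_simps power2_eq_square)
    then show ?thesis
    proof (rule has_field_derivative_transform_within_open[where S="{0<..}"])
    qed (use 1 in \<open>auto simp: flat_exp_def\<close>)
  next
    case 2
    have "((\<lambda>t. 0) has_real_derivative flat_exp (m + 2) t - real m * flat_exp (m + 1) t) (at t)"
      using 2 by (auto simp: flat_exp_def)
    then show ?thesis
    proof (rule has_field_derivative_transform_within_open[where S="{..<0}"])
    qed (use 2 in \<open>auto simp: flat_exp_def\<close>)
  next
    case 3
    have "((\<lambda>h. (flat_exp m (0 + h) - flat_exp m 0) / h) \<longlongrightarrow> 0) (at 0)"
    proof (rule Lim_null_comparison)
      show "\<forall>\<^sub>F h in at 0. norm ((flat_exp m (0 + h) - flat_exp m 0) / h) \<le> fact (m + 2) * \<bar>h\<bar>"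
      proof (rule always_eventually, rule allI)
        fix h :: real
        have "\<bar>flat_exp m h\<bar> \<le> fact (m + 2) * \<bar>h\<bar>\<^sup>2"
          using flat_exp_shift[of m h 2] flat_exp_le_fact[of "m + 2" h] flat_exp_nonneg[of "m + 2" h]
          by (simp add: abs_mult mult_right_mono)
        then show "norm ((flat_exp m (0 + h) - flat_exp m 0) / h) \<le> fact (m + 2) * \<bar>h\<bar>"
          by (cases "h = 0")
            (auto simp: flat_exp_def[of m 0] pos_divide_le_eq power2_eq_square mult.assoc simp del: fact_Suc abs_mult_self_eq)
      qed
      show "((\<lambda>h. fact (m + 2) * \<bar>h\<bar>) \<longlongrightarrow> (0::real)) (at 0)"
        by (auto intro!: tendsto_eq_intros)
    qed
    then show ?thesis using 3 by (simp add: DERIV_def flat_exp_def)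
  qed
qed

lemma continuous_flat_exp: "continuous_on S (flat_exp m)"
  by (meson DERIV_flat_exp DERIV_isCont continuous_at_imp_continuous_on)

text \<open>A class of smooth functions that contains all the cut-offs and mollifiers needed here and is
  closed under partial derivatives by inspection.\<close>

inductive elementary :: "(real^'n::finite \<Rightarrow> real) \<Rightarrow> bool" where
  elementary_const: "elementary (\<lambda>x. c)"
| elementary_coord: "elementary (\<lambda>x. x $ i)"
| elementary_add: "elementary f \<Longrightarrow> elementary h \<Longrightarrow> elementary (\<lambda>x. f x + h x)"
| elementary_mult: "elementary f \<Longrightarrow> elementary h \<Longrightarrow> elementary (\<lambda>x. f x * h x)"
| elementary_flat_exp: "elementary f \<Longrightarrow> elementary (\<lambda>x. flat_exp m (f x))"

lemma elementary_uminus: "elementary f \<Longrightarrow> elementary (\<lambda>x. - f x)"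
  using elementary_mult[OF elementary_const[of "-1"], of f] by simp

lemma elementary_diff: "elementary f \<Longrightarrow> elementary h \<Longrightarrow> elementary (\<lambda>x. f x - h x)"
  using elementary_add[of f "\<lambda>x. - h x"] elementary_uminus[of h] by simp

lemma elementary_sum: "finite I \<Longrightarrow> (\<And>i. i \<in> I \<Longrightarrow> elementary (f i)) \<Longrightarrow> elementary (\<lambda>x. \<Sum>i\<in>I. f i x)"
  by (induction I rule: finite_induct) (auto intro: elementary.intros)

lemma elementary_prod: "finite I \<Longrightarrow> (\<And>i. i \<in> I \<Longrightarrow> elementary (f i)) \<Longrightarrow> elementary (\<lambda>x. \<Prod>i\<in>I. f i x)"
  by (induction I rule: finite_induct) (auto intro: elementary.intros)

lemma has_derivative_partial:
  "(f has_derivative D) (at x) \<Longrightarrow> partial i f x = D (axis i 1)"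
  by (simp add: partial_def frechet_derivative_at[symmetric])

lemma partial_add:
  assumes "f differentiable (at x)" "h differentiable (at x)"
  shows "partial i (\<lambda>x. f x + h x) x = partial i f x + partial i h x"
proof -
  from assms obtain D D' where D: "(f has_derivative D) (at x)" "(h has_derivative D') (at x)"
    by (auto simp: differentiable_def)
  show ?thesis
    using has_derivative_partial[OF has_derivative_add[OF D]] D[THEN has_derivative_partial] by simp
qed

lemma partial_mult:
  assumes "f differentiable (at x)" "h differentiable (at x)"
  shows "partial i (\<lambda>x. f x * h x) x = f x * partial i h x + partial i f x * h x"
proof -
  from assms obtain D D' where D: "(f has_derivative D) (at x)" "(h has_derivative D') (at x)"
    by (auto simp: differentiable_def)
  show ?thesis
    using has_derivative_partial[OF has_derivative_mult[OF D]] D[THEN has_derivative_partial] by simp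
qed

lemma has_derivative_flat_exp_comp:
  assumes "(f has_derivative D) (at x)"
  shows "((\<lambda>x. flat_exp m (f x)) has_derivative
     (\<lambda>h. (flat_exp (m + 2) (f x) - real m * flat_exp (m + 1) (f x)) * D h)) (at x)"
  using has_derivative_compose[OF assms DERIV_flat_exp[unfolded has_field_derivative_def]]
  by simp

lemma partial_flat_exp:
  assumes "f differentiable (at x)"
  shows "partial i (\<lambda>x. flat_exp m (f x)) x =
    (flat_exp (m + 2) (f x) - real m * flat_exp (m + 1) (f x)) * partial i f x"
proof -
  from assms obtain D where D: "(f has_derivative D) (at x)"
    by (auto simp: differentiable_def)
  show ?thesis
    using has_derivative_partial[OF has_derivative_flat_exp_comp[OF D]] has_derivative_partial[OF D] by simp
qed

lemma partial_const: "partial i (\<lambda>x. c) x = 0"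
  by (rule has_derivative_partial[OF has_derivative_const, of i c x])

lemma has_derivative_coord: "((\<lambda>x::real^'n::finite. x $ j) has_derivative (\<lambda>h. h $ j)) (at x)"
  by (simp add: bounded_linear_imp_has_derivative bounded_linear_vec_nth)

lemma partial_coord: "partial i (\<lambda>x::real^'n::finite. x $ j) x = (if i = j then 1 else 0)"
  using has_derivative_partial[OF has_derivative_coord, of i j x] by (auto simp: axis_def)

lemma elementary_differentiable: "elementary f \<Longrightarrow> f differentiable (at x)"
proof (induction rule: elementary.induct)
  case (elementary_coord i)
  then show ?case using has_derivative_coord differentiable_def by blast
next
  case (elementary_flat_exp f m)
  then show ?case
    using has_derivative_flat_exp_comp unfolding differentiable_def by blast
qed auto

lemma elementary_partial: "elementary f \<Longrightarrow> elementary (partial i f)"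
proof (induction rule: elementary.induct)
  case (elementary_const c)
  then show ?case by (simp add: partial_const[abs_def] elementary.intros)
next
  case (elementary_coord j)
  then show ?case by (simp add: partial_coord[abs_def] elementary.intros)
next
  case (elementary_add f h)
  then have "partial i (\<lambda>x. f x + h x) = (\<lambda>x. partial i f x + partial i h x)"
    by (intro ext partial_add elementary_differentiable)
  then show ?case using elementary_add by (simp add: elementary.intros)
next
  case (elementary_mult f h)
  then have "partial i (\<lambda>x. f x * h x) = (\<lambda>x. f x * partial i h x + partial i f x * h x)"
    by (intro ext partial_mult elementary_differentiable)
  then show ?case using elementary_mult by (simp add: elementary.intros)
next
  case (elementary_flat_exp f m)
  then have "partial i (\<lambda>x. flat_exp m (f x)) =
      (\<lambda>x. (flat_exp (m + 2) (f x) - real m * flat_exp (m + 1) (f x)) * partial i f x)"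
    by (intro ext partial_flat_exp elementary_differentiable)
  then show ?case using elementary_flat_exp
    by (auto intro!: elementary.intros elementary_diff)
qed

lemma elementary_partials: "elementary f \<Longrightarrow> elementary (partials \<alpha> f)"
  unfolding partials_def by (induction \<alpha>) (auto intro: elementary_partial)

lemma elementary_laplacian: "elementary f \<Longrightarrow> elementary (laplacian f)"
  unfolding laplacian_def[abs_def] by (intro elementary_sum elementary_partials) auto

lemma elementary_continuous: "elementary f \<Longrightarrow> continuous_on S f"
  by (simp add: continuous_at_imp_continuous_on differentiable_imp_continuous_within elementary_differentiable)

lemma elementary_test_function:
  assumes "elementary \<phi>" "compact K" "K \<subseteq> \<Omega>" "\<And>x. x \<notin> K \<Longrightarrow> \<phi> x = 0"
  shows "\<phi> \<in> test_functions \<Omega>"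
proof -
  have "closure {x. \<phi> x \<noteq> 0} \<subseteq> K"
    using assms by (intro closure_minimal) (auto simp: compact_imp_closed)
  moreover from this have "compact (closure {x. \<phi> x \<noteq> 0})"
    using compact_closure bounded_subset[OF compact_imp_bounded[OF assms(2)]] closure_subset by blast
  ultimately show ?thesis
    using assms elementary_differentiable[OF elementary_partials]
    by (auto simp: test_functions_def)
qed

lemma partials_zero_on_open:
  assumes "open S" "\<And>x. x \<in> S \<Longrightarrow> \<phi> x = 0" "x \<in> S"
  shows "partials \<alpha> \<phi> x = 0"
  using assms(3)
proof (induction \<alpha> arbitrary: x)
  case (Cons i \<alpha>)
  have "((\<lambda>x. 0) has_derivative (\<lambda>h. 0)) (at x)" by simp
  then have "(partials \<alpha> \<phi> has_derivative (\<lambda>h. 0)) (at x)"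
    by (rule has_derivative_transform_within_open[OF _ assms(1)]) (use Cons in auto)
  from has_derivative_partial[OF this] show ?case by (simp add: partials_def)
qed (simp add: partials_def assms)

lemma partials_zero_off_support:
  "x \<notin> closure {x. \<phi> x \<noteq> 0} \<Longrightarrow> partials \<alpha> \<phi> x = 0"
  by (rule partials_zero_on_open[of "- closure {x. \<phi> x \<noteq> 0}"]) (use closure_subset[of "{x. \<phi> x \<noteq> 0}"] in auto)

lemma test_functions_mono: "U \<subseteq> V \<Longrightarrow> test_functions U \<subseteq> test_functions V"
  by (auto simp: test_functions_def)

lemma test_function_continuous_partials: "\<phi> \<in> test_functions \<Omega> \<Longrightarrow> continuous_on S (partials \<alpha> \<phi>)"
  by (auto simp: test_functions_def intro!: continuous_at_imp_continuous_on differentiable_imp_continuous_within)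

section \<open>Radial bumps built from the flat exponential\<close>

text \<open>Meant as the argument of \<open>flat_exp\<close>: for a, b > 0 the composite is a smooth
  radial bump, positive exactly on the open ball of radius sqrt (a / b) around y.\<close>

definition quad :: "real \<Rightarrow> real \<Rightarrow> real^'n::finite \<Rightarrow> real^'n \<Rightarrow> real" where
  "quad a b y x = a - b * (norm (x - y))\<^sup>2"

lemma quad_sum: "quad a b y x = a - b * (\<Sum>i\<in>UNIV. (x $ i - y $ i) * (x $ i - y $ i))"
  by (simp add: quad_def power2_norm_eq_inner inner_vec_def)

lemma elementary_quad: "elementary (quad a b y)"
  unfolding quad_sum[abs_def] by (intro elementary_diff elementary_mult elementary_const elementary_sum
     elementary_coord) auto

lemma partial_quad: "partial i (quad a b y) x = - 2 * b * (x $ i - y $ i)"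
proof -
  have "(quad a b y has_derivative (\<lambda>h. - (b * (\<Sum>j\<in>UNIV. (x $ j - y $ j) * h $ j + h $ j * (x $ j - y $ j))))) (at x)"
    unfolding quad_sum[abs_def]
    by (auto intro!: derivative_eq_intros has_derivative_coord)
  from has_derivative_partial[OF this, of i] show ?thesis
    by (simp add: axis_def if_distrib[of "\<lambda>z. _ * z"] if_distrib[of "\<lambda>z. z * _"] sum.distrib cong: if_cong)
qed

lemma partial_flat_quad:
  "partial i (\<lambda>x. flat_exp m (quad a b y x)) x =
    (flat_exp (m + 2) (quad a b y x) - real m * flat_exp (m + 1) (quad a b y x)) * (- 2 * b * (x $ i - y $ i))"
  by (simp add: partial_flat_exp elementary_differentiable elementary_quad partial_quad)

text \<open>With s = |x - y|^2, the Laplacian of E(a - b s) is 4 b^2 s E'' - 2 b n E', where n is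
  the dimension; two applications of \<open>DERIV_flat_exp\<close> give E'' and E'. The explicit
  form serves three ends: the derivative of the mollifier in its radius, the symmetry of its
  Laplacian in x and y, and the bounds for the cut-off.\<close>

lemma laplacian_flat_quad:
  fixes x y :: "real^'n::finite"
  shows "laplacian (\<lambda>x. flat_exp m (quad a b y x)) x =
    4 * b\<^sup>2 * (norm (x - y))\<^sup>2 * (flat_exp (m + 4) (quad a b y x)
       - (2 * real m + 2) * flat_exp (m + 3) (quad a b y x) + real m * (real m + 1) * flat_exp (m + 2) (quad a b y x))
    - 2 * b * CARD('n) * (flat_exp (m + 2) (quad a b y x) - real m * flat_exp (m + 1) (quad a b y x))"
proof -
  define E where "E k x = flat_exp k (quad a b y x)" for k and x :: "real^'n"
  have dE: "E k differentiable (at x)" for k x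
    unfolding E_def by (intro elementary_differentiable elementary.intros elementary_quad)
  have pE: "partial i (E k) x = (E (k + 2) x - real k * E (k + 1) x) * (- 2 * b * (x $ i - y $ i))" for i k x
    unfolding E_def by (rule partial_flat_quad)
  have dl: "(\<lambda>x. - 2 * b * (x $ i - y $ i)) differentiable (at x)" for i and x :: "real^'n"
    by (intro elementary_differentiable elementary.intros elementary_diff)
  have pl: "partial i (\<lambda>x. - 2 * b * (x $ i - y $ i)) x = - 2 * b" for i and x :: "real^'n"
  proof -
    have "((\<lambda>x. - 2 * b * (x $ i - y $ i)) has_derivative (\<lambda>h. - 2 * b * (h $ i))) (at x)"
      by (rule derivative_eq_intros has_derivative_coord refl)+ auto
    from has_derivative_partial[OF this, of i] show ?thesis by (simp add: axis_def)
  qed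
  have pi: "partials [i, i] (E m) x =
      (E (m + 4) x - (2 * real m + 2) * E (m + 3) x + real m * (real m + 1) * E (m + 2) x) * (4 * b\<^sup>2 * (x $ i - y $ i)\<^sup>2)
      - 2 * b * (E (m + 2) x - real m * E (m + 1) x)" for i
  proof -
    have d1: "(\<lambda>x. E (m + 2) x - real m * E (m + 1) x) differentiable (at x)" for x
      by (intro differentiable_diff differentiable_mult dE differentiable_const)
    have p1: "partial i (\<lambda>x. E (m + 2) x - real m * E (m + 1) x) x =
        partial i (E (m + 2)) x - real m * partial i (E (m + 1)) x"
    proof -
      have "partial i (\<lambda>x. E (m + 2) x + (- real m) * E (m + 1) x) x =
         partial i (E (m + 2)) x + partial i (\<lambda>x. (- real m) * E (m + 1) x) x"
        by (intro partial_add dE differentiable_mult differentiable_const)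
      also have "partial i (\<lambda>x. (- real m) * E (m + 1) x) x = - real m * partial i (E (m + 1)) x"
        by (subst partial_mult) (auto simp: partial_const dE)
      finally show ?thesis by simp
    qed
    have "partials [i, i] (E m) x = partial i (\<lambda>x. (E (m + 2) x - real m * E (m + 1) x) * (- 2 * b * (x $ i - y $ i))) x"
      by (simp add: partials_def pE[abs_def])
    also have "\<dots> = (E (m + 2) x - real m * E (m + 1) x) * (- 2 * b)
       + (partial i (E (m + 2)) x - real m * partial i (E (m + 1)) x) * (- 2 * b * (x $ i - y $ i))"
      by (subst partial_mult[OF d1 dl]) (simp only: pl p1)
    also have "\<dots> = (E (m + 4) x - (2 * real m + 2) * E (m + 3) x + real m * (real m + 1) * E (m + 2) x) * (4 * b\<^sup>2 * (x $ i - y $ i)\<^sup>2)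
      - 2 * b * (E (m + 2) x - real m * E (m + 1) x)"
      by (simp add: pE power2_eq_square numeral_eq_Suc algebra_simps)
    finally show ?thesis .
  qed
  have n: "(norm (x - y))\<^sup>2 = (\<Sum>i\<in>UNIV. (x $ i - y $ i)\<^sup>2)"
    by (simp add: power2_norm_eq_inner inner_vec_def) (simp add: power2_eq_square)
  have "laplacian (E m) x = (\<Sum>i\<in>UNIV. (E (m + 4) x - (2 * real m + 2) * E (m + 3) x + real m * (real m + 1) * E (m + 2) x) * (4 * b\<^sup>2 * (x $ i - y $ i)\<^sup>2)
      - 2 * b * (E (m + 2) x - real m * E (m + 1) x))"
    by (simp add: laplacian_def pi)
  also have "\<dots> = (E (m + 4) x - (2 * real m + 2) * E (m + 3) x + real m * (real m + 1) * E (m + 2) x) * (4 * b\<^sup>2 * (norm (x - y))\<^sup>2)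
      - CARD('n) * (2 * b * (E (m + 2) x - real m * E (m + 1) x))"
    unfolding n by (simp only: sum_subtractf sum_distrib_left[symmetric]) (simp add: algebra_simps)
  finally show ?thesis unfolding E_def[abs_def] by (simp only: mult_ac)
qed

section \<open>Local integrability and weak derivatives\<close>

lemma integrable_lebesgue_on_subset:
  fixes f :: "'a::euclidean_space \<Rightarrow> real"
  assumes "integrable (lebesgue_on T) f" "S \<subseteq> T" "S \<in> sets lebesgue" "T \<in> sets lebesgue"
  shows "integrable (lebesgue_on S) f"
proof -
  have "integrable lebesgue (\<lambda>x. indicator S x *\<^sub>R (if x \<in> T then f x else 0))"
    using assms by (intro integrable_mult_indicator) (auto simp: Lebesgue_Measure.integrable_restrict_UNIV)
  also have "(\<lambda>x. indicator S x *\<^sub>R (if x \<in> T then f x else 0)) = (\<lambda>x. if x \<in> S then f x else 0)"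
    using assms(2) by (intro ext) (auto simp: indicator_def)
  finally show ?thesis using assms by (simp add: Lebesgue_Measure.integrable_restrict_UNIV)
qed

text \<open>Lebesgue measure is complete, so null sets are harmless. This matters because a weak
  derivative is only one chosen representative.\<close>

lemma borel_measurable_lebesgue_on_AE:
  fixes f h :: "'a::euclidean_space \<Rightarrow> real"
  assumes "f \<in> borel_measurable (lebesgue_on S)" "AE x in lebesgue_on S. f x = h x" "S \<in> sets lebesgue"
  shows "h \<in> borel_measurable (lebesgue_on S)"
proof -
  have "(\<lambda>x. if x \<in> S then h x else 0) \<in> borel_measurable lebesgue"
  proof (rule borel_measurable_AE)
    show "(\<lambda>x. if x \<in> S then f x else 0) \<in> borel_measurable lebesgue"
      using assms by (intro borel_measurable_if_I)
    show "AE x in lebesgue. (if x \<in> S then f x else 0) = (if x \<in> S then h x else 0)"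
      using assms(2,3) by (auto simp: AE_restrict_space_iff)
  qed
  then show ?thesis by (rule borel_measurable_if_D)
qed

lemma integrable_lebesgue_on_AE:
  fixes f h :: "'a::euclidean_space \<Rightarrow> real"
  assumes "integrable (lebesgue_on S) f" "AE x in lebesgue_on S. f x = h x" "S \<in> sets lebesgue"
  shows "integrable (lebesgue_on S) h"
  by (rule integrable_cong_AE_imp[OF assms(1) borel_measurable_lebesgue_on_AE[OF borel_measurable_integrable[OF assms(1)] assms(2,3)] assms(2)])

lemma integral_lebesgue_on_superset:
  fixes f :: "'a::euclidean_space \<Rightarrow> real"
  assumes "S \<subseteq> T" "S \<in> sets lebesgue" "T \<in> sets lebesgue" "\<And>x. x \<in> T \<Longrightarrow> x \<notin> S \<Longrightarrow> f x = 0"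
  shows "(LINT x|lebesgue_on T. f x) = (LINT x|lebesgue_on S. f x)"
    and "integrable (lebesgue_on T) f \<longleftrightarrow> integrable (lebesgue_on S) f"
proof -
  have eq: "(\<lambda>x. if x \<in> T then f x else 0) = (\<lambda>x. if x \<in> S then f x else 0)"
    using assms by (intro ext) auto
  show "(LINT x|lebesgue_on T. f x) = (LINT x|lebesgue_on S. f x)"
    using assms(2,3) by (simp add: Lebesgue_Measure.integral_restrict_UNIV[symmetric] eq)
  show "integrable (lebesgue_on T) f \<longleftrightarrow> integrable (lebesgue_on S) f"
    using assms(2,3) by (simp add: Lebesgue_Measure.integrable_restrict_UNIV[symmetric] eq)
qed

lemma integral_lebesgue_on_mono_set:
  fixes f :: "'a::euclidean_space \<Rightarrow> real"
  assumes "integrable (lebesgue_on T) f" "S \<subseteq> T" "S \<in> sets lebesgue" "T \<in> sets lebesgue" "\<And>x. 0 \<le> f x"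
  shows "(LINT x|lebesgue_on S. f x) \<le> (LINT x|lebesgue_on T. f x)"
proof -
  have "(LINT x|lebesgue. (if x \<in> S then f x else 0)) \<le> (LINT x|lebesgue. (if x \<in> T then f x else 0))"
    using assms integrable_lebesgue_on_subset[OF assms(1-4)]
    by (intro integral_mono) (auto simp: Lebesgue_Measure.integrable_restrict_UNIV)
  then show ?thesis using assms(3,4) by (simp add: Lebesgue_Measure.integral_restrict_UNIV)
qed

section \<open>The fundamental lemma of the calculus of variations\<close>

text \<open>The positive and negative parts, taken as densities, define two measures that agree on
  open boxes. Boxes form an intersection-stable generator, so the measures coincide; hence the two
  parts agree almost everywhere, and both vanish.\<close>

lemma AE_zero_of_box_integrals:
  fixes f :: "'a::euclidean_space \<Rightarrow> real"
  assumes f: "integrable lebesgue f"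
    and box: "\<And>a b. (LINT x|lebesgue. indicator (box a b) x * f x) = 0"
  shows "AE x in lebesgue. f x = 0"
proof -
  from f have "f \<in> borel_measurable lebesgue" by auto
  \<comment> \<open>A Borel version moves the problem from the completion to \<open>lborel\<close>,
    whose sets are generated by the boxes.\<close>
  then obtain f' where f': "f' \<in> borel_measurable lborel" and ae: "AE x in lborel. f x = f' x"
    using completion_ex_borel_measurable_real by blast
  have ae': "AE x in lebesgue. f x = f' x" using ae by (rule AE_completion)
  have f'm: "f' \<in> borel_measurable lebesgue" using f' by (simp add: measurable_completion)
  have f'i: "integrable lebesgue f'"
    using f f'm ae' by (metis integrable_cong_AE_imp eq_commute)
  then have i: "integrable lborel f'" using f' by (simp add: integrable_completion)
  have [measurable]: "f' \<in> borel_measurable borel" using f' by simp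
  have box': "(LINT x|lborel. indicator (box a b) x * f' x) = 0" for a b
  proof -
    have "(LINT x|lborel. indicator (box a b) x * f' x) = (LINT x|lebesgue. indicator (box a b) x * f' x)"
      by (subst integral_completion) auto
    also have "\<dots> = (LINT x|lebesgue. indicator (box a b) x * f x)"
      using ae' f f'm by (intro integral_cong_AE) (auto intro!: borel_measurable_times borel_measurable_indicator)
    finally show ?thesis using box by simp
  qed
  let ?M = "density lborel (\<lambda>x. ennreal (max 0 (f' x)))"
  let ?N = "density lborel (\<lambda>x. ennreal (max 0 (- f' x)))"
  \<comment> \<open>The factor s is 1 for the positive and -1 for the negative part.\<close>
  have em: "emeasure (density lborel (\<lambda>x. ennreal (max 0 (s * f' x)))) (box a b)
      = ennreal (LINT x|lborel. indicator (box a b) x * max 0 (s * f' x))" for a b and s :: real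
  proof -
    have ii: "integrable lborel (\<lambda>x. indicator (box a b) x *\<^sub>R max 0 (s * f' x))"
      using i by (intro integrable_mult_indicator integrable_max) auto
    have "emeasure (density lborel (\<lambda>x. ennreal (max 0 (s * f' x)))) (box a b)
       = (\<integral>\<^sup>+ x. ennreal (indicator (box a b) x *\<^sub>R max 0 (s * f' x)) \<partial>lborel)"
      by (subst emeasure_density) (auto intro!: nn_integral_cong simp: indicator_def)
    also have "\<dots> = ennreal (LINT x|lborel. indicator (box a b) x *\<^sub>R max 0 (s * f' x))"
      by (rule nn_integral_eq_integral[OF ii]) auto
    finally show ?thesis by simp
  qed
  have eq: "emeasure ?M (box a b) = emeasure ?N (box a b)" for a b
  proof -
    have ii: "integrable lborel (\<lambda>x. indicator (box a b) x *\<^sub>R max 0 (s * f' x))" for s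
      using i by (intro integrable_mult_indicator integrable_max) auto
    have "(LINT x|lborel. indicator (box a b) x * max 0 (f' x)) - (LINT x|lborel. indicator (box a b) x * max 0 (- f' x))
       = (LINT x|lborel. indicator (box a b) x * max 0 (f' x) - indicator (box a b) x * max 0 (- f' x))"
      using ii[of 1] ii[of "-1"] by (subst Bochner_Integration.integral_diff) auto
    also have "\<dots> = (LINT x|lborel. indicator (box a b) x * f' x)"
      by (intro Bochner_Integration.integral_cong) (auto simp: indicator_def)
    finally show ?thesis using box' em[of 1] em[of "-1"] by simp
  qed
  have "?M = ?N"
  proof (rule measure_eqI_generator_eq)
    let ?E = "range (\<lambda>(a, b). box a b::'a set)"
    show "Int_stable ?E" by (auto simp: Int_stable_def box_Int_box)
    show "?E \<subseteq> Pow UNIV" "sets ?M = sigma_sets UNIV ?E" "sets ?N = sigma_sets UNIV ?E"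
      by (simp_all add: borel_eq_box)
    let ?A = "\<lambda>n::nat. box (- (real n *\<^sub>R One)) (real n *\<^sub>R One) :: 'a set"
    show "range ?A \<subseteq> ?E" "(\<Union>i. ?A i) = UNIV"
      unfolding UN_box_eq_UNIV by auto
    show "emeasure ?M (?A i) \<noteq> \<infinity>" for i using em[of 1] by simp
    show "emeasure ?M X = emeasure ?N X" if "X \<in> ?E" for X
      using that eq by auto
  qed
  then have "AE x in lborel. ennreal (max 0 (f' x)) = ennreal (max 0 (- f' x))"
    by (subst sigma_finite_measure.density_unique_iff[OF sigma_finite_lborel, symmetric]) auto
  then have "AE x in lborel. f' x = 0"
    by eventually_elim (auto simp: max_def split: if_splits)
  with ae have "AE x in lborel. f x = 0" by eventually_elim auto
  then show ?thesis by (rule AE_completion)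
qed

lemma compactly_contained_mono: "compactly_contained U V \<Longrightarrow> V \<subseteq> W \<Longrightarrow> compactly_contained U W"
  by (auto simp: compactly_contained_def)

lemma compactly_contained_subset: "compactly_contained U V \<Longrightarrow> U \<subseteq> V"
  using closure_subset by (auto simp: compactly_contained_def)

lemma compactly_contained_lmeasurable:
  fixes U :: "'a::euclidean_space set"
  assumes "compactly_contained U V"
  shows "U \<in> lmeasurable"
proof (rule lmeasurable_open)
  show "bounded U"
    using assms bounded_subset[OF compact_imp_bounded closure_subset] by (auto simp: compactly_contained_def)
  show "open U" using assms by (simp add: compactly_contained_def)
qed

lemma compactly_contained_sets_lebesgue:
  fixes U :: "'a::euclidean_space set"
  shows "compactly_contained U V \<Longrightarrow> U \<in> sets lebesgue"
  by (simp add: compactly_contained_lmeasurable fmeasurableD)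

lemma measure_lebesgue_on_compactly_contained:
  fixes U :: "'a::euclidean_space set"
  assumes "compactly_contained U V" "V \<in> lmeasurable"
  shows "measure (lebesgue_on U) (space (lebesgue_on U)) \<le> measure lebesgue V"
  using compactly_contained_sets_lebesgue[OF assms(1)] compactly_contained_subset[OF assms(1)] assms(2)
  by (simp add: measure_restrict_space measure_mono_fmeasurable)

text \<open>The point is a single radius valid for all of K: it leaves room for mollifying at every
  point of K without leaving U.\<close>

lemma compactly_contained_nbhd:
  fixes K :: "'a::euclidean_space set"
  assumes "compact K" "open U" "K \<subseteq> U"
  obtains V e where "compactly_contained V U" "e > 0" "\<And>x. x \<in> K \<Longrightarrow> cball x e \<subseteq> V"
proof -
  obtain e where e: "e > 0" "(\<Union>x\<in>K. cball x e) \<subseteq> U"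
    using compact_subset_open_imp_cball_epsilon_subset[OF assms] by blast
  define V where "V = (\<Union>x\<in>K. ball x e)"
  have cpt: "compact (\<Union>x\<in>K. cball x e)"
    using compact_minkowski_sum_cball[OF assms(1), of e] by simp
  have cl: "closure V \<subseteq> (\<Union>x\<in>K. cball x e)"
    unfolding V_def using cpt by (intro closure_minimal compact_imp_closed) auto
  have "compactly_contained V U"
    unfolding compactly_contained_def
  proof (intro conjI)
    show "open V" by (auto simp: V_def)
    show "compact (closure V)"
      using cpt cl by (meson closure_subset bounded_subset compact_closure compact_imp_bounded order_trans)
    show "closure V \<subseteq> U" using cl e by auto
  qed
  moreover have "cball x (e / 2) \<subseteq> V" if "x \<in> K" for x
    using that e by (force simp: V_def)
  ultimately show ?thesis using that[of V "e / 2"] e by auto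
qed

lemma Lq_loc_1_iff:
  "v \<in> Lq_loc 1 \<Omega> \<longleftrightarrow> (\<forall>U. compactly_contained U \<Omega> \<longrightarrow> integrable (lebesgue_on U) v)"
  unfolding Lq_loc_def Lq_def
  by (auto dest: borel_measurable_integrable simp: integrable_abs_iff)

text \<open>The continuous factor is bounded on K and vanishes off K, so only the integrability of v
  near K counts.\<close>

lemma Lq_loc_1_mult:
  fixes v :: "'a::euclidean_space \<Rightarrow> real"
  assumes "v \<in> Lq_loc 1 U" "open U" "continuous_on UNIV \<phi>" "compact K" "K \<subseteq> U" "\<And>x. x \<notin> K \<Longrightarrow> \<phi> x = 0"
  shows "integrable (lebesgue_on U) (\<lambda>x. v x * \<phi> x)"
proof -
  obtain V e where V: "compactly_contained V U" "e > 0" "\<And>x. x \<in> K \<Longrightarrow> cball x e \<subseteq> V"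
    using compactly_contained_nbhd assms by metis
  then have KV: "K \<subseteq> V" by force
  have Vs: "V \<in> sets lebesgue" using V compactly_contained_sets_lebesgue by blast
  have v: "integrable (lebesgue_on V) v" using V assms(1) by (simp add: Lq_loc_1_iff)
  have "bounded (\<phi> ` K)"
    using assms by (intro compact_imp_bounded compact_continuous_image) (auto intro: continuous_on_subset)
  then obtain B where B: "\<And>x. x \<in> K \<Longrightarrow> \<bar>\<phi> x\<bar> \<le> B" by (auto simp: bounded_iff)
  have phi: "\<phi> \<in> borel_measurable (lebesgue_on V)"
    using assms(3) by (meson continuous_imp_measurable_on_sets_lebesgue continuous_on_subset Vs subset_UNIV)
  have "integrable (lebesgue_on V) (\<lambda>x. v x * \<phi> x)"
  proof (rule Bochner_Integration.integrable_bound[where f="\<lambda>x. \<bar>B\<bar> * v x"])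
    show "AE x in lebesgue_on V. norm (v x * \<phi> x) \<le> norm (\<bar>B\<bar> * v x)"
    proof (rule AE_I2)
      fix x
      have "\<bar>\<phi> x\<bar> \<le> \<bar>B\<bar>" using B[of x] assms(6)[of x] by (cases "x \<in> K") auto
      then show "norm (v x * \<phi> x) \<le> norm (\<bar>B\<bar> * v x)"
        by (simp add: abs_mult mult.commute[of "\<bar>v x\<bar>"] mult_right_mono)
    qed
  qed (use v phi in auto)
  then show ?thesis
    using KV assms compactly_contained_subset[OF V(1)] Vs
    by (subst integral_lebesgue_on_superset(2)[of V]) auto
qed

lemma test_function_support:
  assumes "\<phi> \<in> test_functions \<Omega>"
  obtains K where "compact K" "K \<subseteq> \<Omega>" "\<And>\<alpha> x. x \<notin> K \<Longrightarrow> partials \<alpha> \<phi> x = 0"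
  using that[of "closure {x. \<phi> x \<noteq> 0}"] assms partials_zero_off_support
  by (auto simp: test_functions_def)

lemma Lq_loc_1_mult_test:
  assumes "v \<in> Lq_loc 1 U" "open U" "\<phi> \<in> test_functions U"
  shows "integrable (lebesgue_on U) (\<lambda>x. v x * partials \<alpha> \<phi> x)"
proof -
  obtain K where "compact K" "K \<subseteq> U" "\<And>\<alpha> x. x \<notin> K \<Longrightarrow> partials \<alpha> \<phi> x = 0"
    using test_function_support[OF assms(3)] by blast
  then show ?thesis
    by (intro Lq_loc_1_mult[OF assms(1,2) test_function_continuous_partials[OF assms(3)]])
qed

lemma partials_Nil: "partials [] \<phi> = \<phi>" by (simp add: partials_def)

text \<open>Smooth functions converging boundedly to the indicator of a box show that all box
  integrals of h vanish inside a closed box contained in U; countably many such closed boxes exhaust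
  U.\<close>

lemma Lq_loc_1_AE_zero:
  fixes h :: "real^'n::finite \<Rightarrow> real"
  assumes h: "h \<in> Lq_loc 1 U" and U: "open U"
    and zero: "\<And>\<phi>. \<phi> \<in> test_functions U \<Longrightarrow> (LINT x|lebesgue_on U. h x * \<phi> x) = 0"
  shows "AE x in lebesgue_on U. h x = 0"
proof -
  have Us: "U \<in> sets lebesgue" using U by simp
  have AEbox: "AE x in lebesgue. x \<in> cbox a b \<longrightarrow> h x = 0" if ab: "cbox a b \<subseteq> U" for a b
  proof -
    have "compactly_contained (box a b) U"
      using ab unfolding compactly_contained_def
      by (cases "box a b = {}") auto
    then have "integrable (lebesgue_on (box a b)) h" using h by (simp add: Lq_loc_1_iff)
    define f where "f x = (if x \<in> box a b then h x else 0)" for x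
    have f: "integrable lebesgue f"
      unfolding f_def using \<open>integrable (lebesgue_on (box a b)) h\<close>
      by (subst Lebesgue_Measure.integrable_restrict_UNIV) auto
    have "AE x in lebesgue. f x = 0"
    proof (rule AE_zero_of_box_integrals[OF f])
      fix c d :: "real^'n"
      have "\<exists>a' b'. box c d \<inter> box a b = box a' b'" unfolding box_Int_box by blast
      then obtain a' b' where ab': "box c d \<inter> box a b = box a' b'" by blast
      \<comment> \<open>For s > 0 the factor exp (-1 / (k s)) tends to 1, and for s \<le> 0 it is
        replaced by 0. So the product stays between 0 and 1, vanishes off the box and tends to its
        indicator.\<close>
      define \<psi> where "\<psi> k x = (\<Prod>i\<in>UNIV. flat_exp 0 (real k * (x $ i - a' $ i)) * flat_exp 0 (real k * (b' $ i - x $ i)))"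
        for k and x :: "real^'n"
      have elem: "elementary (\<psi> k)" for k
        unfolding \<psi>_def by (intro elementary_prod elementary.intros elementary_diff) auto
      have psi0: "\<psi> k x = 0" if "x \<notin> box a' b'" for k x
      proof -
        from that obtain i where "\<not> (a' $ i < x $ i \<and> x $ i < b' $ i)" by (auto simp: mem_box_cart)
        then have "flat_exp 0 (real k * (x $ i - a' $ i)) * flat_exp 0 (real k * (b' $ i - x $ i)) = 0"
          by (auto simp: flat_exp_def zero_less_mult_iff)
        then show ?thesis unfolding \<psi>_def by (meson UNIV_I finite prod_zero)
      qed
      have E1: "0 \<le> flat_exp 0 t \<and> flat_exp 0 t \<le> 1" for t by (simp add: flat_exp_def)
      have psi1: "0 \<le> \<psi> k x \<and> \<psi> k x \<le> 1" for k x
        unfolding \<psi>_def using E1 by (auto intro!: prod_nonneg prod_le_1 mult_le_one)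
      have lim: "(\<lambda>k. \<psi> k x) \<longlonglongrightarrow> indicator (box a' b') x" for x
      proof (cases "x \<in> box a' b'")
        case False then show ?thesis by (simp add: psi0)
      next
        case True
        have E: "(\<lambda>k. flat_exp 0 (real k * t)) \<longlonglongrightarrow> 1" if "t > 0" for t
        proof -
          have "(\<lambda>k. exp (- (1 / t) * (1 / real k))) \<longlonglongrightarrow> exp (- (1 / t) * 0)"
            by (intro tendsto_intros lim_1_over_n)
          then show ?thesis
            using that by (rule_tac Lim_transform_eventually) (auto simp: flat_exp_def eventually_sequentially mult.commute intro!: exI[of _ 1])
        qed
        have "(\<lambda>k. \<psi> k x) \<longlonglongrightarrow> (\<Prod>i\<in>(UNIV::'n set). 1 * 1)"
          unfolding \<psi>_def using True by (intro tendsto_intros E) (auto simp: mem_box_cart)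
        then show ?thesis using True by simp
      qed
      have sub: "box a' b' \<subseteq> box a b" using ab' by auto
      have test: "\<psi> k \<in> test_functions U" for k
        using sub box_subset_cbox[of a b]
        by (intro elementary_test_function[OF elem compact_cbox ab] psi0) auto
      have z: "(LINT x|lebesgue. \<psi> k x * f x) = 0" for k
      proof -
        have "(LINT x|lebesgue. \<psi> k x * f x) = (LINT x|lebesgue. (if x \<in> U then h x * \<psi> k x else 0))"
          using sub psi0 ab box_subset_cbox[of a b]
          by (intro Bochner_Integration.integral_cong refl) (simp add: f_def subset_iff; metis)
        also have "\<dots> = 0" using zero[OF test] Us by (simp add: Lebesgue_Measure.integral_restrict_UNIV)
        finally show ?thesis .
      qed
      have fm: "f \<in> borel_measurable lebesgue" using f by auto
      have pm: "\<psi> k \<in> borel_measurable lebesgue" for k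
        using elementary_continuous[OF elem, of UNIV] 
        by (simp add: borel_measurable_continuous_onI measurable_completion)
      have "(\<lambda>k. LINT x|lebesgue. \<psi> k x * f x) \<longlonglongrightarrow> (LINT x|lebesgue. indicator (box a' b') x * f x)"
      proof (rule integral_dominated_convergence[where w="\<lambda>x. \<bar>f x\<bar>"])
        show "AE x in lebesgue. (\<lambda>k. \<psi> k x * f x) \<longlonglongrightarrow> indicator (box a' b') x * f x"
          using lim by (intro AE_I2 tendsto_intros)
        show "AE x in lebesgue. norm (\<psi> k x * f x) \<le> \<bar>f x\<bar>" for k
          using psi1 by (intro AE_I2) (auto simp: abs_mult intro: mult_left_le_one_le)
      qed (use f fm pm in \<open>auto intro!: borel_measurable_times borel_measurable_indicator\<close>)
      then have "(LINT x|lebesgue. indicator (box a' b') x * f x) = 0"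
        using z by (simp add: LIMSEQ_const_iff)
      also have "(LINT x|lebesgue. indicator (box a' b') x * f x) = (LINT x|lebesgue. indicator (box c d) x * f x)"
        using ab' by (intro Bochner_Integration.integral_cong) (auto simp: f_def indicator_def)
      finally show "(LINT x|lebesgue. indicator (box c d) x * f x) = 0" .
    qed
    moreover have "AE x in lebesgue. x \<notin> cbox a b - box a b"
      by (rule AE_not_in) (use negligible_frontier_interval[of a b] in \<open>simp add: negligible_iff_null_sets\<close>)
    ultimately show ?thesis by eventually_elim (auto simp: f_def split: if_splits)
  qed
  obtain \<D> where D: "countable \<D>" "\<D> \<subseteq> Pow U" "\<And>X. X \<in> \<D> \<Longrightarrow> \<exists>a b. X = cbox a b" "\<Union>\<D> = U"
    using open_countable_Union_open_cbox[OF U] by metis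
  have "AE x in lebesgue. x \<in> X \<longrightarrow> h x = 0" if X: "X \<in> \<D>" for X
  proof -
    obtain a b where "X = cbox a b" using D(3)[OF X] by blast
    moreover have "X \<subseteq> U" using D(2) X by blast
    ultimately show ?thesis using AEbox by simp
  qed
  then have "AE x in lebesgue. \<forall>X\<in>\<D>. x \<in> X \<longrightarrow> h x = 0"
    using D(1) by (intro AE_ball_countable[THEN iffD2]) auto
  then have "AE x in lebesgue. x \<in> U \<longrightarrow> h x = 0"
  proof eventually_elim
    case (elim x)
    then show ?case using D(4) by blast
  qed
  then show ?thesis using Us by (simp add: AE_restrict_space_iff)
qed

section \<open>Restriction, uniqueness and gluing of weak derivatives\<close>

lemma has_weak_derivative_subset:
  assumes w: "has_weak_derivative U \<alpha> u v" and V: "open V" "V \<subseteq> U" "open U"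
  shows "has_weak_derivative V \<alpha> u v"
proof -
  have loc: "z \<in> Lq_loc 1 U \<Longrightarrow> z \<in> Lq_loc 1 V" for z
    unfolding Lq_loc_def using compactly_contained_mono[OF _ V(2)] by blast
  have "(LINT x|lebesgue_on V. u x * partials \<alpha> \<phi> x) = (-1) ^ length \<alpha> * (LINT x|lebesgue_on V. v x * \<phi> x)"
    if phi: "\<phi> \<in> test_functions V" for \<phi>
  proof -
    obtain K where K: "compact K" "K \<subseteq> V" "\<And>\<alpha> x. x \<notin> K \<Longrightarrow> partials \<alpha> \<phi> x = 0"
      using test_function_support[OF phi] by blast
    have "(LINT x|lebesgue_on U. z x * partials \<beta> \<phi> x) = (LINT x|lebesgue_on V. z x * partials \<beta> \<phi> x)" for z \<beta>
      using V K by (intro integral_lebesgue_on_superset(1)) auto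
    from this[of u \<alpha>] this[of v "[]"] show ?thesis
      using w phi test_functions_mono[OF V(2)] by (auto simp: has_weak_derivative_def partials_Nil)
  qed
  with w loc show ?thesis by (auto simp: has_weak_derivative_def)
qed

lemma has_weak_derivative_unique:
  assumes "has_weak_derivative U \<alpha> u v" "has_weak_derivative U \<alpha> u v'" "open U"
  shows "AE x in lebesgue_on U. v x = v' x"
proof -
  have v: "v \<in> Lq_loc 1 U" "v' \<in> Lq_loc 1 U" using assms by (auto simp: has_weak_derivative_def)
  have "AE x in lebesgue_on U. v x - v' x = 0"
  proof (rule Lq_loc_1_AE_zero[OF _ assms(3)])
    show "(\<lambda>x. v x - v' x) \<in> Lq_loc 1 U" using v by (simp add: Lq_loc_1_iff)
    fix \<phi> assume phi: "\<phi> \<in> test_functions U"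
    have "(-1) ^ length \<alpha> * (LINT x|lebesgue_on U. v x * \<phi> x) = (-1) ^ length \<alpha> * (LINT x|lebesgue_on U. v' x * \<phi> x)"
      using assms phi by (auto simp: has_weak_derivative_def)
    then have "(LINT x|lebesgue_on U. v x * \<phi> x) = (LINT x|lebesgue_on U. v' x * \<phi> x)" by simp
    then show "(LINT x|lebesgue_on U. (v x - v' x) * \<phi> x) = 0"
      using v[THEN Lq_loc_1_mult_test[OF _ assms(3) phi, of _ "[]"]]
      by (simp add: left_diff_distrib partials_Nil)
  qed
  then show ?thesis by simp
qed

lemma has_weak_derivative_AE:
  assumes "has_weak_derivative U \<alpha> u v" "open U" "AE x in lebesgue_on U. v x = v' x"
  shows "has_weak_derivative U \<alpha> u v'"
proof -
  have Us: "U \<in> sets lebesgue" using assms(2) by simp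
  have v: "v \<in> Lq_loc 1 U" using assms(1) by (auto simp: has_weak_derivative_def)
  have "v' \<in> Lq_loc 1 U"
    unfolding Lq_loc_1_iff
  proof (intro allI impI)
    fix V assume V: "compactly_contained V U"
    note Vs = compactly_contained_sets_lebesgue[OF V]
    have "AE x in lebesgue. x \<in> U \<longrightarrow> v x = v' x"
      using assms(3) Us by (simp add: AE_restrict_space_iff)
    then have "AE x in lebesgue. x \<in> V \<longrightarrow> v x = v' x"
    proof eventually_elim
      case (elim x)
      then show ?case using compactly_contained_subset[OF V] by blast
    qed
    then have "AE x in lebesgue_on V. v x = v' x"
      using Vs by (simp add: AE_restrict_space_iff)
    moreover have "integrable (lebesgue_on V) v" using v V by (simp add: Lq_loc_1_iff)
    ultimately show "integrable (lebesgue_on V) v'"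
      using Vs integrable_lebesgue_on_AE by blast
  qed
  moreover have "(LINT x|lebesgue_on U. v x * \<phi> x) = (LINT x|lebesgue_on U. v' x * \<phi> x)"
    if phi: "\<phi> \<in> test_functions U" for \<phi>
  proof (rule integral_cong_AE)
    show "AE x in lebesgue_on U. v x * \<phi> x = v' x * \<phi> x" using assms(3) by eventually_elim auto
    show "(\<lambda>x. v x * \<phi> x) \<in> borel_measurable (lebesgue_on U)" "(\<lambda>x. v' x * \<phi> x) \<in> borel_measurable (lebesgue_on U)"
      using Lq_loc_1_mult_test[OF v assms(2) phi, of "[]"] Lq_loc_1_mult_test[OF \<open>v' \<in> _\<close> assms(2) phi, of "[]"]
      by (auto simp: partials_Nil intro: borel_measurable_integrable)
  qed
  ultimately show ?thesis using assms(1) by (auto simp: has_weak_derivative_def)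
qed

text \<open>The local Sobolev class provides a weak derivative on each compactly contained set
  separately, while \<open>weak_derivative \<Omega>\<close> is a choice on the whole of \<Omega>;
  without a global witness that choice would carry no information. The local derivatives agree
  almost everywhere on overlaps and are glued along a countable exhaustion.\<close>

lemma has_weak_derivative_local:
  assumes \<Omega>: "open \<Omega>" and loc: "\<And>U. compactly_contained U \<Omega> \<Longrightarrow> \<exists>v. has_weak_derivative U \<alpha> u v"
  shows "\<exists>v. has_weak_derivative \<Omega> \<alpha> u v"
proof -
  obtain C where C: "\<And>n. compact (C n)" "\<And>n. C n \<subseteq> \<Omega>" "\<And>n. C n \<subseteq> interior (C (Suc n))"
     "\<Union>(range C) = \<Omega>" "\<And>K. compact K \<Longrightarrow> K \<subseteq> \<Omega> \<Longrightarrow> \<exists>N. \<forall>n\<ge>N. K \<subseteq> C n"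
    using open_Union_compact_subsets[OF \<Omega>] by metis
  define U where "U n = interior (C n)" for n :: nat
  have cl: "closure (U n) \<subseteq> C n" for n
    unfolding U_def using C(1) by (simp add: closure_minimal compact_imp_closed interior_subset)
  have cc: "compactly_contained (U n) \<Omega>" for n
    using cl[of n] C(1,2)[of n] unfolding compactly_contained_def U_def
    by (meson closure_subset bounded_subset compact_closure compact_imp_bounded open_interior order_trans)
  have UO: "open (U n)" for n by (simp add: U_def)
  have Us: "U n \<in> sets lebesgue" for n using cc compactly_contained_sets_lebesgue by blast
  have mono: "U m \<subseteq> U n" if "m \<le> n" for m n
    unfolding U_def using C(3) interior_subset by (intro lift_Suc_mono_le[OF _ that]) blast
  have "\<forall>n. \<exists>v. has_weak_derivative (U n) \<alpha> u v" using cc loc by blast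
  from choice[OF this] obtain v where v: "\<And>n. has_weak_derivative (U n) \<alpha> u (v n)" by blast
  \<comment> \<open>The least index makes w one function. On U k it can differ from v k only on the
    finitely many null sets where some v j with j \<le> k disagrees with v k.\<close>
  define w where "w x = v (LEAST n. x \<in> U n) x" for x
  have ae: "AE x in lebesgue_on (U k). v k x = w x" for k
  proof -
    have "AE x in lebesgue. x \<in> U j \<longrightarrow> v j x = v k x" if "j \<le> k" for j
      using has_weak_derivative_unique[OF v[of j] has_weak_derivative_subset[OF v[of k] UO mono[OF that] UO] UO] Us[of j]
      by (simp add: AE_restrict_space_iff)
    then have "AE x in lebesgue. \<forall>j\<in>{..k}. x \<in> U j \<longrightarrow> v j x = v k x"
      by (intro AE_ball_countable[THEN iffD2]) auto
    then have "AE x in lebesgue. x \<in> U k \<longrightarrow> v k x = w x"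
    proof eventually_elim
      case (elim x)
      show ?case
      proof
        assume x: "x \<in> U k"
        have "x \<in> U (LEAST n. x \<in> U n)" using x by (rule LeastI)
        moreover have "(LEAST n. x \<in> U n) \<le> k" using x by (rule Least_le)
        ultimately show "v k x = w x" using elim by (auto simp: w_def)
      qed
    qed
    then show ?thesis using Us[of k] by (simp add: AE_restrict_space_iff)
  qed
  have hw: "has_weak_derivative (U k) \<alpha> u w" for k
    using has_weak_derivative_AE[OF v UO ae] .
  have cov: "\<exists>n. K \<subseteq> U n" if "compact K" "K \<subseteq> \<Omega>" for K
    using C(5)[OF that] C(3) unfolding U_def by (meson order_refl order_trans)
  have "u \<in> Lq_loc 1 \<Omega> \<and> w \<in> Lq_loc 1 \<Omega>"
  proof -
    have "integrable (lebesgue_on V) u \<and> integrable (lebesgue_on V) w" if V: "compactly_contained V \<Omega>" for V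
    proof -
      obtain n where "closure V \<subseteq> U n" using cov V unfolding compactly_contained_def by metis
      then have "compactly_contained V (U n)" using V by (auto simp: compactly_contained_def)
      then show ?thesis using hw[of n] by (auto simp: has_weak_derivative_def Lq_loc_1_iff)
    qed
    then show ?thesis by (auto simp: Lq_loc_1_iff)
  qed
  moreover have "(LINT x|lebesgue_on \<Omega>. u x * partials \<alpha> \<phi> x) = (-1) ^ length \<alpha> * (LINT x|lebesgue_on \<Omega>. w x * \<phi> x)"
    if phi: "\<phi> \<in> test_functions \<Omega>" for \<phi>
  proof -
    have K: "compact (closure {x. \<phi> x \<noteq> 0})" "closure {x. \<phi> x \<noteq> 0} \<subseteq> \<Omega>"
      using phi by (auto simp: test_functions_def)
    obtain n where n: "closure {x. \<phi> x \<noteq> 0} \<subseteq> U n" using cov[OF K] by blast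
    then have "\<phi> \<in> test_functions (U n)" using phi by (auto simp: test_functions_def)
    moreover have "(LINT x|lebesgue_on \<Omega>. z x * partials \<beta> \<phi> x) = (LINT x|lebesgue_on (U n). z x * partials \<beta> \<phi> x)" for z \<beta>
      using \<Omega> n Us compactly_contained_subset[OF cc]
      by (intro integral_lebesgue_on_superset(1)) (auto intro!: partials_zero_off_support)
    from this[of u \<alpha>] this[of w "[]"] calculation show ?thesis
      using hw[of n] by (auto simp: has_weak_derivative_def partials_Nil)
  qed
  ultimately show ?thesis by (auto simp: has_weak_derivative_def)
qed

section \<open>Mollifiers\<close>

lemma sigma_finite_lebesgue: "sigma_finite_measure (lebesgue :: 'a::euclidean_space measure)"
proof
  show "\<exists>A. countable A \<and> A \<subseteq> sets (lebesgue :: 'a measure) \<and> \<Union>A = space lebesgue \<and> (\<forall>a\<in>A. emeasure lebesgue a \<noteq> \<infinity>)"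
  proof (intro exI conjI)
    show "countable (range (\<lambda>n::nat. ball (0::'a) (real n)))" by simp
    show "\<Union>(range (\<lambda>n::nat. ball (0::'a) (real n))) = space lebesgue"
      using reals_Archimedean2 by auto
    show "\<forall>a\<in>range (\<lambda>n::nat. ball (0::'a) (real n)). emeasure lebesgue a \<noteq> \<infinity>"
      using emeasure_bounded_finite by (auto simp: less_top)
  qed auto
qed

text \<open>The kernel is bounded, so the integrand is dominated by a multiple of |f x * w y|, which
  is integrable on the product. Every exchange of a mollification between two factors goes through
  this lemma.\<close>

lemma kernel_Fubini:
  fixes f w :: "'a::euclidean_space \<Rightarrow> real" and k :: "'a \<Rightarrow> 'a \<Rightarrow> real"
  assumes f: "integrable lebesgue f" and w: "integrable lebesgue w"
    and k: "continuous_on UNIV (\<lambda>(x, y). k x y)" and B: "\<And>x y. \<bar>k x y\<bar> \<le> B"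
  shows "integrable lebesgue (\<lambda>x. f x * (LINT y|lebesgue. w y * k x y))"
    and "(LINT x|lebesgue. f x * (LINT y|lebesgue. w y * k x y)) = (LINT y|lebesgue. w y * (LINT x|lebesgue. f x * k x y))"
proof -
  interpret L: sigma_finite_measure "lebesgue :: 'a measure" by (rule sigma_finite_lebesgue)
  interpret P: pair_sigma_finite "lebesgue :: 'a measure" "lebesgue :: 'a measure" ..
  let ?P = "lebesgue \<Otimes>\<^sub>M lebesgue :: ('a \<times> 'a) measure"
  have [measurable]: "f \<in> borel_measurable lebesgue" "w \<in> borel_measurable lebesgue" using f w by auto
  \<comment> \<open>The kernel is continuous, hence Borel; it is measurable on the product of the
    completed measures because the identity into the Borel sets is.\<close>
  have id: "(\<lambda>x. x) \<in> (lebesgue :: 'a measure) \<rightarrow>\<^sub>M borel"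
    by (simp add: measurable_completion)
  have "(\<lambda>p. (fst p, snd p)) \<in> ?P \<rightarrow>\<^sub>M borel \<Otimes>\<^sub>M borel"
    using measurable_compose[OF measurable_fst id] measurable_compose[OF measurable_snd id]
    by (rule measurable_Pair)
  then have pm: "(\<lambda>p. p) \<in> ?P \<rightarrow>\<^sub>M borel" by (simp add: borel_prod)
  have km: "(\<lambda>(x, y). k x y) \<in> borel_measurable ?P"
    using measurable_compose[OF pm borel_measurable_continuous_onI[OF k]] by simp
  have i0: "integrable ?P (\<lambda>(x, y). f x * w y)"
  proof (rule P.Fubini_integrable)
    show "(\<lambda>(x, y). f x * w y) \<in> borel_measurable ?P" by measurable
    show "integrable lebesgue (\<lambda>x. LINT y|lebesgue. norm (case (x, y) of (x, y) \<Rightarrow> f x * w y))"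
      using f by (simp add: abs_mult)
    show "AE x in lebesgue. integrable lebesgue (\<lambda>y. case (x, y) of (x, y) \<Rightarrow> f x * w y)"
      using w by simp
  qed
  have i1: "integrable ?P (\<lambda>(x, y). f x * (w y * k x y))"
  proof (rule Bochner_Integration.integrable_bound[where f="\<lambda>p. B * (case p of (x, y) \<Rightarrow> f x * w y)"])
    show "integrable ?P (\<lambda>p. B * (case p of (x, y) \<Rightarrow> f x * w y))" using i0 by simp
    show "(\<lambda>(x, y). f x * (w y * k x y)) \<in> borel_measurable ?P"
    proof -
      have "(\<lambda>p. (case p of (x, y) \<Rightarrow> f x * w y) * (case p of (x, y) \<Rightarrow> k x y)) \<in> borel_measurable ?P"
        by (intro borel_measurable_times km) measurable
      then show ?thesis by (simp add: case_prod_beta mult.assoc)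
    qed
    show "AE p in ?P. norm (case p of (x, y) \<Rightarrow> f x * (w y * k x y)) \<le> norm (B * (case p of (x, y) \<Rightarrow> f x * w y))"
    proof (rule AE_I2, clarify)
      fix x y
      have "\<bar>f x * w y\<bar> * \<bar>k x y\<bar> \<le> \<bar>f x * w y\<bar> * \<bar>B\<bar>"
        using B[of x y] by (intro mult_left_mono) auto
      then show "norm (f x * (w y * k x y)) \<le> norm (B * (f x * w y))"
        by (simp add: abs_mult mult_ac)
    qed
  qed
  show "integrable lebesgue (\<lambda>x. f x * (LINT y|lebesgue. w y * k x y))"
    using P.integrable_fst[OF i1] by simp
  show "(LINT x|lebesgue. f x * (LINT y|lebesgue. w y * k x y)) = (LINT y|lebesgue. w y * (LINT x|lebesgue. f x * k x y))"
  proof -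
    have "(LINT x|lebesgue. f x * (w y * k x y)) = w y * (LINT x|lebesgue. f x * k x y)" for y
    proof -
      have "(\<lambda>x. f x * (w y * k x y)) = (\<lambda>x. w y * (f x * k x y))" by (simp add: fun_eq_iff)
      then show ?thesis by simp
    qed
    then show ?thesis using P.Fubini_integral[OF i1] by simp
  qed
qed

text \<open>Dominated convergence along sequences: on the convex set S the mean value inequality
  bounds all difference quotients by B.\<close>

lemma has_field_derivative_integral:
  fixes k k' :: "real \<Rightarrow> 'a \<Rightarrow> real" and w :: "'a \<Rightarrow> real"
  assumes S: "convex S" "t \<in> S" and w: "integrable M w"
    and der: "\<And>t y. t \<in> S \<Longrightarrow> ((\<lambda>t. k t y) has_real_derivative k' t y) (at t within S)"
    and B: "\<And>t y. t \<in> S \<Longrightarrow> \<bar>k' t y\<bar> \<le> B"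
    and int: "\<And>t. t \<in> S \<Longrightarrow> integrable M (\<lambda>y. w y * k t y)"
    and meas: "(\<lambda>y. w y * k' t y) \<in> borel_measurable M"
  shows "((\<lambda>t. LINT y|M. w y * k t y) has_real_derivative (LINT y|M. w y * k' t y)) (at t within S)"
  unfolding has_field_derivative_iff tendsto_at_iff_sequentially comp_def
proof (intro allI impI)
  fix X :: "nat \<Rightarrow> real"
  assume X: "\<forall>i. X i \<in> S - {t}" "X \<longlonglongrightarrow> t"
  have eq: "((LINT y|M. w y * k (X i) y) - (LINT y|M. w y * k t y)) / (X i - t) =
     (LINT y|M. w y * ((k (X i) y - k t y) / (X i - t)))" for i
  proof -
    have "(LINT y|M. w y * k (X i) y) - (LINT y|M. w y * k t y) = (LINT y|M. w y * k (X i) y - w y * k t y)"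
      using X(1) S int by (intro Bochner_Integration.integral_diff[symmetric]) auto
    then show ?thesis by (simp add: right_diff_distrib[symmetric])
  qed
  have "(\<lambda>i. LINT y|M. w y * ((k (X i) y - k t y) / (X i - t))) \<longlonglongrightarrow> (LINT y|M. w y * k' t y)"
  proof (rule integral_dominated_convergence[where w="\<lambda>y. B * \<bar>w y\<bar>"])
    show "(\<lambda>y. w y * ((k (X i) y - k t y) / (X i - t))) \<in> borel_measurable M" for i
    proof -
      have "(\<lambda>y. (w y * k (X i) y - w y * k t y) / (X i - t)) \<in> borel_measurable M"
        using X(1) S int[THEN borel_measurable_integrable] by (intro borel_measurable_divide borel_measurable_diff) auto
      then show ?thesis by (simp add: right_diff_distrib[symmetric])
    qed
    show "integrable M (\<lambda>y. B * \<bar>w y\<bar>)" using w by simp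
    show "AE y in M. (\<lambda>i. w y * ((k (X i) y - k t y) / (X i - t))) \<longlonglongrightarrow> w y * k' t y"
    proof (intro AE_I2 tendsto_intros)
      fix y
      show "(\<lambda>i. (k (X i) y - k t y) / (X i - t)) \<longlonglongrightarrow> k' t y"
        using der[OF S(2), of y] X
        unfolding has_field_derivative_iff tendsto_at_iff_sequentially comp_def by blast
    qed
    show "AE y in M. norm (w y * ((k (X i) y - k t y) / (X i - t))) \<le> B * \<bar>w y\<bar>" for i
    proof (rule AE_I2)
      fix y
      have "norm (k (X i) y - k t y) \<le> B * norm (X i - t)"
        using X(1) S der B by (intro field_differentiable_bound[of S _ "\<lambda>t. k' t y"]) auto
      moreover have "X i \<noteq> t" using X(1) by auto
      ultimately have "\<bar>(k (X i) y - k t y) / (X i - t)\<bar> \<le> B"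
        by (simp add: pos_divide_le_eq)
      then show "norm (w y * ((k (X i) y - k t y) / (X i - t))) \<le> B * \<bar>w y\<bar>"
        unfolding real_norm_def abs_mult[of "w y"] mult.commute[of B] by (rule mult_left_mono) simp
    qed
  qed (use meas in auto)
  then show "(\<lambda>i. ((LINT y|M. w y * k (X i) y) - (LINT y|M. w y * k t y)) / (X i - t)) \<longlonglongrightarrow> (LINT y|M. w y * k' t y)"
    by (simp add: eq)
qed

section \<open>The mollifier and its dependence on the radius\<close>

text \<open>The kernel is not normalised. The profile has index 2 because \<open>flat_exp 2\<close>
  is the derivative of \<open>flat_exp 0\<close>: with E_m for \<open>flat_exp m\<close>, z E_2(1 -
  |z|^2) is then -1/2 times the gradient of E_0(1 - |z|^2), which is what makes the derivative in t
  a Laplacian.\<close>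

definition moll :: "real \<Rightarrow> real^'n::finite \<Rightarrow> real^'n \<Rightarrow> real" where
  "moll t x y = flat_exp 2 (quad 1 (1 / t\<^sup>2) x y) / t ^ CARD('n)"

text \<open>Indexed by a type since the value depends on the dimension alone; by scaling it is the
  integral of \<open>moll t x\<close> for every t > 0.\<close>

definition moll_mass :: "'n::finite itself \<Rightarrow> real" where
  "moll_mass _ = (LINT z|lborel. flat_exp 2 (quad 1 1 0 (z::real^'n)))"

lemma quad_commute: "quad a b x y = quad a b y x"
  by (simp add: quad_def norm_minus_commute)

lemma moll_commute: "moll t x y = moll t y x"
  by (simp add: moll_def quad_commute)

lemma quad_pos_iff: "t > 0 \<Longrightarrow> 0 < quad 1 (1 / t\<^sup>2) x y \<longleftrightarrow> dist x y < t"
  by (simp add: quad_def dist_norm norm_minus_commute pos_divide_less_eq) (meson norm_ge_zero order_less_imp_le pos2 power_less_imp_less_base power_strict_mono)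

lemma moll_zero: "t > 0 \<Longrightarrow> t \<le> dist x y \<Longrightarrow> moll t x y = 0"
  using quad_pos_iff[of t x y] by (auto simp: moll_def flat_exp_def)

lemma continuous_quad [continuous_intros]: "continuous_on UNIV (\<lambda>(x, y). quad a b x y)"
  unfolding quad_def case_prod_beta by (intro continuous_intros)

lemma continuous_flat_quad: "continuous_on UNIV (\<lambda>(x, y). flat_exp m (quad a b x y))"
  using continuous_on_compose2[OF continuous_flat_exp[of UNIV m] continuous_quad[of a b]]
  by (simp add: case_prod_beta)

lemma continuous_moll: "continuous_on UNIV (\<lambda>(x, y). moll t x (y::real^'n::finite))"
  unfolding moll_def using continuous_flat_quad[of 2 1 "1 / t\<^sup>2"]
  by (cases "t = 0") (auto simp: case_prod_beta power_0_left intro!: continuous_intros)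

lemma moll_bound:
  assumes "t > 0"
  shows "0 \<le> moll t x y \<and> moll t x (y::real^'n::finite) \<le> 2 / t ^ CARD('n)"
  using assms flat_exp_le_fact[of 2] flat_exp_nonneg[of 2]
  by (auto simp: moll_def fact_numeral intro!: divide_right_mono)

lemma elementary_flat_quad: "elementary (\<lambda>y. flat_exp m (quad a b x y))"
  by (intro elementary_flat_exp elementary_quad)

lemma elementary_moll: "elementary (moll t x)"
  using elementary_mult[OF elementary_const[of "1 / t ^ CARD('a)"] elementary_flat_quad[of 2 1 "1 / t\<^sup>2" x]]
  by (simp add: moll_def[abs_def])

lemma laplacian_scale:
  assumes "elementary f"
  shows "laplacian (\<lambda>x. c * f x) x = c * laplacian f x"
proof -
  have 1: "partial i (\<lambda>x. c * h x) = (\<lambda>x. c * partial i h x)" if "elementary h" for i h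
    using that by (intro ext) (simp add: partial_mult partial_const elementary_differentiable)
  show ?thesis
    unfolding laplacian_def partials_def using assms
    by (simp add: 1 elementary_partial sum_distrib_left)
qed

lemma laplacian_moll:
  fixes x y :: "real^'n::finite"
  shows "laplacian (moll t x) y = 1 / t ^ CARD('n) * laplacian (\<lambda>y. flat_exp 2 (quad 1 (1 / t\<^sup>2) x y)) y"
  by (subst laplacian_scale[OF elementary_flat_quad, symmetric]) (simp add: moll_def[abs_def])

lemma laplacian_moll_commute: "laplacian (moll t x) y = laplacian (moll t y) x"
  by (simp only: laplacian_moll laplacian_flat_quad norm_minus_commute[of x y] quad_commute[of _ _ x y])

text \<open>Where \<open>quad\<close> is positive, b |x - y|^2 \<le> a; elsewhere all terms vanish.
  What remains is the bound k! for each \<open>flat_exp k\<close>.\<close>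

lemma laplacian_flat_quad_bound:
  fixes x y :: "real^'n::finite"
  assumes "b \<ge> 0" "a \<ge> 0"
  shows "\<bar>laplacian (\<lambda>y. flat_exp m (quad a b x y)) y\<bar> \<le>
    4 * b * a * (fact (m + 4) + (2 * real m + 2) * fact (m + 3) + real m * (real m + 1) * fact (m + 2))
     + 2 * b * CARD('n) * (fact (m + 2) + real m * fact (m + 1))"
proof -
  define Q where "Q = quad a b x y"
  define A where "A = flat_exp (m + 4) Q - (2 * real m + 2) * flat_exp (m + 3) Q + real m * (real m + 1) * flat_exp (m + 2) Q"
  define A' where "A' = flat_exp (m + 2) Q - real m * flat_exp (m + 1) Q"
  have E: "\<bar>flat_exp k Q\<bar> \<le> fact k" for k using flat_exp_le_fact[of k Q] flat_exp_nonneg[of k Q] by linarith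
  have A: "\<bar>A\<bar> \<le> fact (m + 4) + (2 * real m + 2) * fact (m + 3) + real m * (real m + 1) * fact (m + 2)"
    unfolding A_def
    by (rule order_trans[OF abs_triangle_ineq], rule add_mono, rule order_trans[OF abs_triangle_ineq4])
       (auto simp: abs_mult simp del: fact_Suc intro!: add_mono mult_left_mono E)
  have A': "\<bar>A'\<bar> \<le> fact (m + 2) + real m * fact (m + 1)"
    unfolding A'_def
    by (rule order_trans[OF abs_triangle_ineq4])
       (auto simp: abs_mult simp del: fact_Suc intro!: add_mono mult_left_mono E)
  have "\<bar>b * (norm (y - x))\<^sup>2 * A\<bar> \<le> a * \<bar>A\<bar>"
  proof (cases "Q > 0")
    case True
    then have "b * (norm (y - x))\<^sup>2 \<le> a" by (simp add: Q_def quad_def)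
    then show ?thesis using assms by (simp add: abs_mult mult_right_mono)
  qed (use assms in \<open>simp add: A_def flat_exp_def\<close>)
  also have "\<dots> \<le> a * (fact (m + 4) + (2 * real m + 2) * fact (m + 3) + real m * (real m + 1) * fact (m + 2))"
    using A assms by (intro mult_left_mono) auto
  finally have 1: "\<bar>4 * b * (b * (norm (y - x))\<^sup>2 * A)\<bar> \<le> 4 * b * (a * (fact (m + 4) + (2 * real m + 2) * fact (m + 3) + real m * (real m + 1) * fact (m + 2)))"
    using assms by (simp only: abs_mult[of "4 * b"]) (simp add: mult_left_mono)
  have 2: "\<bar>2 * b * CARD('n) * A'\<bar> \<le> 2 * b * CARD('n) * (fact (m + 2) + real m * fact (m + 1))"
    using A' assms by (simp only: abs_mult[of "2 * b * CARD('n)"]) (simp add: mult_left_mono)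
  have "laplacian (\<lambda>y. flat_exp m (quad a b x y)) y = 4 * b * (b * (norm (y - x))\<^sup>2 * A) - 2 * b * CARD('n) * A'"
    by (simp only: laplacian_flat_quad A_def A'_def Q_def power2_eq_square mult_ac)
  then show ?thesis using 1 2 abs_triangle_ineq4[of "4 * b * (b * (norm (y - x))\<^sup>2 * A)" "2 * b * CARD('n) * A'"]
    by (simp only: mult.assoc)
qed

text \<open>With z = (y - x) / t and profile p, the derivative in t of t^(-n) p(z) is -t^(-n-1) div
  (z p(z)). Here z p(z) is -1/2 times a gradient, so a Laplacian in z appears, and returning from z
  to y contributes t^2. The proof checks this against the explicit formula for the
  Laplacian.\<close>

lemma DERIV_moll:
  fixes x y :: "real^'n::finite"
  assumes "t > 0"
  shows "((\<lambda>t. moll t x y) has_real_derivative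
     t / (2 * t ^ CARD('n)) * laplacian (\<lambda>y. flat_exp 0 (quad 1 (1 / t\<^sup>2) x y)) y) (at t)"
proof -
  define Z where "Z = (norm (y - x))\<^sup>2"
  define N where "N = CARD('n)"
  have d1: "((\<lambda>t. 1 - 1 / t\<^sup>2 * Z) has_real_derivative 2 * Z / t ^ 3) (at t)"
    using assms by (auto intro!: derivative_eq_intros simp: field_simps power2_eq_square power3_eq_cube)
  have d2: "((\<lambda>t. flat_exp 2 (1 - 1 / t\<^sup>2 * Z)) has_real_derivative
      (flat_exp (2 + 2) (1 - 1 / t\<^sup>2 * Z) - real 2 * flat_exp (2 + 1) (1 - 1 / t\<^sup>2 * Z)) * (2 * Z / t ^ 3)) (at t)"
    by (rule DERIV_chain2[OF DERIV_flat_exp d1])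
  have d3: "((\<lambda>t. t ^ N) has_real_derivative real N * t ^ (N - 1)) (at t)"
    by (auto intro!: derivative_eq_intros)
  \<comment> \<open>The dimension is positive, so the truncated exponent N - 1 is a true
    predecessor.\<close>
  have N: "t ^ N = t ^ (N - 1) * t" using zero_less_card_finite[where 'a='n]
    by (metis N_def power_minus_mult)
  have d: "((\<lambda>t. flat_exp 2 (1 - 1 / t\<^sup>2 * Z) / t ^ N) has_real_derivative
     ((flat_exp (2 + 2) (1 - 1 / t\<^sup>2 * Z) - real 2 * flat_exp (2 + 1) (1 - 1 / t\<^sup>2 * Z)) * (2 * Z / t ^ 3) * t ^ N
       - flat_exp 2 (1 - 1 / t\<^sup>2 * Z) * (real N * t ^ (N - 1))) / (t ^ N * t ^ N)) (at t)"
    by (rule DERIV_divide[OF d2 d3]) (use assms in auto)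
  have "((\<lambda>t. moll t x y) has_real_derivative ((flat_exp 4 (1 - 1 / t\<^sup>2 * Z) - 2 * flat_exp 3 (1 - 1 / t\<^sup>2 * Z)) * (2 * Z / t ^ 3) * t ^ N
       - flat_exp 2 (1 - 1 / t\<^sup>2 * Z) * (real N * t ^ (N - 1))) / (t ^ N * t ^ N)) (at t)"
    using d by (simp add: moll_def quad_def N_def Z_def)
  moreover have "((e4 - 2 * e3) * (2 * Z / t ^ 3) * t ^ N - e2 * (real N * t ^ (N - 1))) / (t ^ N * t ^ N) =
      t / (2 * t ^ N) * (4 * (1 / t\<^sup>2)\<^sup>2 * Z * (e4 - 2 * e3) - 2 * (1 / t\<^sup>2) * real N * e2)" for e2 e3 e4
    using assms unfolding N by (simp add: field_simps power2_eq_square power3_eq_cube)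
  moreover have "laplacian (\<lambda>y. flat_exp 0 (quad 1 (1 / t\<^sup>2) x y)) y = 4 * (1 / t\<^sup>2)\<^sup>2 * Z *
      (flat_exp 4 (1 - 1 / t\<^sup>2 * Z) - 2 * flat_exp 3 (1 - 1 / t\<^sup>2 * Z)) - 2 * (1 / t\<^sup>2) * real N * flat_exp 2 (1 - 1 / t\<^sup>2 * Z)"
    by (subst laplacian_flat_quad) (simp add: quad_def Z_def N_def, simp add: numeral_2_eq_2)
  ultimately show ?thesis by (simp only: N_def)
qed

lemma mult_bounded_integrable:
  fixes w :: "'a::euclidean_space \<Rightarrow> real"
  assumes "integrable lebesgue w" "continuous_on UNIV k" "\<And>y. \<bar>k y\<bar> \<le> B"
  shows "integrable lebesgue (\<lambda>y. w y * k y)"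
proof (rule Bochner_Integration.integrable_bound[where f="\<lambda>y. B * w y"])
  have "k \<in> borel_measurable lebesgue"
    using assms(2) by (simp add: borel_measurable_continuous_onI measurable_completion)
  then show "(\<lambda>y. w y * k y) \<in> borel_measurable lebesgue" using assms(1) by auto
  show "AE y in lebesgue. norm (w y * k y) \<le> norm (B * w y)"
  proof (rule AE_I2)
    fix y show "norm (w y * k y) \<le> norm (B * w y)"
      using assms(3)[of y] by (simp add: abs_mult mult.commute[of "\<bar>w y\<bar>"] mult_right_mono)
  qed
qed (use assms in auto)

text \<open>A substitute for the mean value property: the derivative of the average in the radius is
  w paired with the Laplacian of a bump supported in \<open>cball x e\<close>, which is an
  admissible test function, and so it is 0.\<close>

lemma moll_average_const:
  fixes w :: "real^'n::finite \<Rightarrow> real"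
  assumes w: "integrable lebesgue w"
    and harm: "\<And>\<phi>. \<phi> \<in> test_functions V \<Longrightarrow> (LINT y|lebesgue. w y * laplacian \<phi> y) = 0"
    and s: "0 < s" "s \<le> e" "cball x e \<subseteq> V"
  shows "(LINT y|lebesgue. w y * moll s x y) = (LINT y|lebesgue. w y * moll e x y)"
proof -
  define L where "L t y = laplacian (\<lambda>y. flat_exp 0 (quad 1 (1 / t\<^sup>2) x y)) y" for t y
  \<comment> \<open>From \<open>laplacian_flat_quad_bound\<close> with m = 0, a = 1 and b = 1 / t^2:
    4 (4! + 2 * 3!) = 144, and 2 * 2! = 4 in front of the dimension.\<close>
  define B where "B = 144 + 4 * real CARD('n)"
  have L: "\<bar>L t y\<bar> \<le> B / t\<^sup>2" for t y
    using laplacian_flat_quad_bound[of "1 / t\<^sup>2" 1 0 x y]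
    by (simp add: L_def B_def fact_numeral add_divide_distrib)
  have Lc: "continuous_on UNIV (L t)" for t
    unfolding L_def by (intro elementary_continuous elementary_laplacian elementary_flat_quad)
  have der: "((\<lambda>t. LINT y|lebesgue. w y * moll t x y) has_real_derivative 0) (at t within {s..e})"
    if t: "t \<in> {s..e}" for t
  proof -
    have "((\<lambda>t. LINT y|lebesgue. w y * moll t x y) has_real_derivative
        (LINT y|lebesgue. w y * (t / (2 * t ^ CARD('n)) * L t y))) (at t within {s..e})"
    proof (rule has_field_derivative_integral[OF _ t w])
      show "((\<lambda>t. moll t x y) has_real_derivative t / (2 * t ^ CARD('n)) * L t y) (at t within {s..e})"
        if "t \<in> {s..e}" for t y
        unfolding L_def using that s DERIV_moll[of t x y] by (simp add: has_field_derivative_at_within)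
      show "\<bar>t / (2 * t ^ CARD('n)) * L t y\<bar> \<le> e / (2 * s ^ CARD('n)) * (B / s\<^sup>2)"
        if t: "t \<in> {s..e}" for t y
      proof -
        have "B / t\<^sup>2 \<le> B / s\<^sup>2"
          using t s by (intro divide_left_mono power_mono) (auto simp: B_def)
        then have "\<bar>L t y\<bar> \<le> B / s\<^sup>2" using L[of t y] by linarith
        moreover have "t / (2 * t ^ CARD('n)) \<le> e / (2 * s ^ CARD('n))"
          using t s by (intro frac_le mult_left_mono power_mono) auto
        moreover have "0 \<le> t / (2 * t ^ CARD('n))" using t s by auto
        ultimately show ?thesis unfolding abs_mult by (intro mult_mono) auto
      qed
      show "integrable lebesgue (\<lambda>y. w y * moll t x y)" if "t \<in> {s..e}" for t
        using that s moll_bound[of t x]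
        by (intro mult_bounded_integrable[OF w elementary_continuous[OF elementary_moll]]) auto
      show "(\<lambda>y. w y * (t / (2 * t ^ CARD('n)) * L t y)) \<in> borel_measurable lebesgue"
        using mult_bounded_integrable[OF w Lc L, of t] borel_measurable_times[of "\<lambda>_. t / (2 * t ^ CARD('n))" lebesgue "\<lambda>y. w y * L t y"]
        by (simp add: mult.left_commute borel_measurable_integrable)
    qed simp
    also have "(LINT y|lebesgue. w y * (t / (2 * t ^ CARD('n)) * L t y)) = 0"
    proof -
      have "(\<lambda>y. flat_exp 0 (quad 1 (1 / t\<^sup>2) x y)) \<in> test_functions V"
      proof (rule elementary_test_function[OF elementary_flat_quad])
        show "compact (cball x e)" "cball x e \<subseteq> V" using s by auto
        show "flat_exp 0 (quad 1 (1 / t\<^sup>2) x y) = 0" if "y \<notin> cball x e" for y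
          using that t s quad_pos_iff[of t x y] by (intro flat_exp_nonpos_arg) auto
      qed
      then have "(LINT y|lebesgue. w y * L t y) = 0" using harm by (simp add: L_def)
      then show ?thesis by (simp add: mult.left_commute)
    qed
    finally show ?thesis .
  qed
  obtain c where "\<forall>t\<in>{s..e}. (LINT y|lebesgue. w y * moll t x y) = c"
    using has_field_derivative_zero_constant[OF _ der] by auto
  then show ?thesis using s by auto
qed

text \<open>The profile is positive exactly on the unit ball; mass zero would make that ball a null
  set.\<close>

lemma moll_mass_pos: "moll_mass TYPE('n::finite) > 0"
proof -
  let ?f = "\<lambda>z::real^'n. flat_exp 2 (quad 1 1 0 z)"
  have q: "quad 1 1 0 z > 0 \<longleftrightarrow> z \<in> ball 0 1" for z :: "real^'n" using quad_pos_iff[of 1 0 z] by simp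
  have i: "integrable lborel ?f"
  proof -
    have "integrable lborel (\<lambda>z. indicator (cball 0 1) z *\<^sub>R ?f z)"
      by (intro borel_integrable_compact elementary_continuous elementary_flat_quad) auto
    moreover have "(\<lambda>z. indicator (cball 0 1) z *\<^sub>R ?f z) = ?f"
      using q by (intro ext) (force simp: indicator_def flat_exp_def)
    ultimately show ?thesis by simp
  qed
  have nn: "0 \<le> moll_mass TYPE('n)"
    unfolding moll_mass_def by (intro integral_nonneg_AE) (auto simp: flat_exp_nonneg)
  moreover have "moll_mass TYPE('n) \<noteq> 0"
  proof
    assume "moll_mass TYPE('n) = 0"
    then have "AE z in lborel. ?f z = 0"
      using integral_nonneg_eq_0_iff_AE[OF i] by (auto simp: moll_mass_def flat_exp_nonneg)
    then have "AE z in lborel. z \<notin> ball (0::real^'n) 1"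
      by eventually_elim (metis q flat_exp_pos less_irrefl)
    then have "AE z in lebesgue. z \<notin> ball (0::real^'n) 1" by (rule AE_completion)
    then have "negligible (ball (0::real^'n) 1)"
      by (subst negligible_iff_null_sets, subst AE_iff_null_sets) auto
    then show False using open_not_negligible[of "ball (0::real^'n) 1"] by auto
  qed
  ultimately show ?thesis by linarith
qed

text \<open>Substituting x = y + t z moves the radius into the argument of \<psi>, where the limit
  of vanishing radius can be taken under the integral.\<close>

lemma moll_integral_substitution:
  fixes \<psi> :: "real^'n::finite \<Rightarrow> real"
  assumes "continuous_on UNIV \<psi>" "t > 0"
  shows "(LINT x|lebesgue. \<psi> x * moll t x y) = (LINT z|lborel. flat_exp 2 (quad 1 1 0 z) * \<psi> (y + t *\<^sub>R z))"
proof -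
  let ?h = "\<lambda>x. \<psi> x * moll t x y"
  have hm: "?h \<in> borel_measurable borel"
    using assms(1) elementary_continuous[OF elementary_moll[of t y], of UNIV]
    by (intro borel_measurable_continuous_onI continuous_intros) (auto simp: moll_commute[of t _ y])
  have "(LINT x|lebesgue. ?h x) = (LINT x|lborel. ?h x)" using hm by (simp add: integral_completion)
  also have "\<dots> = (LINT x|density (distr lborel borel (\<lambda>z. y + t *\<^sub>R z)) (\<lambda>_. ennreal (\<bar>t\<bar> ^ DIM(real^'n))). ?h x)"
    using assms(2) by (subst lborel_affine[of t y]) auto
  also have "\<dots> = (LINT z|lborel. t ^ CARD('n) * ?h (y + t *\<^sub>R z))"
    using hm assms(2) by (subst integral_density) (auto simp: integral_distr)
  also have "\<dots> = (LINT z|lborel. flat_exp 2 (quad 1 1 0 z) * \<psi> (y + t *\<^sub>R z))"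
  proof (intro Bochner_Integration.integral_cong refl)
    fix z
    have "quad 1 (1 / t\<^sup>2) (y + t *\<^sub>R z) y = quad 1 1 0 z"
      using assms(2) by (simp add: quad_def power_mult_distrib)
    then show "t ^ CARD('n) * ?h (y + t *\<^sub>R z) = flat_exp 2 (quad 1 1 0 z) * \<psi> (y + t *\<^sub>R z)"
      using assms(2) by (simp add: moll_def)
  qed
  finally show ?thesis .
qed

section \<open>Weyl's lemma\<close>

text \<open>On K the average of radius e equals the average of any smaller radius t. Paired with a
  test function \<phi>, Fubini shifts the kernel to \<phi>, and t tending to 0 gives the mass times
  the pairing of w with \<phi>. Thus w and its normalised average agree as distributions on K; only
  mollifications of the smooth \<phi> have to converge.\<close>

theorem weyl_moll:
  fixes w :: "real^'n::finite \<Rightarrow> real"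
  assumes w: "integrable lebesgue w"
    and harm: "\<And>\<phi>. \<phi> \<in> test_functions V \<Longrightarrow> (LINT y|lebesgue. w y * laplacian \<phi> y) = 0"
    and K: "open K" "0 < e" "\<And>x. x \<in> K \<Longrightarrow> cball x e \<subseteq> V"
  shows "AE x in lebesgue. x \<in> K \<longrightarrow> w x = (LINT y|lebesgue. w y * moll e x y) / moll_mass TYPE('n)"
proof -
  define c where "c = moll_mass TYPE('n)"
  have c: "c > 0" by (simp add: c_def moll_mass_pos)
  define A where "A t x = (LINT y|lebesgue. w y * moll t x y)" for t x
  have mb: "\<bar>moll t x y\<bar> \<le> 2 / t ^ CARD('n)" if "t > 0" for t and x y :: "real^'n"
    using moll_bound[OF that, of x y] by simp
  have Ks: "K \<in> sets lebesgue" using K by simp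
  have "AE x in lebesgue_on K. w x - A e x / c = 0"
  proof (rule Lq_loc_1_AE_zero[OF _ K(1)])
    show "(\<lambda>x. w x - A e x / c) \<in> Lq_loc 1 K"
      unfolding Lq_loc_1_iff
    proof (intro allI impI)
      fix U assume U: "compactly_contained U K"
      note Us = compactly_contained_sets_lebesgue[OF U]
      have i1: "integrable (lebesgue_on U) w"
        by (rule integrable_lebesgue_on_subset[OF _ subset_UNIV Us]) (simp_all add: lebesgue_on_UNIV_eq w)
      have "integrable lebesgue (indicat_real U)"
        using compactly_contained_lmeasurable[OF U] by (simp add: lmeasurable_iff_integrable)
      from kernel_Fubini(1)[OF this w continuous_moll mb[OF K(2)]]
      have "integrable lebesgue (\<lambda>x. if x \<in> U then A e x else 0)"
        by (simp add: A_def indicator_def of_bool_def if_distrib[of "\<lambda>z. z * _"] cong: if_cong)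
      then have "integrable (lebesgue_on U) (A e)" using Us by (simp add: Lebesgue_Measure.integrable_restrict_UNIV)
      with i1 show "integrable (lebesgue_on U) (\<lambda>x. w x - A e x / c)" by simp
    qed
    fix \<phi> assume phi: "\<phi> \<in> test_functions K"
    obtain S where S: "compact S" "S \<subseteq> K" "\<And>x. x \<notin> S \<Longrightarrow> \<phi> x = 0"
      using test_function_support[OF phi] partials_Nil by metis
    have cont: "continuous_on X \<phi>" for X
      using test_function_continuous_partials[OF phi, of X "[]"] by (simp add: partials_Nil)
    have "bounded (\<phi> ` S)" using S cont by (intro compact_imp_bounded compact_continuous_image)
    then obtain B0 where "\<And>x. x \<in> S \<Longrightarrow> \<bar>\<phi> x\<bar> \<le> B0" by (auto simp: bounded_iff)
    then have B: "\<bar>\<phi> x\<bar> \<le> \<bar>B0\<bar>" for x using S(3)[of x] by (cases "x \<in> S") force+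
    have iphi: "integrable lebesgue \<phi>"
    proof -
      have "integrable lebesgue (indicat_real S)"
        using lmeasurable_compact[OF S(1)] by (simp add: lmeasurable_iff_integrable)
      from mult_bounded_integrable[OF this cont B]
      have "integrable lebesgue (\<lambda>x. indicat_real S x * \<phi> x)" .
      moreover have "(\<lambda>x. indicat_real S x * \<phi> x) = \<phi>" using S(3) by (intro ext) (auto simp: indicator_def)
      ultimately show ?thesis by simp
    qed
    have iwphi: "integrable lebesgue (\<lambda>x. w x * \<phi> x)" by (rule mult_bounded_integrable[OF w cont B])
    have iA: "integrable lebesgue (\<lambda>x. \<phi> x * A e x)"
      unfolding A_def by (rule kernel_Fubini(1)[OF iphi w continuous_moll mb[OF K(2)]])
    define E where "E z = flat_exp 2 (quad 1 1 0 z)" for z :: "real^'n"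
    define J where "J t y = (LINT z|lborel. E z * \<phi> (y + t *\<^sub>R z))" for t y
    have AJ: "(LINT x|lebesgue. \<phi> x * A e x) = (LINT y|lebesgue. w y * J t y)" if t: "0 < t" "t \<le> e" for t
    proof -
      \<comment> \<open>Off K the averages need not agree, but there \<phi> vanishes.\<close>
      have "\<phi> x * A e x = \<phi> x * A t x" for x
      proof (cases "x \<in> K")
        case True
        then show ?thesis unfolding A_def using moll_average_const[OF w harm t K(3)] by simp
      next
        case False
        then show ?thesis using S by auto
      qed
      then have "(LINT x|lebesgue. \<phi> x * A e x) = (LINT x|lebesgue. \<phi> x * A t x)" by (simp only:)
      also have "\<dots> = (LINT y|lebesgue. w y * (LINT x|lebesgue. \<phi> x * moll t x y))"
        unfolding A_def by (rule kernel_Fubini(2)[OF iphi w continuous_moll mb[OF t(1)]])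
      finally show ?thesis by (simp add: J_def E_def moll_integral_substitution[OF cont t(1)])
    qed
    \<comment> \<open>The Bochner integral of a non-integrable function is 0 by convention, so a
      positive mass already implies integrability.\<close>
    have Ei: "integrable lborel (\<lambda>z. E z)"
      using moll_mass_pos[where 'n='n] not_integrable_integral_eq unfolding moll_mass_def E_def by fastforce
    have E0: "0 \<le> E z" for z by (simp add: E_def flat_exp_nonneg)
    have phim: "(\<lambda>z. \<phi> (y + t *\<^sub>R z)) \<in> borel_measurable borel" for y t
      by (intro borel_measurable_continuous_onI continuous_on_compose2[OF cont[of UNIV]] continuous_intros) auto
    have fm: "(\<lambda>z. E z) \<in> borel_measurable borel"
      unfolding E_def by (intro borel_measurable_continuous_onI elementary_continuous elementary_flat_quad)
    have Jb: "\<bar>J t y\<bar> \<le> \<bar>B0\<bar> * c" for t y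
    proof -
      have "norm (J t y) \<le> (LINT z|lborel. \<bar>B0\<bar> * E z)"
        unfolding J_def
      proof (rule Bochner_Integration.integral_norm_bound_integral)
        show "integrable lborel (\<lambda>z. E z * \<phi> (y + t *\<^sub>R z))"
        proof (rule Bochner_Integration.integrable_bound[where f="\<lambda>z. \<bar>B0\<bar> * E z"])
          show "AE z in lborel. norm (E z * \<phi> (y + t *\<^sub>R z)) \<le> norm (\<bar>B0\<bar> * E z)"
            using B by (intro AE_I2) (auto simp: abs_mult mult.commute[of "\<bar>B0\<bar>"] intro!: mult_left_mono)
        qed (use Ei phim fm in auto)
        show "norm (E z * \<phi> (y + t *\<^sub>R z)) \<le> \<bar>B0\<bar> * E z" for z
          using B E0[of z] by (auto simp: abs_mult mult.commute[of "\<bar>B0\<bar>"] intro!: mult_left_mono)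
      qed (use Ei in auto)
      then show ?thesis by (simp add: c_def moll_mass_def E_def)
    qed
    define T where "T n = e / real (Suc n)" for n
    have T: "0 < T n" "T n \<le> e" for n using K(2) by (auto simp: T_def field_simps)
    have T0: "T \<longlonglongrightarrow> 0" unfolding T_def using tendsto_mult_left[OF LIMSEQ_inverse_real_of_nat, of e] by (simp add: divide_inverse)
    have Jlim: "(\<lambda>n. J (T n) y) \<longlonglongrightarrow> c * \<phi> y" for y
    proof -
      have "(\<lambda>n. J (T n) y) \<longlonglongrightarrow> (LINT z|lborel. E z * \<phi> y)"
        unfolding J_def
      proof (rule integral_dominated_convergence[where w="\<lambda>z. \<bar>B0\<bar> * E z"])
        show "AE z in lborel. (\<lambda>n. E z * \<phi> (y + T n *\<^sub>R z)) \<longlonglongrightarrow> E z * \<phi> y"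
        proof (rule AE_I2)
          fix z
          have "isCont \<phi> y" using cont[of UNIV] by (simp add: continuous_on_eq_continuous_at)
          moreover have "(\<lambda>n. y + T n *\<^sub>R z) \<longlonglongrightarrow> y" using tendsto_add[OF tendsto_const tendsto_scaleR[OF T0 tendsto_const], of y z] by simp
          ultimately show "(\<lambda>n. E z * \<phi> (y + T n *\<^sub>R z)) \<longlonglongrightarrow> E z * \<phi> y"
            by (intro tendsto_intros) (rule isCont_tendsto_compose)
        qed
        show "AE z in lborel. norm (E z * \<phi> (y + T n *\<^sub>R z)) \<le> \<bar>B0\<bar> * E z" for n
          using B E0 by (intro AE_I2) (auto simp: abs_mult mult.commute[of "\<bar>B0\<bar>"] intro!: mult_left_mono)
      qed (use Ei phim fm in auto)
      then show ?thesis by (simp add: c_def moll_mass_def E_def)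
    qed
    have "(\<lambda>n. LINT y|lebesgue. w y * J (T n) y) \<longlonglongrightarrow> (LINT y|lebesgue. w y * (c * \<phi> y))"
    proof (rule integral_dominated_convergence[where w="\<lambda>y. \<bar>B0\<bar> * c * \<bar>w y\<bar>"])
      show "AE y in lebesgue. (\<lambda>n. w y * J (T n) y) \<longlonglongrightarrow> w y * (c * \<phi> y)"
        by (intro AE_I2 tendsto_intros Jlim)
      show "AE y in lebesgue. norm (w y * J (T n) y) \<le> \<bar>B0\<bar> * c * \<bar>w y\<bar>" for n
        using Jb by (intro AE_I2) (auto simp: abs_mult mult.commute[of _ "\<bar>w _\<bar>"] intro!: mult_left_mono)
      show "(\<lambda>y. w y * J (T n) y) \<in> borel_measurable lebesgue" for n
      proof -
        have "integrable lebesgue (\<lambda>y. w y * (LINT x|lebesgue. \<phi> x * moll (T n) y x))"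
          by (rule kernel_Fubini(1)[OF w iphi continuous_moll mb[OF T(1)]])
        then show ?thesis
          unfolding J_def E_def moll_integral_substitution[OF cont T(1), symmetric]
          by (subst moll_commute) (rule borel_measurable_integrable)
      qed
      show "(\<lambda>y. w y * (c * \<phi> y)) \<in> borel_measurable lebesgue"
        using iwphi by (simp add: mult.left_commute[of _ c] borel_measurable_integrable)
    qed (use w in auto)
    then have "(LINT x|lebesgue. \<phi> x * A e x) = (LINT y|lebesgue. w y * (c * \<phi> y))"
      using AJ[OF T] by (simp add: LIMSEQ_const_iff)
    then have eq: "(LINT x|lebesgue. \<phi> x * A e x) = c * (LINT y|lebesgue. w y * \<phi> y)"
      by (simp add: mult.left_commute[of _ c])
    have "(LINT x|lebesgue_on K. (w x - A e x / c) * \<phi> x) = (LINT x|lebesgue. (if x \<in> K then (w x - A e x / c) * \<phi> x else 0))"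
      using Ks by (simp add: Lebesgue_Measure.integral_restrict_UNIV)
    also have "\<dots> = (LINT x|lebesgue. w x * \<phi> x - \<phi> x * A e x / c)"
    proof (intro Bochner_Integration.integral_cong refl)
      fix x
      have "x \<notin> K \<Longrightarrow> \<phi> x = 0" using S by blast
      then show "(if x \<in> K then (w x - A e x / c) * \<phi> x else 0) = w x * \<phi> x - \<phi> x * A e x / c"
        by (auto simp: algebra_simps)
    qed
    also have "\<dots> = (LINT x|lebesgue. w x * \<phi> x) - (LINT x|lebesgue. \<phi> x * A e x) / c"
      using iwphi iA by simp
    also have "\<dots> = 0" using eq c by simp
    finally show "(LINT x|lebesgue_on K. (w x - A e x / c) * \<phi> x) = 0" .
  qed
  then have "AE x in lebesgue. x \<in> K \<longrightarrow> w x - A e x / c = 0" using Ks by (simp add: AE_restrict_space_iff)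
  then show ?thesis by eventually_elim (auto simp: A_def c_def)
qed

section \<open>Testing a weakly harmonic function\<close>

lemma Lq_loc_1_mult_lebesgue:
  fixes v :: "'a::euclidean_space \<Rightarrow> real"
  assumes "v \<in> Lq_loc 1 U" "open U" "continuous_on UNIV \<phi>" "compact K" "K \<subseteq> U" "\<And>x. x \<notin> K \<Longrightarrow> \<phi> x = 0"
  shows "integrable lebesgue (\<lambda>x. v x * \<phi> x)"
    and "(LINT x|lebesgue_on U. v x * \<phi> x) = (LINT x|lebesgue. v x * \<phi> x)"
proof -
  have z: "v x * \<phi> x = 0" if "x \<notin> U" for x using assms(5,6) that by auto
  have Us: "U \<in> sets lebesgue" using assms(2) by simp
  show "integrable lebesgue (\<lambda>x. v x * \<phi> x)"
    using Lq_loc_1_mult[OF assms] integral_lebesgue_on_superset(2)[OF subset_UNIV Us, of "\<lambda>x. v x * \<phi> x"] z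
    by (simp add: lebesgue_on_UNIV_eq)
  show "(LINT x|lebesgue_on U. v x * \<phi> x) = (LINT x|lebesgue. v x * \<phi> x)"
    using integral_lebesgue_on_superset(1)[OF subset_UNIV Us, of "\<lambda>x. v x * \<phi> x"] z
    by (simp add: lebesgue_on_UNIV_eq)
qed

lemma elementary_support:
  assumes "closed S" "\<And>x. x \<notin> S \<Longrightarrow> \<eta> x = 0" "x \<notin> S"
  shows "partials \<alpha> \<eta> x = 0"
  by (rule partials_zero_on_open[of "- S"]) (use assms in auto)

lemma continuous_laplacian_moll:
  "continuous_on UNIV (\<lambda>(x, y). laplacian (moll t x) (y::real^'n::finite))"
proof -
  have c: "continuous_on UNIV (\<lambda>p. flat_exp m (quad a b (fst p) (snd p :: real^'n)))" for m a b
    using continuous_flat_quad[of m a b] by (simp add: case_prod_beta)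
  show ?thesis
    unfolding laplacian_moll laplacian_flat_quad case_prod_beta by (intro continuous_intros c)
qed

text \<open>The function v is the weak Laplacian of \<eta> u, which is not a test function. On K, w
  equals its mollification, so the kernel can be moved onto v; integration by parts turns v into
  \<eta> u against the Laplacian of the kernel; a second use of Fubini leaves w paired with the
  Laplacian of \<open>moll e x\<close>, which is supported in V. The integrability of w v comes from
  the same replacement.\<close>

lemma weak_harmonic_identity:
  fixes u w :: "real^'n::finite \<Rightarrow> real"
  assumes \<Omega>: "open \<Omega>"
    and D1: "\<And>i. has_weak_derivative \<Omega> [i] u (D1 i)" and D2: "\<And>i. has_weak_derivative \<Omega> [i, i] u (D2 i)"
    and w: "integrable lebesgue w"
    and harm: "\<And>\<phi>. \<phi> \<in> test_functions V \<Longrightarrow> (LINT y|lebesgue. w y * laplacian \<phi> y) = 0"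
    and K: "open K" "0 < e" "\<And>x. x \<in> K \<Longrightarrow> cball x e \<subseteq> V"
    and \<eta>: "elementary \<eta>" and S: "compact S" "S \<subseteq> K" "S \<subseteq> \<Omega>" "\<And>x. x \<notin> S \<Longrightarrow> \<eta> x = 0"
  defines "v \<equiv> \<lambda>x. \<eta> x * (\<Sum>i\<in>UNIV. D2 i x) + 2 * (\<Sum>i\<in>UNIV. D1 i x * partial i \<eta> x) + u x * laplacian \<eta> x"
  shows "integrable lebesgue (\<lambda>x. w x * v x)" and "(LINT x|lebesgue. w x * v x) = 0"
proof -
  define c where "c = moll_mass TYPE('n)"
  have c: "c > 0" by (simp add: c_def moll_mass_pos)
  define A where "A x = (LINT y|lebesgue. w y * moll e x y)" for x
  have u: "u \<in> Lq_loc 1 \<Omega>" using D1 by (auto simp: has_weak_derivative_def)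
  have d1: "D1 i \<in> Lq_loc 1 \<Omega>" for i using D1[of i] by (auto simp: has_weak_derivative_def)
  have d2: "D2 i \<in> Lq_loc 1 \<Omega>" for i using D2[of i] by (auto simp: has_weak_derivative_def)
  have S0: "partials \<alpha> \<eta> x = 0" if "x \<notin> S" for \<alpha> x
    using elementary_support[of S \<eta>] S that compact_imp_closed by blast
  have S1: "partial i \<eta> x = 0" if "x \<notin> S" for i x using S0[OF that, of "[i]"] by (simp add: partials_def)
  have SL: "laplacian \<eta> x = 0" if "x \<notin> S" for x using S0[OF that] by (simp add: laplacian_def)
  have v0: "v x = 0" if "x \<notin> S" for x using S1[OF that] SL[OF that] S(4)[OF that] by (simp add: v_def)
  have int: "integrable lebesgue (\<lambda>x. z x * \<phi> x)"
    if "z \<in> Lq_loc 1 \<Omega>" "elementary \<phi>" "\<And>x. x \<notin> S \<Longrightarrow> \<phi> x = 0" for z \<phi>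
    using that by (intro Lq_loc_1_mult_lebesgue(1)[OF _ \<Omega> elementary_continuous S(1,3)])
  have e1: "elementary (partial i \<eta>)" for i using \<eta> by (rule elementary_partial)
  have e2: "elementary (partials \<alpha> \<eta>)" for \<alpha> using \<eta> by (rule elementary_partials)
  have vint: "integrable lebesgue v"
  proof -
    have "integrable lebesgue (\<lambda>x. \<Sum>i\<in>UNIV. D2 i x * \<eta> x)" "integrable lebesgue (\<lambda>x. \<Sum>i\<in>UNIV. D1 i x * partial i \<eta> x)"
      "integrable lebesgue (\<lambda>x. u x * laplacian \<eta> x)"
      using S(4) S1 SL by (auto intro!: Bochner_Integration.integrable_sum int d1 d2 u \<eta> e1 elementary_laplacian)
    then have "integrable lebesgue (\<lambda>x. (\<Sum>i\<in>UNIV. D2 i x * \<eta> x) + 2 * (\<Sum>i\<in>UNIV. D1 i x * partial i \<eta> x) + u x * laplacian \<eta> x)"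
      by (intro Bochner_Integration.integrable_add integrable_mult_right)
    then show ?thesis by (simp add: v_def sum_distrib_right mult.commute[of "\<eta> _"])
  qed
  have mb: "\<bar>moll e x y\<bar> \<le> 2 / e ^ CARD('n)" for x y :: "real^'n"
    using moll_bound[OF K(2), of x y] by simp
  have "AE x in lebesgue. x \<in> K \<longrightarrow> w x = (LINT y|lebesgue. w y * moll e x y) / moll_mass TYPE('n)"
    by (rule weyl_moll[OF w harm K])
  then have ae: "AE x in lebesgue. w x * v x = v x * A x / c"
  proof eventually_elim
    case (elim x)
    then show ?case using v0[of x] S(2) by (cases "x \<in> S") (auto simp: A_def c_def)
  qed
  have i: "integrable lebesgue (\<lambda>x. v x * A x / c)"
    unfolding A_def using kernel_Fubini(1)[OF vint w continuous_moll mb] by simp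
  show wv: "integrable lebesgue (\<lambda>x. w x * v x)"
    by (rule integrable_cong_AE_imp[OF i]) (use w vint ae in \<open>auto intro!: borel_measurable_times\<close>)
  have inner: "(LINT x|lebesgue. v x * moll e x y) = (LINT x|lebesgue. u x * \<eta> x * laplacian (moll e y) x)" for y
  proof -
    define k where "k = moll e y"
    have k: "elementary k" unfolding k_def by (rule elementary_moll)
    note df = elementary_differentiable elementary_partial elementary_mult k \<eta>
    have t0: "(\<lambda>x. \<eta> x * k x) \<in> test_functions \<Omega>"
      using S by (intro elementary_test_function[OF elementary_mult[OF \<eta> k] S(1,3)]) auto
    have t1: "(\<lambda>x. partial i \<eta> x * k x) \<in> test_functions \<Omega>" for i
      using S1 by (intro elementary_test_function[OF elementary_mult[OF e1 k] S(1,3)]) auto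
    have p1: "partial i (\<lambda>x. \<eta> x * k x) = (\<lambda>x. \<eta> x * partial i k x + partial i \<eta> x * k x)" for i
      by (intro ext partial_mult df)
    have p2: "partials [i] (\<lambda>x. partial i \<eta> x * k x) x = partial i \<eta> x * partial i k x + partials [i, i] \<eta> x * k x" for i x
      unfolding partials_def by (simp add: partial_mult df)
    have p3: "partials [i, i] (\<lambda>x. \<eta> x * k x) x =
        \<eta> x * partials [i, i] k x + 2 * (partial i \<eta> x * partial i k x) + partials [i, i] \<eta> x * k x" for i x
    proof -
      have "partials [i, i] (\<lambda>x. \<eta> x * k x) x = partial i (\<lambda>x. \<eta> x * partial i k x + partial i \<eta> x * k x) x"
        by (simp add: partials_def p1)
      also have "\<dots> = partial i (\<lambda>x. \<eta> x * partial i k x) x + partial i (\<lambda>x. partial i \<eta> x * k x) x"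
        by (intro partial_add df)
      finally show ?thesis by (simp add: partial_mult df partials_def)
    qed
    have n0: "integrable lebesgue (\<lambda>x. D2 i x * (\<eta> x * k x))" for i
      using S(4) by (intro int d2 elementary_mult \<eta> k) auto
    have n1: "integrable lebesgue (\<lambda>x. D1 i x * (partial i \<eta> x * k x))" for i
      using S1 by (intro int d1 elementary_mult e1 k) auto
    have n2: "integrable lebesgue (\<lambda>x. u x * (partials \<alpha> \<eta> x * h x))" if "elementary h" for \<alpha> h
      using S0 that by (intro int u elementary_mult e2) auto
    have z1: "partials \<beta> (\<lambda>x. partials \<alpha> \<eta> x * k x) x = 0" if "x \<notin> S" for \<alpha> \<beta> x
      by (rule elementary_support[OF compact_imp_closed[OF S(1)] _ that]) (simp add: S0)
    have w0: "(LINT x|lebesgue. u x * partials [i, i] (\<lambda>x. \<eta> x * k x) x) = (LINT x|lebesgue. D2 i x * (\<eta> x * k x))" for i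
    proof -
      have "(LINT x|lebesgue_on \<Omega>. u x * partials [i, i] (\<lambda>x. \<eta> x * k x) x) = (LINT x|lebesgue_on \<Omega>. D2 i x * (\<eta> x * k x))"
        using D2[of i] t0 by (simp add: has_weak_derivative_def)
      moreover have "(LINT x|lebesgue_on \<Omega>. u x * partials [i, i] (\<lambda>x. \<eta> x * k x) x) = (LINT x|lebesgue. u x * partials [i, i] (\<lambda>x. \<eta> x * k x) x)"
        using z1[of _ "[i, i]" "[]"]
        by (intro Lq_loc_1_mult_lebesgue(2)[OF u \<Omega> elementary_continuous S(1,3)] elementary_partials elementary_mult \<eta> k)
           (simp add: partials_Nil)
      moreover have "(LINT x|lebesgue_on \<Omega>. D2 i x * (\<eta> x * k x)) = (LINT x|lebesgue. D2 i x * (\<eta> x * k x))"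
        using S(4) by (intro Lq_loc_1_mult_lebesgue(2)[OF d2 \<Omega> elementary_continuous S(1,3)] elementary_mult \<eta> k) simp
      ultimately show ?thesis by simp
    qed
    have w1: "(LINT x|lebesgue. u x * partials [i] (\<lambda>x. partial i \<eta> x * k x) x) = - (LINT x|lebesgue. D1 i x * (partial i \<eta> x * k x))" for i
    proof -
      have "(LINT x|lebesgue_on \<Omega>. u x * partials [i] (\<lambda>x. partial i \<eta> x * k x) x) = - (LINT x|lebesgue_on \<Omega>. D1 i x * (partial i \<eta> x * k x))"
        using D1[of i] t1 by (simp add: has_weak_derivative_def)
      moreover have "(LINT x|lebesgue_on \<Omega>. u x * partials [i] (\<lambda>x. partial i \<eta> x * k x) x) = (LINT x|lebesgue. u x * partials [i] (\<lambda>x. partial i \<eta> x * k x) x)"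
        using z1[of _ "[i]" "[i]"]
        by (intro Lq_loc_1_mult_lebesgue(2)[OF u \<Omega> elementary_continuous S(1,3)] elementary_partials elementary_mult e1 k)
           (simp add: partials_def)
      moreover have "(LINT x|lebesgue_on \<Omega>. D1 i x * (partial i \<eta> x * k x)) = (LINT x|lebesgue. D1 i x * (partial i \<eta> x * k x))"
        using S1 by (intro Lq_loc_1_mult_lebesgue(2)[OF d1 \<Omega> elementary_continuous S(1,3)] elementary_mult e1 k) simp
      ultimately show ?thesis by simp
    qed
    \<comment> \<open>The product rule is tested against second derivatives of u with \<eta> k, and
      against first derivatives with \<open>partial i \<eta> x * k x\<close>. The second identity,
      taken twice, eliminates the mixed terms
      \<open>partial i \<eta> x * partial i k x\<close>.\<close>
    have each: "(LINT x|lebesgue. D2 i x * (\<eta> x * k x)) + 2 * (LINT x|lebesgue. D1 i x * (partial i \<eta> x * k x))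
        + (LINT x|lebesgue. u x * (partials [i, i] \<eta> x * k x)) = (LINT x|lebesgue. u x * (\<eta> x * partials [i, i] k x))" for i
    proof -
      have m: "integrable lebesgue (\<lambda>x. u x * (\<eta> x * partials [i, i] k x))"
         "integrable lebesgue (\<lambda>x. u x * (partial i \<eta> x * partial i k x))"
         "integrable lebesgue (\<lambda>x. u x * (partials [i, i] \<eta> x * k x))"
        using n2[OF elementary_partials[OF k, of "[i, i]"], of "[]"] n2[OF elementary_partial[OF k, of i], of "[i]"] n2[OF k, of "[i, i]"]
        by (simp_all add: partials_def)
      have "(LINT x|lebesgue. u x * partials [i, i] (\<lambda>x. \<eta> x * k x) x) =
        (LINT x|lebesgue. u x * (\<eta> x * partials [i, i] k x) + 2 * (u x * (partial i \<eta> x * partial i k x)) + u x * (partials [i, i] \<eta> x * k x))"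
        by (simp only: p3 distrib_left mult.left_commute[of _ 2])
      also have "\<dots> = (LINT x|lebesgue. u x * (\<eta> x * partials [i, i] k x)) + 2 * (LINT x|lebesgue. u x * (partial i \<eta> x * partial i k x))
          + (LINT x|lebesgue. u x * (partials [i, i] \<eta> x * k x))"
        using m by simp
      finally have 1: "(LINT x|lebesgue. D2 i x * (\<eta> x * k x)) = \<dots>" using w0 by simp
      have "(LINT x|lebesgue. u x * partials [i] (\<lambda>x. partial i \<eta> x * k x) x) =
         (LINT x|lebesgue. u x * (partial i \<eta> x * partial i k x) + u x * (partials [i, i] \<eta> x * k x))"
        by (simp only: p2 distrib_left mult.left_commute[of _ 2])
      also have "\<dots> = (LINT x|lebesgue. u x * (partial i \<eta> x * partial i k x)) + (LINT x|lebesgue. u x * (partials [i, i] \<eta> x * k x))"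
        using m by simp
      finally show ?thesis using 1 w1[of i] by simp
    qed
    have "v x * k x = (\<Sum>i\<in>UNIV. D2 i x * (\<eta> x * k x) + 2 * (D1 i x * (partial i \<eta> x * k x)) + u x * (partials [i, i] \<eta> x * k x))" for x
      by (simp add: v_def laplacian_def sum.distrib sum_distrib_left sum_distrib_right distrib_right distrib_left mult_ac)
    then have "(LINT x|lebesgue. v x * k x) = (LINT x|lebesgue. (\<Sum>i\<in>UNIV. D2 i x * (\<eta> x * k x) + 2 * (D1 i x * (partial i \<eta> x * k x)) + u x * (partials [i, i] \<eta> x * k x)))"
      by (simp only:)
    also have "\<dots> = (\<Sum>i\<in>UNIV. LINT x|lebesgue. D2 i x * (\<eta> x * k x) + 2 * (D1 i x * (partial i \<eta> x * k x)) + u x * (partials [i, i] \<eta> x * k x))"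
      by (intro Bochner_Integration.integral_sum Bochner_Integration.integrable_add integrable_mult_right n0 n1 n2 k)
    also have "\<dots> = (\<Sum>i\<in>UNIV. LINT x|lebesgue. u x * (\<eta> x * partials [i, i] k x))"
      using n0 n1 n2[OF k] by (intro sum.cong refl) (simp add: each[symmetric])
    also have "\<dots> = (LINT x|lebesgue. (\<Sum>i\<in>UNIV. u x * (\<eta> x * partials [i, i] k x)))"
      using n2[OF elementary_partials[OF k], of "[]"]
      by (intro Bochner_Integration.integral_sum[symmetric]) (simp add: partials_Nil)
    also have "\<dots> = (LINT x|lebesgue. u x * \<eta> x * laplacian k x)"
      by (simp add: laplacian_def sum_distrib_left mult_ac)
    finally show ?thesis by (simp add: k_def moll_commute[of e _ y])
  qed
  have uh: "integrable lebesgue (\<lambda>x. u x * \<eta> x)" using S(4) by (intro int u \<eta>)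
  obtain B where B: "\<bar>laplacian (moll e x) y\<bar> \<le> B" for x y :: "real^'n"
  proof -
    have "\<bar>laplacian (moll e x) y\<bar> \<le> 1 / e ^ CARD('n) * (4 * (1 / e\<^sup>2) * 1 * (fact (2 + 4) + (2 * real 2 + 2) * fact (2 + 3) + real 2 * (real 2 + 1) * fact (2 + 2))
        + 2 * (1 / e\<^sup>2) * CARD('n) * (fact (2 + 2) + real 2 * fact (2 + 1)))" for x y :: "real^'n"
      unfolding laplacian_moll abs_mult using laplacian_flat_quad_bound[of "1 / e\<^sup>2" 1 2 x y] K(2)
      by (intro mult_mono) auto
    then show ?thesis using that by blast
  qed
  \<comment> \<open>Off S the factor \<eta> vanishes; for x in S the kernel centred at x is
    supported in V, where w is harmonic.\<close>
  have z: "u x * \<eta> x * (LINT y|lebesgue. w y * laplacian (moll e x) y) = 0" for x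
  proof (cases "x \<in> S")
    case True
    then have sub: "cball x e \<subseteq> V" using K(3) S(2) by blast
    have "moll e x \<in> test_functions V"
      using K(2) by (intro elementary_test_function[OF elementary_moll compact_cball sub]) (auto intro: moll_zero)
    then show ?thesis using harm by simp
  qed (use S(4) in simp)
  have "(LINT x|lebesgue. w x * v x) = (LINT x|lebesgue. v x * A x / c)"
    using ae w vint i by (intro integral_cong_AE) (auto intro!: borel_measurable_times)
  also have "\<dots> = (LINT x|lebesgue. v x * A x) / c" by simp
  also have "(LINT x|lebesgue. v x * A x) = (LINT y|lebesgue. w y * (LINT x|lebesgue. v x * moll e x y))"
    unfolding A_def by (rule kernel_Fubini(2)[OF vint w continuous_moll mb])
  \<comment> \<open>By symmetry the Laplacian of the kernel may be taken in either variable, which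
    brings it to the side of w.\<close>
  also have "\<dots> = (LINT y|lebesgue. w y * (LINT x|lebesgue. u x * \<eta> x * laplacian (moll e x) y))"
    by (simp only: inner laplacian_moll_commute[of e _ _])
  also have "\<dots> = (LINT x|lebesgue. u x * \<eta> x * (LINT y|lebesgue. w y * laplacian (moll e x) y))"
    by (rule kernel_Fubini(2)[OF uh w continuous_laplacian_moll B, symmetric])
  also have "\<dots> = 0" by (simp only: z) simp
  finally show "(LINT x|lebesgue. w x * v x) = 0" by simp
qed

section \<open>Growth of the N-function\<close>

text \<open>The upper bound in \<open>condition_A1\<close> makes t g' - N g nonincreasing as soon as
  N \<ge> p - 2. Arbitrarily close to 0 there are points where t g' is as small as desired, so this
  quantity is nonpositive throughout; that is, g(t) / t^N is nonincreasing.\<close>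

lemma A1_power_growth:
  assumes g: "N_function_generator g" and A1: "condition_A1 g"
  obtains N :: nat where "\<And>t l. 0 < t \<Longrightarrow> 1 \<le> l \<Longrightarrow> g (l * t) \<le> l ^ N * g t"
proof -
  have gpos: "g t > 0" if "t > 0" for t using g that by (simp add: N_function_generator_def)
  have gmono: "g s \<le> g t" if "0 \<le> s" "s \<le> t" for s t
    using g that by (auto simp: N_function_generator_def mono_on_def)
  have dg: "(g has_real_derivative deriv g t) (at t)" "(deriv g has_real_derivative deriv (deriv g) t) (at t)"
    and g'pos: "deriv g t > 0" if "t > 0" for t
    using A1 that by (auto simp: condition_A1_def DERIV_deriv_iff_real_differentiable)
  obtain p where p: "\<And>t. t > 0 \<Longrightarrow> t * deriv (deriv g) t / deriv g t \<le> p - 3"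
    using A1 by (auto simp: condition_A1_def)
  obtain N :: nat where N: "p - 2 \<le> real N" using real_arch_simple by blast
  have noninc: "t * deriv g t - N * g t \<le> s * deriv g s - N * g s" if st: "0 < s" "s \<le> t" for s t
  proof (rule DERIV_nonpos_imp_nonincreasing[OF st(2)])
    fix x assume x: "s \<le> x" "x \<le> t"
    then have x0: "x > 0" using st by simp
    have "((\<lambda>x. x * deriv g x - N * g x) has_real_derivative (1 * deriv g x + deriv (deriv g) x * x) - N * deriv g x) (at x)"
      by (intro DERIV_diff DERIV_mult DERIV_cmult dg x0 DERIV_ident)
    moreover have "(1 * deriv g x + deriv (deriv g) x * x) - N * deriv g x \<le> 0"
    proof -
      have "x * deriv (deriv g) x \<le> (p - 3) * deriv g x" using p[OF x0] g'pos[OF x0] by (simp add: pos_divide_le_eq)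
      also have "\<dots> \<le> (real N - 1) * deriv g x" using N g'pos[OF x0] by (intro mult_right_mono) auto
      finally show ?thesis by (simp add: algebra_simps)
    qed
    ultimately show "\<exists>y. ((\<lambda>x. x * deriv g x - N * g x) has_real_derivative y) (at x) \<and> y \<le> 0" by blast
  qed
  have euler: "t * deriv g t \<le> N * g t" if t: "t > 0" for t
  proof (rule field_le_epsilon)
    fix \<delta> :: real assume \<delta>: "\<delta> > 0"
    have "((\<lambda>s. g s) \<longlongrightarrow> 0) (at_right 0)"
      using g by (auto simp: N_function_generator_def continuous_within)
    then have "\<forall>\<^sub>F s in at_right 0. g s < \<delta> / 2" using \<delta> by (intro order_tendstoD) auto
    then obtain b where b: "b > 0" "\<And>s. 0 < s \<Longrightarrow> s < b \<Longrightarrow> g s < \<delta> / 2"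
      by (auto simp: eventually_at_right_field)
    define s where "s = min t b / 2"
    have s: "0 < s" "s < b" "s \<le> t" using b t by (auto simp: s_def)
    \<comment> \<open>Smallness of g' near 0 is not given, only that g tends to 0. The mean value
      theorem on [s/2, s] supplies a point with \<xi> g'(\<xi>) \<le> 2 (g(s) - g(s/2)).\<close>
    obtain \<xi> where \<xi>: "s / 2 < \<xi>" "\<xi> < s" "g s - g (s / 2) = (s - s / 2) * deriv g \<xi>"
      using MVT2[of "s / 2" s g "deriv g"] s dg by (metis half_gt_zero_iff field_sum_of_halves less_add_same_cancel2 less_le_trans)
    have x0: "\<xi> > 0" using \<xi> s by linarith
    have "\<xi> * deriv g \<xi> \<le> s * deriv g \<xi>" using \<xi> g'pos[OF x0] by (intro mult_right_mono) auto
    also have "\<dots> = 2 * (g s - g (s / 2))" using \<xi>(3) by (simp add: field_simps)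
    also have "\<dots> \<le> \<delta>" using b(2)[OF s(1,2)] gpos[of "s / 2"] s by simp
    finally have "\<xi> * deriv g \<xi> \<le> \<delta>" .
    moreover have "0 \<le> N * g \<xi>" using gpos[OF x0] by simp
    ultimately show "t * deriv g t \<le> N * g t + \<delta>" using noninc[OF x0, of t] \<xi> s by linarith
  qed
  show ?thesis
  proof (rule that)
    fix t l :: real assume t: "0 < t" and l: "1 \<le> l"
    have lt: "t \<le> l * t" using t l by simp
    have "g (l * t) / (l * t) ^ N \<le> g t / t ^ N"
    proof (rule DERIV_nonpos_imp_nonincreasing[OF lt])
      fix x assume "t \<le> x" "x \<le> l * t"
      then have x: "x > 0" using t by simp
      have d: "((\<lambda>x. g x / x ^ N) has_real_derivative (deriv g x * x ^ N - g x * (N * x ^ (N - 1))) / (x ^ N * x ^ N)) (at x)"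
        using x DERIV_pow[of N x] by (intro DERIV_divide dg) auto
      have "deriv g x * x ^ N \<le> g x * (N * x ^ (N - 1))"
      proof (cases N)
        \<comment> \<open>For N = 0 the exponent N - 1 is truncated to 0; this case is void because
          \<open>euler\<close> then contradicts g' > 0.\<close>
        case 0
        then show ?thesis using euler[OF x] g'pos[OF x] x by (simp add: mult_le_0_iff)
      next
        case (Suc k)
        have "x * deriv g x * x ^ k \<le> N * g x * x ^ k" using euler[OF x] x by (intro mult_right_mono) auto
        then show ?thesis using Suc by (simp add: mult_ac)
      qed
      then have "(deriv g x * x ^ N - g x * (N * x ^ (N - 1))) / (x ^ N * x ^ N) \<le> 0"
        using x by (auto simp: divide_le_0_iff)
      with d show "\<exists>y. ((\<lambda>x. g x / x ^ N) has_real_derivative y) (at x) \<and> y \<le> 0"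
        by blast
    qed
    then show "g (l * t) \<le> l ^ N * g t"
      using t l by (simp add: power_mult_distrib field_simps)
  qed
qed

text \<open>The assumption \<open>growth\<close> is the doubling property with an explicit exponent,
  so that every dilation costs an explicit power.\<close>

locale N_growth =
  fixes g :: "real \<Rightarrow> real" and N :: nat
  assumes even: "g (- t) = g t"
    and mono: "0 \<le> s \<Longrightarrow> s \<le> t \<Longrightarrow> g s \<le> g t"
    and zero: "g 0 = 0"
    and pos: "t > 0 \<Longrightarrow> g t > 0"
    and cont: "continuous_on UNIV g"
    and unbounded: "filterlim (\<lambda>t. g t * t) at_top at_top"
    and growth: "0 < t \<Longrightarrow> 1 \<le> l \<Longrightarrow> g (l * t) \<le> l ^ N * g t"
begin

text \<open>For t \<ge> 0 this is t G'(t). It is comparable to G within the factor 2^(N+2) and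
  equals the flux g(t) t times its argument t, so it avoids handling the integral that defines
  G.\<close>

definition Phi :: "real \<Rightarrow> real" where "Phi t = g t * t\<^sup>2"

lemma g_abs: "g t = g \<bar>t\<bar>"
  using even[of t] by (cases "t \<ge> 0") auto

lemma g_nonneg: "0 \<le> g t"
  using mono[of 0 "\<bar>t\<bar>"] zero g_abs[of t] by simp

lemma g_mono: "\<bar>s\<bar> \<le> \<bar>t\<bar> \<Longrightarrow> g s \<le> g t"
  using mono[of "\<bar>s\<bar>" "\<bar>t\<bar>"] g_abs[of t] g_abs[of s] by simp

lemma Phi_nonneg: "0 \<le> Phi t" by (simp add: Phi_def g_nonneg)

lemma Phi_abs: "Phi \<bar>t\<bar> = Phi t" using g_abs[of t] by (simp add: Phi_def)

lemma Phi_mono: "\<bar>s\<bar> \<le> \<bar>t\<bar> \<Longrightarrow> Phi s \<le> Phi t"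
  unfolding Phi_def using g_mono[of s t] g_nonneg by (intro mult_mono) (auto simp: abs_le_square_iff)

lemma Phi_scale: "1 \<le> l \<Longrightarrow> Phi (l * t) \<le> l ^ (N + 2) * Phi t"
proof -
  assume l: "1 \<le> l"
  have "g (l * t) \<le> l ^ N * g t"
  proof (cases "t = 0")
    case False
    then show ?thesis using growth[of "\<bar>t\<bar>" l] l g_abs[of t] g_abs[of "l * t"] by (simp add: abs_mult)
  qed (simp add: zero)
  then have "g (l * t) * (l * t)\<^sup>2 \<le> l ^ N * g t * (l * t)\<^sup>2" by (intro mult_right_mono) auto
  also have "l ^ N * g t * (l * t)\<^sup>2 = l ^ (N + 2) * Phi t"
    by (simp only: Phi_def power_mult_distrib power_add mult_ac)
  finally show ?thesis by (simp only: Phi_def)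
qed

text \<open>Doubling the larger of the two summands. It makes the modular class closed under sums,
  so the weak Laplacian and gradient inherit integrability without any norm.\<close>

lemma Phi_add: "Phi (s + t) \<le> 2 ^ (N + 2) * (Phi s + Phi t)"
proof -
  have *: "Phi (s + t) \<le> 2 ^ (N + 2) * (Phi s + Phi t)" if "\<bar>s\<bar> \<le> \<bar>t\<bar>" for s t
  proof -
    have "Phi (s + t) \<le> Phi (2 * t)" using that by (intro Phi_mono) auto
    also have "\<dots> \<le> 2 ^ (N + 2) * Phi t" by (rule Phi_scale) simp
    also have "\<dots> \<le> 2 ^ (N + 2) * (Phi s + Phi t)" using Phi_nonneg by (intro mult_left_mono) auto
    finally show ?thesis .
  qed
  show ?thesis using *[of s t] *[of t s] by (cases "\<bar>s\<bar> \<le> \<bar>t\<bar>") (auto simp: add.commute)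
qed

lemma cont_integrand: "continuous_on S (\<lambda>t. g t * t)"
  using cont by (auto intro!: continuous_intros intro: continuous_on_subset)

lemma continuous_Phi: "continuous_on S Phi"
  unfolding Phi_def[abs_def] using cont by (auto intro!: continuous_intros intro: continuous_on_subset)

lemma G_le_Phi: "N_function g t \<le> Phi t"
proof -
  have "N_function g t \<le> integral {0..\<bar>t\<bar>} (\<lambda>\<tau>. g \<bar>t\<bar> * \<bar>t\<bar>)"
    unfolding N_function_def using mono g_nonneg
    by (intro integral_le integrable_continuous_interval cont_integrand) (auto intro!: mult_mono)
  also have "\<dots> = Phi t" by (simp add: Phi_def power2_eq_square mult.left_commute[of "\<bar>t\<bar>"] g_abs[of t, symmetric])
  finally show ?thesis .
qed

lemma integral_mono_upper: "s \<le> t \<Longrightarrow> integral {0..s} (\<lambda>\<tau>. g \<tau> * \<tau>) \<le> integral {0..t} (\<lambda>\<tau>. g \<tau> * \<tau>)"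
  using g_nonneg by (intro integral_subset_le integrable_continuous_interval cont_integrand) auto

lemma G_nonneg: "0 \<le> N_function g t"
  unfolding N_function_def using g_nonneg
  by (intro integral_nonneg integrable_continuous_interval cont_integrand) auto

text \<open>The integral over the upper half [T/2, T] already dominates \<open>Phi (T / 2)\<close>;
  the doubling property returns to T.\<close>

lemma Phi_le_G: "Phi t \<le> 2 ^ (N + 2) * N_function g t"
proof -
  define T where "T = \<bar>t\<bar>"
  have T: "T \<ge> 0" by (simp add: T_def)
  have "Phi (T / 2) = integral {T/2..T} (\<lambda>\<tau>. g (T / 2) * (T / 2))"
    using T by (simp add: Phi_def power2_eq_square)
  also have "\<dots> \<le> integral {T/2..T} (\<lambda>\<tau>. g \<tau> * \<tau>)"
  proof (intro integral_le integrable_continuous_interval cont_integrand continuous_on_const)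
    show "g (T / 2) * (T / 2) \<le> g \<tau> * \<tau>" if "\<tau> \<in> {T / 2..T}" for \<tau>
      using that T mono[of "T / 2" \<tau>] g_nonneg by (intro mult_mono) auto
  qed
  also have "\<dots> \<le> integral {0..T} (\<lambda>\<tau>. g \<tau> * \<tau>)"
    using T g_nonneg by (intro integral_subset_le integrable_continuous_interval cont_integrand) auto
  also have "\<dots> = N_function g t" by (simp add: N_function_def T_def)
  finally have "2 ^ (N + 2) * Phi (T / 2) \<le> 2 ^ (N + 2) * N_function g t" by simp
  moreover have "Phi t \<le> 2 ^ (N + 2) * Phi (T / 2)"
    using Phi_scale[of 2 "T / 2"] Phi_abs[of t] by (simp add: T_def)
  ultimately show ?thesis by linarith
qed

lemma G_measurable: "N_function g \<in> borel_measurable borel"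
proof -
  have "(\<lambda>s. integral {0..s} (\<lambda>\<tau>. g \<tau> * \<tau>)) \<in> borel_measurable borel"
    by (intro borel_measurable_mono monoI integral_mono_upper)
  from measurable_compose[OF _ this, of abs borel] show ?thesis
    by (simp add: N_function_def[abs_def])
qed

lemma Phi_measurable: "Phi \<in> borel_measurable borel"
  by (intro borel_measurable_continuous_onI continuous_Phi)

lemma A_measurable: "(\<lambda>t. g t * t) \<in> borel_measurable borel"
  by (intro borel_measurable_continuous_onI cont_integrand)

lemma integrable_G_iff:
  assumes "u \<in> borel_measurable M"
  shows "integrable M (\<lambda>x. N_function g (u x)) \<longleftrightarrow> integrable M (\<lambda>x. Phi (u x))"
proof
  assume "integrable M (\<lambda>x. N_function g (u x))"
  then have i: "integrable M (\<lambda>x. 2 ^ (N + 2) * N_function g (u x))" by simp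
  show "integrable M (\<lambda>x. Phi (u x))"
  proof (rule Bochner_Integration.integrable_bound[OF i])
    show "(\<lambda>x. Phi (u x)) \<in> borel_measurable M" using measurable_compose[OF assms Phi_measurable] .
    show "AE x in M. norm (Phi (u x)) \<le> norm (2 ^ (N + 2) * N_function g (u x))"
      using Phi_le_G Phi_nonneg G_nonneg by (intro AE_I2) (simp add: abs_mult)
  qed
next
  assume i: "integrable M (\<lambda>x. Phi (u x))"
  show "integrable M (\<lambda>x. N_function g (u x))"
  proof (rule Bochner_Integration.integrable_bound[OF i])
    show "(\<lambda>x. N_function g (u x)) \<in> borel_measurable M" using measurable_compose[OF assms G_measurable] .
    show "AE x in M. norm (N_function g (u x)) \<le> norm (Phi (u x))"
      using G_le_Phi Phi_nonneg G_nonneg by (intro AE_I2) simp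
  qed
qed

lemma integrable_Phi_bound:
  assumes "integrable M (\<lambda>x. Phi (u x))" "v \<in> borel_measurable M" "\<And>x. \<bar>v x\<bar> \<le> l * \<bar>u x\<bar>" "1 \<le> l"
  shows "integrable M (\<lambda>x. Phi (v x))"
proof (rule Bochner_Integration.integrable_bound[of M "\<lambda>x. l ^ (N + 2) * Phi (u x)"])
  show "(\<lambda>x. Phi (v x)) \<in> borel_measurable M" using measurable_compose[OF assms(2) Phi_measurable] .
  show "AE x in M. norm (Phi (v x)) \<le> norm (l ^ (N + 2) * Phi (u x))"
  proof (rule AE_I2)
    fix x
    have "Phi (v x) \<le> Phi (l * u x)" using assms(3)[of x] assms(4) by (intro Phi_mono) (auto simp: abs_mult)
    also have "\<dots> \<le> l ^ (N + 2) * Phi (u x)" using assms(4) by (rule Phi_scale)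
    finally show "norm (Phi (v x)) \<le> norm (l ^ (N + 2) * Phi (u x))" using Phi_nonneg by simp
  qed
qed (use assms in simp)

lemma integrable_Phi_add:
  assumes "integrable M (\<lambda>x. Phi (u x))" "integrable M (\<lambda>x. Phi (v x))" "u \<in> borel_measurable M" "v \<in> borel_measurable M"
  shows "integrable M (\<lambda>x. Phi (u x + v x))"
proof (rule Bochner_Integration.integrable_bound[of M "\<lambda>x. 2 ^ (N + 2) * (Phi (u x) + Phi (v x))"])
  show "(\<lambda>x. Phi (u x + v x)) \<in> borel_measurable M"
    using measurable_compose[OF borel_measurable_add[OF assms(3,4)] Phi_measurable] .
  show "AE x in M. norm (Phi (u x + v x)) \<le> norm (2 ^ (N + 2) * (Phi (u x) + Phi (v x)))"
    using Phi_add Phi_nonneg by (intro AE_I2) simp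
qed (use assms in simp)

lemma integrable_Phi_sum:
  assumes "finite I" "\<And>i. i \<in> I \<Longrightarrow> integrable M (\<lambda>x. Phi (u i x))" "\<And>i. i \<in> I \<Longrightarrow> u i \<in> borel_measurable M"
  shows "integrable M (\<lambda>x. Phi (\<Sum>i\<in>I. u i x))"
  using assms
proof (induction I rule: finite_induct)
  case empty
  then show ?case by (simp add: Phi_def)
next
  case (insert i I)
  then show ?case by (simp add: integrable_Phi_add)
qed

text \<open>On a set of finite measure this makes the flux integrable wherever the modular
  is.\<close>

lemma A_le: "\<bar>g t * t\<bar> \<le> g 1 + Phi t"
proof (cases "\<bar>t\<bar> \<le> 1")
  case True
  then have "g t * \<bar>t\<bar> \<le> g 1 * 1" using g_mono[of t 1] g_nonneg by (intro mult_mono) auto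
  then show ?thesis using Phi_nonneg[of t] g_nonneg by (simp add: abs_mult)
next
  case False
  then have "\<bar>t\<bar> \<le> \<bar>t\<bar> * \<bar>t\<bar>" using mult_left_mono[of 1 "\<bar>t\<bar>" "\<bar>t\<bar>"] by linarith
  then have "g t * \<bar>t\<bar> \<le> g t * t\<^sup>2" using g_nonneg by (intro mult_left_mono) (auto simp: power2_eq_square)
  then show ?thesis using g_nonneg[of 1] g_nonneg[of t] by (simp add: abs_mult Phi_def)
qed

section \<open>Young-type inequalities and comparison of flux and modular\<close>

text \<open>No conjugate function is involved: either b is small relative to a and the product is at
  most \<open>\<delta> * Phi a\<close>, or |a| lies below |b| / \<delta> and monotonicity of g
  bounds the product by \<open>Phi (b / \<delta>)\<close>.\<close>

lemma young_right:
  assumes "0 < \<delta>" "\<delta> \<le> 1"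
  shows "\<bar>g a * a\<bar> * \<bar>b\<bar> \<le> \<delta> * Phi a + Phi (b / \<delta>)"
proof (cases "\<bar>b\<bar> \<le> \<delta> * \<bar>a\<bar>")
  case True
  have "\<bar>g a * a\<bar> * \<bar>b\<bar> \<le> \<bar>g a * a\<bar> * (\<delta> * \<bar>a\<bar>)" using True by (intro mult_left_mono) auto
  also have "\<dots> = \<delta> * Phi a" using g_nonneg[of a] by (simp add: Phi_def abs_mult power2_eq_square mult_ac)
  finally show ?thesis using Phi_nonneg[of "b / \<delta>"] by linarith
next
  case False
  define \<beta> where "\<beta> = \<bar>b\<bar> / \<delta>"
  have 1: "\<bar>a\<bar> \<le> \<beta>" using False assms by (simp add: \<beta>_def pos_le_divide_eq mult.commute)
  have 2: "\<bar>b\<bar> \<le> \<beta>"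
    unfolding \<beta>_def using assms mult_left_mono[of \<delta> 1 "\<bar>b\<bar>"] by (simp add: pos_le_divide_eq)
  have "\<bar>g a * a\<bar> * \<bar>b\<bar> = g a * (\<bar>a\<bar> * \<bar>b\<bar>)" using g_nonneg[of a] by (simp add: abs_mult)
  also have "\<dots> \<le> g \<beta> * (\<beta> * \<beta>)" using 1 2 g_mono[of a \<beta>] g_nonneg by (intro mult_mono) auto
  also have "\<dots> = Phi (b / \<delta>)" using Phi_abs[of "b / \<delta>"] assms by (simp add: Phi_def \<beta>_def power2_eq_square)
  finally show ?thesis using Phi_nonneg[of a] assms by (simp add: add_increasing)
qed

text \<open>Counterpart of \<open>young_right\<close> with the small factor on the modular of b
  instead of a; the same case distinction with the two roles exchanged.\<close>

lemma young_left:
  assumes "0 < \<delta>" "\<delta> \<le> 1"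
  shows "\<bar>g a * a\<bar> * \<bar>b\<bar> \<le> \<delta> * Phi b + Phi a / \<delta>"
proof (cases "\<bar>a\<bar> \<le> \<delta> * \<bar>b\<bar>")
  case True
  have "\<bar>a\<bar> \<le> \<bar>b\<bar>" using True assms mult_right_mono[of \<delta> 1 "\<bar>b\<bar>"] by simp
  then have "g a \<le> g b" by (rule g_mono)
  then have "g a * (\<bar>a\<bar> * \<bar>b\<bar>) \<le> g b * (\<delta> * \<bar>b\<bar> * \<bar>b\<bar>)"
    using True g_nonneg by (intro mult_mono) (auto intro!: mult_right_mono)
  also have "\<dots> = \<delta> * Phi b" by (simp add: Phi_def power2_eq_square mult_ac)
  finally have "\<bar>g a * a\<bar> * \<bar>b\<bar> \<le> \<delta> * Phi b" using g_nonneg[of a] by (simp add: abs_mult)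
  moreover have "0 \<le> Phi a / \<delta>" using Phi_nonneg assms by simp
  ultimately show ?thesis by linarith
next
  case False
  then have "\<bar>b\<bar> \<le> \<bar>a\<bar> / \<delta>" using assms by (simp add: pos_le_divide_eq mult.commute)
  then have "\<bar>g a * a\<bar> * \<bar>b\<bar> \<le> \<bar>g a * a\<bar> * (\<bar>a\<bar> / \<delta>)" by (intro mult_left_mono) auto
  also have "\<dots> = Phi a / \<delta>" using g_nonneg[of a] by (simp add: Phi_def abs_mult power2_eq_square)
  finally show ?thesis using Phi_nonneg[of b] assms by (simp add: add_increasing)
qed

text \<open>Here e is the value of the cut-off, d the Laplacian of u, and y the lower order part of
  the Laplacian of the product with u. Since |y| \<le> e Z, the weight e factors out of every term.
  Parameter 1/4 in two Young inequalities leaves half of \<open>e * Phi d\<close>; the rest adds up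
  to 4 + 1 copies of \<open>Phi f\<close> and two of \<open>Phi (4 * Z)\<close>.\<close>

lemma caccioppoli_pointwise:
  assumes e: "0 \<le> e" and y: "\<bar>y\<bar> \<le> e * Z"
  shows "e * Phi d / 2 - 5 * (e * Phi f) - 2 * (e * Phi (4 * Z)) \<le> (g d * d - g f * f) * (e * d + y)"
proof -
  have Z: "0 \<le> e * Z" using y by linarith
  have 1: "\<bar>g f * f\<bar> * \<bar>d\<bar> \<le> 1 / 4 * Phi d + 4 * Phi f" using young_left[of "1/4" f d] by simp
  have 2: "\<bar>g d * d\<bar> * \<bar>Z\<bar> \<le> 1 / 4 * Phi d + Phi (4 * Z)" using young_right[of "1/4" d Z] by (simp add: mult.commute)
  have 3: "\<bar>g f * f\<bar> * \<bar>Z\<bar> \<le> Phi f + Phi (4 * Z)"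
    using young_right[of 1 f Z] Phi_mono[of Z "4 * Z"] by (simp add: abs_mult)
  have yZ: "\<bar>y\<bar> \<le> e * \<bar>Z\<bar>" using y mult_left_mono[OF abs_ge_self[of Z] e] by linarith
  have a: "(g f * f) * (e * d) \<le> e * (\<bar>g f * f\<bar> * \<bar>d\<bar>)"
    using mult_left_mono[OF abs_ge_self[of "g f * f * d"] e] by (simp add: abs_mult mult_ac)
  have b: "\<bar>(g d * d) * y\<bar> \<le> e * (\<bar>g d * d\<bar> * \<bar>Z\<bar>)"
    using mult_left_mono[OF yZ, of "\<bar>g d * d\<bar>"] by (simp add: abs_mult mult_ac)
  have c: "\<bar>(g f * f) * y\<bar> \<le> e * (\<bar>g f * f\<bar> * \<bar>Z\<bar>)"
    using mult_left_mono[OF yZ, of "\<bar>g f * f\<bar>"] by (simp add: abs_mult mult_ac)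
  have "(g d * d - g f * f) * (e * d + y) = e * Phi d - (g f * f) * (e * d) + (g d * d) * y - (g f * f) * y"
    by (simp add: Phi_def power2_eq_square algebra_simps)
  also have "\<dots> \<ge> e * Phi d - e * (\<bar>g f * f\<bar> * \<bar>d\<bar>) - e * (\<bar>g d * d\<bar> * \<bar>Z\<bar>) - e * (\<bar>g f * f\<bar> * \<bar>Z\<bar>)"
    using a b c by linarith
  finally have "e * Phi d - e * (\<bar>g f * f\<bar> * \<bar>d\<bar>) - e * (\<bar>g d * d\<bar> * \<bar>Z\<bar>) - e * (\<bar>g f * f\<bar> * \<bar>Z\<bar>) \<le> (g d * d - g f * f) * (e * d + y)" .
  moreover have "e * (\<bar>g f * f\<bar> * \<bar>d\<bar>) + e * (\<bar>g d * d\<bar> * \<bar>Z\<bar>) + e * (\<bar>g f * f\<bar> * \<bar>Z\<bar>) \<le> e * (Phi d / 2 + 5 * Phi f + 2 * Phi (4 * Z))"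
    unfolding distrib_left[symmetric] using 1 2 3 e by (intro mult_left_mono) linarith+
  ultimately show ?thesis by (simp add: algebra_simps)
qed

lemma A_strict_mono: "\<bar>s\<bar> < \<bar>t\<bar> \<Longrightarrow> \<bar>g s * s\<bar> < \<bar>g t * t\<bar>"
proof -
  assume st: "\<bar>s\<bar> < \<bar>t\<bar>"
  then have t: "g t > 0" using pos[of "\<bar>t\<bar>"] g_abs[of t] by linarith
  have "g s * \<bar>s\<bar> \<le> g t * \<bar>s\<bar>" using st g_mono[of s t] by (intro mult_right_mono) auto
  also have "\<dots> < g t * \<bar>t\<bar>" using st t by simp
  finally show ?thesis using g_nonneg t by (simp add: abs_mult)
qed

text \<open>Twice the flux at f is at most the flux at 2 f, because g increases; strict monotonicity
  of the flux then gives |d| \<le> |2 f|.\<close>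

lemma Phi_le_of_A_le:
  assumes "\<bar>g d * d\<bar> \<le> 2 * \<bar>g f * f\<bar>"
  shows "Phi d \<le> 2 ^ (N + 2) * Phi f"
proof -
  have "2 * \<bar>g f * f\<bar> \<le> \<bar>g (2 * f) * (2 * f)\<bar>"
    using g_mono[of f "2 * f"] g_nonneg mult_right_mono[of "g f" "g (2 * f)" "2 * \<bar>f\<bar>"] by (simp add: abs_mult)
  then have "\<bar>d\<bar> \<le> \<bar>2 * f\<bar>" using assms A_strict_mono[of "2 * f" d] by linarith
  then have "Phi d \<le> Phi (2 * f)" by (rule Phi_mono)
  also have "\<dots> \<le> 2 ^ (N + 2) * Phi f" by (rule Phi_scale) simp
  finally show ?thesis .
qed

text \<open>A weighted Young inequality whose weight \<kappa> sits on the flux at T: when T is the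
  quantity to be estimated, that term can be absorbed. Either |s| \<le> \<kappa> T, or the flux is
  the modular divided by |s| > \<kappa> T.\<close>

lemma A_split:
  assumes "0 < T" "0 < \<kappa>" "\<kappa> \<le> 1"
  shows "\<bar>g s * s\<bar> \<le> \<kappa> * (g T * T) + Phi s / (\<kappa> * T)"
proof (cases "\<bar>s\<bar> \<le> \<kappa> * T")
  case True
  have "\<bar>s\<bar> \<le> T" using True assms mult_right_mono[of \<kappa> 1 T] by linarith
  then have "g s * \<bar>s\<bar> \<le> g T * (\<kappa> * T)" using True g_mono[of s T] g_nonneg assms by (intro mult_mono) auto
  then show ?thesis using Phi_nonneg[of s] assms g_nonneg[of s] by (simp add: abs_mult mult_ac add_increasing2)
next
  case False
  have "\<bar>g s * s\<bar> * (\<kappa> * T) \<le> \<bar>g s * s\<bar> * \<bar>s\<bar>" using False by (intro mult_left_mono) auto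
  also have "\<dots> = Phi s" using g_nonneg[of s] by (simp add: Phi_def abs_mult power2_eq_square)
  finally have "\<bar>g s * s\<bar> \<le> Phi s / (\<kappa> * T)" using assms by (simp add: pos_le_divide_eq)
  moreover have "0 \<le> \<kappa> * (g T * T)" using assms g_nonneg by simp
  ultimately show ?thesis by linarith
qed

text \<open>This replaces Jensen's inequality for the conjugate of the N-function: a bound of the flux
  by a mean of the flux is turned into a bound of the modular by a mean of the modular.\<close>

lemma Phi_le_modular_mean:
  assumes fin: "finite_measure M" and b: "measure M (space M) \<le> b" and M0: "0 \<le> m"
    and d: "integrable M (\<lambda>y. Phi (u y))" "u \<in> borel_measurable M"
    and f: "integrable M (\<lambda>y. Phi (v y))" "v \<in> borel_measurable M"
    and T: "\<bar>g T * T\<bar> \<le> 2 * m * (LINT y|M. \<bar>g (u y) * u y\<bar> + \<bar>g (v y) * v y\<bar>)"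
  shows "Phi T \<le> 4 * m * (1 + 8 * m * b) * (LINT y|M. Phi (u y) + Phi (v y))"
proof (cases "T = 0")
  case True
  have "0 \<le> b" using b measure_nonneg[of M "space M"] by linarith
  then show ?thesis using True M0 Phi_nonneg by (auto simp: Phi_def[of 0] intro!: mult_nonneg_nonneg integral_nonneg_AE add_nonneg_nonneg)
next
  case False
  interpret finite_measure M by fact
  define t where "t = \<bar>T\<bar>"
  have t: "t > 0" using False by (simp add: t_def)
  have b0: "0 \<le> b" using b measure_nonneg[of M "space M"] by linarith
  \<comment> \<open>This choice makes \<open>4 * m * b * \<kappa>\<close> at most 1/2, so the flux
    at T on the right is absorbed; multiplying what is left by t turns it into
    \<open>Phi T\<close>.\<close>
  define \<kappa> where "\<kappa> = 1 / (1 + 8 * m * b)"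
  have k1: "1 + 8 * m * b > 0" using M0 b0 by (simp add: add_pos_nonneg)
  have k: "0 < \<kappa>" "\<kappa> \<le> 1" using k1 M0 b0 by (auto simp: \<kappa>_def)
  define I where "I = (LINT y|M. Phi (u y) + Phi (v y))"
  define At where "At = g t * t"
  have At: "0 \<le> At" "\<bar>g T * T\<bar> = At" using t g_nonneg g_abs[of T] by (auto simp: At_def t_def abs_mult)
  have "(LINT y|M. \<bar>g (u y) * u y\<bar> + \<bar>g (v y) * v y\<bar>) \<le> (LINT y|M. 2 * \<kappa> * At + (Phi (u y) + Phi (v y)) / (\<kappa> * t))"
  proof (rule integral_mono)
    have A: "integrable M (\<lambda>y. \<bar>g (h y) * h y\<bar>)" if "integrable M (\<lambda>y. Phi (h y))" "h \<in> borel_measurable M" for h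
    proof (rule Bochner_Integration.integrable_bound[of M "\<lambda>y. g 1 + Phi (h y)"])
      show "(\<lambda>y. \<bar>g (h y) * h y\<bar>) \<in> borel_measurable M" using measurable_compose[OF that(2) A_measurable] by simp
      show "AE y in M. norm \<bar>g (h y) * h y\<bar> \<le> norm (g 1 + Phi (h y))"
        using A_le g_nonneg Phi_nonneg by (intro AE_I2) (simp add: abs_of_nonneg)
    qed (use that in simp)
    show "integrable M (\<lambda>y. \<bar>g (u y) * u y\<bar> + \<bar>g (v y) * v y\<bar>)" using A d f by simp
    show "integrable M (\<lambda>y. 2 * \<kappa> * At + (Phi (u y) + Phi (v y)) / (\<kappa> * t))" using d f by simp
    show "\<bar>g (u y) * u y\<bar> + \<bar>g (v y) * v y\<bar> \<le> 2 * \<kappa> * At + (Phi (u y) + Phi (v y)) / (\<kappa> * t)" for y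
      using A_split[OF t k, of "u y"] A_split[OF t k, of "v y"] by (simp add: At_def add_divide_distrib)
  qed
  also have "\<dots> = measure M (space M) * (2 * \<kappa> * At) + I / (\<kappa> * t)"
    using d f by (simp add: I_def)
  also have "\<dots> \<le> b * (2 * \<kappa> * At) + I / (\<kappa> * t)"
    using b k At by (intro add_mono mult_right_mono) auto
  finally have X: "(LINT y|M. \<bar>g (u y) * u y\<bar> + \<bar>g (v y) * v y\<bar>) \<le> b * (2 * \<kappa> * At) + I / (\<kappa> * t)" .
  have "At \<le> 2 * m * (b * (2 * \<kappa> * At) + I / (\<kappa> * t))"
    using T mult_left_mono[OF X, of "2 * m"] M0 At(2) by linarith
  also have "\<dots> = (4 * m * b * \<kappa>) * At + 2 * m * I / (\<kappa> * t)" by (simp add: algebra_simps)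
  also have "(4 * m * b * \<kappa>) * At \<le> (1 / 2) * At"
    using At(1) k1 M0 b0 by (intro mult_right_mono) (auto simp: \<kappa>_def pos_divide_le_eq)
  finally have "At \<le> 4 * m * I / (\<kappa> * t)" by simp
  then have "At * t \<le> 4 * m * I / \<kappa>" using t k by (simp add: field_simps)
  moreover have "At * t = Phi T" using Phi_abs[of T] unfolding At_def Phi_def t_def[symmetric] by (simp add: power2_eq_square)
  ultimately show ?thesis by (simp add: \<kappa>_def I_def algebra_simps)
qed

end

text \<open>Besides the growth bound, the point to check is continuity of g: right-continuity at 0,
  differentiability for t > 0, and evenness for t < 0.\<close>

lemma N_growth_of_A1:
  assumes g: "N_function_generator g" and A1: "condition_A1 g"
  obtains N where "N_growth g N"
proof -
  obtain N :: nat where N: "\<And>t l. 0 < t \<Longrightarrow> 1 \<le> l \<Longrightarrow> g (l * t) \<le> l ^ N * g t"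
    using A1_power_growth[OF assms] by blast
  have ev: "g (- t) = g t" for t using g by (simp add: N_function_generator_def)
  have "N_growth g N"
  proof
    have c: "continuous_on {0..} g"
      unfolding continuous_on_eq_continuous_within
    proof
      fix t :: real assume "t \<in> {0..}"
      then consider "t = 0" | "t > 0" by fastforce
      then show "continuous (at t within {0..}) g"
      proof cases
        case 1
        then show ?thesis using g by (simp add: N_function_generator_def at_within_Ici_at_right)
      next
        case 2
        then have "g differentiable (at t)" using A1 by (simp add: condition_A1_def)
        then have "isCont g t" by (rule differentiable_imp_continuous_within)
        then show ?thesis by (rule continuous_at_imp_continuous_at_within)
      qed
    qed
    have "continuous_on UNIV (\<lambda>t. g \<bar>t\<bar>)"
      by (rule continuous_on_compose2[OF c]) (auto intro: continuous_intros)
    moreover have "g \<bar>t\<bar> = g t" for t using ev[of t] by (cases "t \<ge> 0") auto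
    ultimately show "continuous_on UNIV g" by simp
  qed (use g N in \<open>auto simp: N_function_generator_def mono_on_def\<close>)
  then show ?thesis using that by blast
qed

section \<open>Weak solutions\<close>

context N_growth
begin

lemma LG_iff: "u \<in> LG g U \<longleftrightarrow> u \<in> borel_measurable (lebesgue_on U) \<and> integrable (lebesgue_on U) (\<lambda>x. Phi (u x))"
  unfolding LG_def using integrable_G_iff[of u "lebesgue_on U"] by blast

text \<open>Gluing shows that the chosen representative is a weak derivative on all of \<Omega>;
  uniqueness then transfers integrability from the local witnesses to it.\<close>

lemma weak_derivative_W2G:
  assumes \<Omega>: "open \<Omega>" and u: "u \<in> W2G_loc g \<Omega>" and \<alpha>: "length \<alpha> \<le> 2"
  shows "has_weak_derivative \<Omega> \<alpha> u (weak_derivative \<Omega> \<alpha> u)"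
    and "compactly_contained U \<Omega> \<Longrightarrow> weak_derivative \<Omega> \<alpha> u \<in> LG g U"
proof -
  have loc: "\<exists>v\<in>LG g U. has_weak_derivative U \<alpha> u v" if "compactly_contained U \<Omega>" for U
    using u \<alpha> that by (auto simp: W2G_loc_def W2G_def)
  have "\<exists>v. has_weak_derivative \<Omega> \<alpha> u v"
    by (rule has_weak_derivative_local[OF \<Omega>]) (use loc in blast)
  then show hw: "has_weak_derivative \<Omega> \<alpha> u (weak_derivative \<Omega> \<alpha> u)"
    unfolding weak_derivative_def by (rule someI_ex)
  assume U: "compactly_contained U \<Omega>"
  then have UO: "open U" and Us: "U \<in> sets lebesgue"
    by (auto simp: compactly_contained_def)
  obtain v where v: "v \<in> LG g U" "has_weak_derivative U \<alpha> u v" using loc[OF U] by blast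
  have ae: "AE x in lebesgue_on U. v x = weak_derivative \<Omega> \<alpha> u x"
    by (rule has_weak_derivative_unique[OF v(2) has_weak_derivative_subset[OF hw UO compactly_contained_subset[OF U] \<Omega>] UO])
  then have ae': "AE x in lebesgue_on U. Phi (v x) = Phi (weak_derivative \<Omega> \<alpha> u x)"
    by eventually_elim simp
  have "v \<in> borel_measurable (lebesgue_on U)" "integrable (lebesgue_on U) (\<lambda>x. Phi (v x))"
    using v(1) by (auto simp: LG_iff)
  then show "weak_derivative \<Omega> \<alpha> u \<in> LG g U"
    unfolding LG_iff by (intro conjI borel_measurable_lebesgue_on_AE[OF _ ae Us] integrable_lebesgue_on_AE[OF _ ae' Us])
qed

lemma weak_laplacian_LG:
  assumes "open \<Omega>" "u \<in> W2G_loc g \<Omega>" "compactly_contained U \<Omega>"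
  shows "weak_laplacian \<Omega> u \<in> LG g U"
proof -
  have "weak_derivative \<Omega> [i, i] u \<in> LG g U" for i by (rule weak_derivative_W2G(2)[OF assms(1,2) _ assms(3)]) simp
  then show ?thesis
    unfolding LG_iff weak_laplacian_def[abs_def] by (auto intro!: integrable_Phi_sum borel_measurable_sum)
qed

lemma weak_gradient_LG:
  assumes "open \<Omega>" "u \<in> W2G_loc g \<Omega>" "compactly_contained U \<Omega>"
  shows "(\<lambda>x. norm (weak_gradient \<Omega> u x)) \<in> LG g U"
proof -
  have d: "weak_derivative \<Omega> [i] u \<in> LG g U" for i by (rule weak_derivative_W2G(2)[OF assms(1,2) _ assms(3)]) simp
  have m: "(\<lambda>x. norm (weak_gradient \<Omega> u x)) \<in> borel_measurable (lebesgue_on U)"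
  proof -
    have [measurable]: "weak_derivative \<Omega> [i] u \<in> borel_measurable (lebesgue_on U)" for i
      using d[of i] by (simp add: LG_iff)
    show ?thesis unfolding norm_vec_def L2_set_def weak_gradient_def by simp
  qed
  have "integrable (lebesgue_on U) (\<lambda>x. Phi (\<Sum>i\<in>UNIV. \<bar>weak_derivative \<Omega> [i] u x\<bar>))"
    using d by (intro integrable_Phi_sum) (auto simp: LG_iff Phi_abs intro!: borel_measurable_abs)
  then have "integrable (lebesgue_on U) (\<lambda>x. Phi (norm (weak_gradient \<Omega> u x)))"
  proof (rule integrable_Phi_bound[OF _ m])
    show "\<bar>norm (weak_gradient \<Omega> u x)\<bar> \<le> 1 * \<bar>\<Sum>i\<in>UNIV. \<bar>weak_derivative \<Omega> [i] u x\<bar>\<bar>" for x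
      using norm_le_l1_cart[of "weak_gradient \<Omega> u x"] by (simp add: weak_gradient_def)
  qed simp
  with m show ?thesis by (simp add: LG_iff)
qed

text \<open>The set U has finite measure, and a \<le> 1 + a^q for a \<ge> 0 and q \<ge> 1.\<close>

lemma LG_of_Lq_loc:
  assumes f: "f \<in> borel_measurable (lebesgue_on \<Omega>)" "(\<lambda>x. N_function g (f x)) \<in> Lq_loc q \<Omega>" and q: "q \<ge> 1"
    and U: "compactly_contained U \<Omega>"
  shows "f \<in> LG g U"
proof -
  have m: "f \<in> borel_measurable (lebesgue_on U)"
    using measurable_restrict_mono[OF f(1) compactly_contained_subset[OF U]] .
  interpret finite_measure "lebesgue_on U" by (rule finite_measure_lebesgue_on[OF compactly_contained_lmeasurable[OF U]])
  have i: "integrable (lebesgue_on U) (\<lambda>x. N_function g (f x) powr q)"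
    using f(2) U G_nonneg by (auto simp: Lq_loc_def Lq_def)
  have "integrable (lebesgue_on U) (\<lambda>x. N_function g (f x))"
  proof (rule Bochner_Integration.integrable_bound[of _ "\<lambda>x. 1 + N_function g (f x) powr q"])
    show "(\<lambda>x. N_function g (f x)) \<in> borel_measurable (lebesgue_on U)" using measurable_compose[OF m G_measurable] .
    show "AE x in lebesgue_on U. norm (N_function g (f x)) \<le> norm (1 + N_function g (f x) powr q)"
    proof (rule AE_I2)
      fix x
      have "N_function g (f x) \<le> 1 + N_function g (f x) powr q"
      proof (cases "N_function g (f x) \<le> 1")
        case True
        then show ?thesis using powr_ge_zero[of "N_function g (f x)" q] by linarith
      next
        case False
        then have "N_function g (f x) powr 1 \<le> N_function g (f x) powr q" using q by (intro powr_mono) auto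
        then show ?thesis using False by simp
      qed
      then show "norm (N_function g (f x)) \<le> norm (1 + N_function g (f x) powr q)" using G_nonneg[of "f x"] by simp
    qed
  qed (use i in simp)
  then show ?thesis using m by (simp add: LG_def)
qed

lemma flux_Lq_loc:
  assumes "\<And>U. compactly_contained U \<Omega> \<Longrightarrow> v \<in> LG g U"
  shows "(\<lambda>x. g (v x) * v x) \<in> Lq_loc 1 \<Omega>"
  unfolding Lq_loc_1_iff
proof (intro allI impI)
  fix U assume U: "compactly_contained U \<Omega>"
  interpret finite_measure "lebesgue_on U" by (rule finite_measure_lebesgue_on[OF compactly_contained_lmeasurable[OF U]])
  have v: "v \<in> borel_measurable (lebesgue_on U)" "integrable (lebesgue_on U) (\<lambda>x. Phi (v x))"
    using assms[OF U] by (auto simp: LG_iff)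
  show "integrable (lebesgue_on U) (\<lambda>x. g (v x) * v x)"
  proof (rule Bochner_Integration.integrable_bound[of _ "\<lambda>y. g 1 + Phi (v y)"])
    show "(\<lambda>y. g (v y) * v y) \<in> borel_measurable (lebesgue_on U)" using measurable_compose[OF v(1) A_measurable] .
    show "AE y in lebesgue_on U. norm (g (v y) * v y) \<le> norm (g 1 + Phi (v y))"
      using A_le g_nonneg Phi_nonneg by (intro AE_I2) (simp add: abs_of_nonneg)
  qed (use v in simp)
qed

end

section \<open>The flux difference and local higher integrability\<close>

text \<open>A weak solution only comes with a locally integrable flux of f; local integrability of
  the modular of f is therefore assumed separately, and is supplied by
  \<open>LG_of_Lq_loc\<close>.\<close>

locale weak_solution = N_growth +
  fixes \<Omega> :: "(real^'n::finite) set" and u f :: "real^'n \<Rightarrow> real"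
  assumes open_\<Omega>: "open \<Omega>"
    and sol: "local_weak_solution g \<Omega> f u"
    and f_LG: "compactly_contained U \<Omega> \<Longrightarrow> f \<in> LG g U"
begin

abbreviation d :: "real^'n \<Rightarrow> real" where "d \<equiv> weak_laplacian \<Omega> u"
abbreviation gr :: "real^'n \<Rightarrow> real" where "gr x \<equiv> norm (weak_gradient \<Omega> u x)"
abbreviation Psi :: "real^'n \<Rightarrow> real" where "Psi x \<equiv> Phi (f x) + Phi (u x) + Phi (gr x)"
definition W :: "real^'n \<Rightarrow> real" where "W x = g (d x) * d x - g (f x) * f x"

lemma u_W2G: "u \<in> W2G_loc g \<Omega>" using sol by (simp add: local_weak_solution_def)

lemma u_LG: "compactly_contained U \<Omega> \<Longrightarrow> u \<in> LG g U" using u_W2G by (auto simp: W2G_loc_def W2G_def)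

lemmas d_LG = weak_laplacian_LG[OF open_\<Omega> u_W2G]
lemmas gr_LG = weak_gradient_LG[OF open_\<Omega> u_W2G]

lemma Ad_loc: "(\<lambda>x. g (d x) * d x) \<in> Lq_loc 1 \<Omega>" by (rule flux_Lq_loc[OF d_LG])
lemma Af_loc: "(\<lambda>x. g (f x) * f x) \<in> Lq_loc 1 \<Omega>" by (rule flux_Lq_loc[OF f_LG])
lemma W_loc: "W \<in> Lq_loc 1 \<Omega>" using Ad_loc Af_loc by (simp add: Lq_loc_1_iff W_def[abs_def])

text \<open>Extension by zero gives one globally integrable function, as the mollification results
  demand; test functions supported in V do not see the truncation.\<close>

lemma W_restrict:
  assumes V: "compactly_contained V \<Omega>"
  shows "integrable lebesgue (\<lambda>x. if x \<in> V then W x else 0)"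
    and "\<phi> \<in> test_functions V \<Longrightarrow> (LINT x|lebesgue. (if x \<in> V then W x else 0) * laplacian \<phi> x) = 0"
proof -
  note Vs = compactly_contained_sets_lebesgue[OF V]
  show "integrable lebesgue (\<lambda>x. if x \<in> V then W x else 0)"
    using V Vs W_loc by (simp add: Lebesgue_Measure.integrable_restrict_UNIV Lq_loc_1_iff)
  assume phi: "\<phi> \<in> test_functions V"
  have phi': "\<phi> \<in> test_functions \<Omega>" using phi test_functions_mono[OF compactly_contained_subset[OF V]] by blast
  obtain K where K: "compact K" "K \<subseteq> V" "\<And>\<alpha> x. x \<notin> K \<Longrightarrow> partials \<alpha> \<phi> x = 0"
    using test_function_support[OF phi] by blast
  have L0: "laplacian \<phi> x = 0" if "x \<notin> K" for x using K(3)[OF that] by (simp add: laplacian_def)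
  have K\<Omega>: "K \<subseteq> \<Omega>" using K(2) compactly_contained_subset[OF V] by blast
  have Lc: "continuous_on UNIV (laplacian \<phi>)"
    unfolding laplacian_def[abs_def] by (intro continuous_on_sum test_function_continuous_partials[OF phi])
  note m = Lq_loc_1_mult[OF _ open_\<Omega> Lc K(1) K\<Omega> L0]
  have "(LINT x|lebesgue_on \<Omega>. W x * laplacian \<phi> x) =
      (LINT x|lebesgue_on \<Omega>. g (d x) * d x * laplacian \<phi> x) - (LINT x|lebesgue_on \<Omega>. g (f x) * f x * laplacian \<phi> x)"
    using m[OF Ad_loc] m[OF Af_loc] by (simp add: W_def left_diff_distrib)
  also have "\<dots> = 0" using sol phi' by (simp add: local_weak_solution_def)
  finally have "(LINT x|lebesgue_on \<Omega>. W x * laplacian \<phi> x) = 0" .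
  moreover have "(LINT x|lebesgue_on \<Omega>. W x * laplacian \<phi> x) = (LINT x|lebesgue. W x * laplacian \<phi> x)"
    by (rule Lq_loc_1_mult_lebesgue(2)[OF W_loc open_\<Omega> Lc K(1) K\<Omega> L0])
  moreover have "(\<lambda>x. (if x \<in> V then W x else 0) * laplacian \<phi> x) = (\<lambda>x. W x * laplacian \<phi> x)"
    using L0 K(2) by (intro ext) auto
  ultimately show "(LINT x|lebesgue. (if x \<in> V then W x else 0) * laplacian \<phi> x) = 0" by simp
qed

text \<open>By \<open>weyl_moll\<close>, W is an average against a kernel bounded by 2 / e^n, n the
  dimension, divided by the mass of the profile.\<close>

lemma W_sup_bound:
  assumes V: "compactly_contained V \<Omega>" and K: "open K" "0 < e" "\<And>x. x \<in> K \<Longrightarrow> cball x e \<subseteq> V"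
  shows "AE x in lebesgue. x \<in> K \<longrightarrow> \<bar>W x\<bar> \<le> 2 / e ^ CARD('n) / moll_mass TYPE('n) *
      (LINT y|lebesgue_on V. \<bar>g (d y) * d y\<bar> + \<bar>g (f y) * f y\<bar>)"
proof -
  let ?h = "\<lambda>y. \<bar>g (d y) * d y\<bar> + \<bar>g (f y) * f y\<bar>"
  let ?w = "\<lambda>x. if x \<in> V then W x else 0"
  note Vs = compactly_contained_sets_lebesgue[OF V]
  have "AE x in lebesgue. x \<in> K \<longrightarrow> ?w x = (LINT y|lebesgue. ?w y * moll e x y) / moll_mass TYPE('n)"
    by (rule weyl_moll[OF W_restrict(1)[OF V] W_restrict(2)[OF V] K])
  then show ?thesis
  proof eventually_elim
    case (elim x)
    show ?case
    proof
      assume x: "x \<in> K"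
      have xV: "x \<in> V" using K(3)[OF x] K(2) by (auto simp: subset_iff)
      have Ai: "integrable (lebesgue_on V) (\<lambda>y. ?h y)"
        using Ad_loc Af_loc V by (simp add: Lq_loc_1_iff)
      have "norm (LINT y|lebesgue. ?w y * moll e x y) \<le> (LINT y|lebesgue. 2 / e ^ CARD('n) * (if y \<in> V then ?h y else 0))"
      proof (rule Bochner_Integration.integral_norm_bound_integral)
        show "integrable lebesgue (\<lambda>y. ?w y * moll e x y)"
          using moll_bound[OF K(2), of x]
          by (intro mult_bounded_integrable[OF W_restrict(1)[OF V] elementary_continuous[OF elementary_moll]]) auto
        show "integrable lebesgue (\<lambda>y. 2 / e ^ CARD('n) * (if y \<in> V then ?h y else 0))"
          using Ai Vs by (intro integrable_mult_right) (simp add: Lebesgue_Measure.integrable_restrict_UNIV)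
        show "norm (?w y * moll e x y) \<le> 2 / e ^ CARD('n) * (if y \<in> V then ?h y else 0)" for y
        proof (cases "y \<in> V")
          case True
          have "\<bar>W y\<bar> * \<bar>moll e x y\<bar> \<le> ?h y * (2 / e ^ CARD('n))"
            using moll_bound[OF K(2), of x y] abs_triangle_ineq4 by (intro mult_mono) (auto simp: W_def)
          then show ?thesis using True by (simp only: if_True real_norm_def abs_mult[of "W y" "moll e x y"] mult.commute[of "2 / e ^ CARD('n)"])
        qed simp
      qed
      also have "\<dots> = 2 / e ^ CARD('n) * (LINT y|lebesgue_on V. ?h y)"
        using Vs by (simp only: integral_mult_right_zero Lebesgue_Measure.integral_restrict_UNIV)
      finally have I: "\<bar>LINT y|lebesgue. ?w y * moll e x y\<bar> \<le> 2 / e ^ CARD('n) * (LINT y|lebesgue_on V. ?h y)"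
        by simp
      have "\<bar>W x\<bar> = \<bar>LINT y|lebesgue. ?w y * moll e x y\<bar> / moll_mass TYPE('n)"
        using elim x xV moll_mass_pos[where 'n='n] by simp
      also have "\<dots> \<le> 2 / e ^ CARD('n) * (LINT y|lebesgue_on V. ?h y) / moll_mass TYPE('n)"
        using I moll_mass_pos[where 'n='n] by (intro divide_right_mono) auto
      finally show "\<bar>W x\<bar> \<le> 2 / e ^ CARD('n) / moll_mass TYPE('n) * (LINT y|lebesgue_on V. ?h y)"
        by simp
    qed
  qed
qed

text \<open>The flux of d is the sum of W and the flux of f, so one of the two is at least half as
  large.\<close>

lemma flux_dichotomy: "\<bar>g (d x) * d x\<bar> \<le> 2 * \<bar>g (f x) * f x\<bar> \<or> \<bar>g (d x) * d x\<bar> \<le> 2 * \<bar>W x\<bar>"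
  using abs_triangle_ineq[of "W x" "g (f x) * f x"] by (auto simp: W_def)

text \<open>On U the function W is bounded. So where f does not control the Laplacian, the flux of
  the Laplacian is bounded by a constant, and then so is the Laplacian. The quantitative estimate
  later takes its integrability from here.\<close>

lemma G_laplacian_Lq_loc:
  assumes f: "(\<lambda>x. N_function g (f x)) \<in> Lq_loc q \<Omega>" and q: "q \<ge> 1"
  shows "(\<lambda>x. N_function g (d x)) \<in> Lq_loc q \<Omega>"
proof -
  have "(\<lambda>x. N_function g (d x)) \<in> Lq q U" if U: "compactly_contained U \<Omega>" for U
  proof -
    have clU: "compact (closure U)" "closure U \<subseteq> \<Omega>" and UO: "open U" using U by (auto simp: compactly_contained_def)
    note Us = compactly_contained_sets_lebesgue[OF U]
    obtain V e where V: "compactly_contained V \<Omega>" "e > 0" "\<And>x. x \<in> closure U \<Longrightarrow> cball x e \<subseteq> V"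
      using compactly_contained_nbhd[OF clU(1) open_\<Omega> clU(2)] by blast
    define M where "M = 2 / e ^ CARD('n) / moll_mass TYPE('n) * (LINT y|lebesgue_on V. \<bar>g (d y) * d y\<bar> + \<bar>g (f y) * f y\<bar>)"
    have bd: "AE x in lebesgue. x \<in> U \<longrightarrow> \<bar>W x\<bar> \<le> M"
      unfolding M_def using V closure_subset[of U] by (intro W_sup_bound UO) auto
    \<comment> \<open>Unboundedness of the flux converts the bound 2 M for the flux into a bound T
      for its argument.\<close>
    obtain T where T: "T > 0" "2 * M < g T * T"
    proof -
      have "\<forall>\<^sub>F t in at_top. 2 * M < g t * t" using unbounded by (simp add: filterlim_at_top_dense)
      then have "\<forall>\<^sub>F t in at_top. 2 * M < g t * t \<and> t > 0"
        by (intro eventually_conj eventually_gt_at_top)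
      then obtain t where "2 * M < g t * t" "t > 0"
        using eventually_happens'[OF trivial_limit_at_top_linorder] by blast
      then show ?thesis using that by blast
    qed
    define C where "C = 2 ^ (N + 2) * 2 ^ (N + 2) + Phi T"
    have C: "C \<ge> 0" using Phi_nonneg by (simp add: C_def)
    have pt: "N_function g (d x) \<le> C * (N_function g (f x) + 1)" if x: "\<bar>W x\<bar> \<le> M" for x
    proof -
      have "Phi (d x) \<le> 2 ^ (N + 2) * Phi (f x) \<or> Phi (d x) \<le> Phi T"
      proof (cases "\<bar>g (d x) * d x\<bar> \<le> 2 * \<bar>g (f x) * f x\<bar>")
        case False
        then have "\<bar>g (d x) * d x\<bar> \<le> 2 * M" using flux_dichotomy[of x] x by linarith
        also have "\<dots> < \<bar>g T * T\<bar>" using T by linarith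
        finally have "\<bar>d x\<bar> \<le> \<bar>T\<bar>" using A_strict_mono[of T "d x"] by linarith
        then show ?thesis using Phi_mono by blast
      qed (use Phi_le_of_A_le in blast)
      moreover have "2 ^ (N + 2) * Phi (f x) \<le> 2 ^ (N + 2) * (2 ^ (N + 2) * N_function g (f x))"
        using Phi_le_G by (intro mult_left_mono) auto
      moreover have "0 \<le> 2 ^ (N + 2) * (2 ^ (N + 2) * N_function g (f x))" using G_nonneg by simp
      ultimately have "N_function g (d x) \<le> 2 ^ (N + 2) * (2 ^ (N + 2) * N_function g (f x)) + Phi T"
        using G_le_Phi[of "d x"] Phi_nonneg[of T] by linarith
      also have "\<dots> \<le> C * (N_function g (f x) + 1)"
        using Phi_nonneg[of T] G_nonneg[of "f x"] by (simp add: C_def algebra_simps)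
      finally show ?thesis .
    qed
    have m: "(\<lambda>x. N_function g (d x)) \<in> borel_measurable (lebesgue_on U)"
      using measurable_compose[OF _ G_measurable, of d] d_LG[OF U] by (simp add: LG_def)
    interpret finite_measure "lebesgue_on U" by (rule finite_measure_lebesgue_on[OF compactly_contained_lmeasurable[OF U]])
    have fi: "integrable (lebesgue_on U) (\<lambda>x. N_function g (f x) powr q)"
      using f U G_nonneg by (auto simp: Lq_loc_def Lq_def)
    have "integrable (lebesgue_on U) (\<lambda>x. \<bar>N_function g (d x)\<bar> powr q)"
    proof (rule Bochner_Integration.integrable_bound[of _ "\<lambda>x. (2 * C) powr q * (N_function g (f x) powr q + 1)"])
      show "integrable (lebesgue_on U) (\<lambda>x. (2 * C) powr q * (N_function g (f x) powr q + 1))" using fi by simp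
      show "(\<lambda>x. \<bar>N_function g (d x)\<bar> powr q) \<in> borel_measurable (lebesgue_on U)" using m by simp
      have "AE x in lebesgue. x \<in> U \<longrightarrow> norm (\<bar>N_function g (d x)\<bar> powr q) \<le> norm ((2 * C) powr q * (N_function g (f x) powr q + 1))"
        using bd
      proof eventually_elim
        case (elim x)
        show ?case
        proof
          assume x: "x \<in> U"
          define a where "a = N_function g (f x)"
          have a: "a \<ge> 0" by (simp add: a_def G_nonneg)
          have "N_function g (d x) powr q \<le> (C * (a + 1)) powr q"
            using pt[of x] elim x q G_nonneg by (intro powr_mono2) (auto simp: a_def)
          \<comment> \<open>Through the maximum: a + 1 \<le> 2 max a 1, and (max a 1)^q \<le> a^q +
            1.\<close>
          also have "\<dots> \<le> (2 * C * max a 1) powr q"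
            using a C q mult_left_mono[of "a + 1" "2 * max a 1" C] by (intro powr_mono2) (auto simp: mult_ac)
          also have "\<dots> = (2 * C) powr q * (max a 1) powr q" using C a by (simp add: powr_mult)
          also have "\<dots> \<le> (2 * C) powr q * (a powr q + 1)"
            by (intro mult_left_mono) (auto simp: max_def)
          finally show "norm (\<bar>N_function g (d x)\<bar> powr q) \<le> norm ((2 * C) powr q * (N_function g (f x) powr q + 1))"
            using G_nonneg[of "d x"] by (simp add: a_def)
        qed
      qed
      then show "AE x in lebesgue_on U. norm (\<bar>N_function g (d x)\<bar> powr q) \<le> norm ((2 * C) powr q * (N_function g (f x) powr q + 1))"
        using Us by (simp add: AE_restrict_space_iff)
    qed
    then show ?thesis using m by (simp add: Lq_def)
  qed
  then show ?thesis by (simp add: Lq_loc_def)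
qed

end

section \<open>The Caccioppoli inequality\<close>

lemma compactly_contained_ball:
  fixes x0 :: "'a::euclidean_space"
  assumes "ball x0 (4 * r) \<subseteq> \<Omega>" "s < 4 * r"
  shows "compactly_contained (ball x0 s) \<Omega>"
proof -
  have "closure (ball x0 s) \<subseteq> cball x0 s" by (rule closure_minimal) auto
  moreover have "cball x0 s \<subseteq> ball x0 (4 * r)" using assms(2) by auto
  ultimately show ?thesis using assms(1) unfolding compactly_contained_def
    by (auto simp: compact_closure)
qed

text \<open>The cut-off \<open>flat_exp 0 (4 r\<^sup>2 - |x - x0|\<^sup>2)\<close> loses only a power of its argument under
  differentiation, so a sufficiently high power of the ratio is still bounded after multiplication
  by the cut-off.\<close>

lemma cutoff_bound:
  fixes x x0 :: "real^'n::finite" and grad :: "real^'n" and r R L a :: real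
  defines "Q \<equiv> quad (4 * r\<^sup>2) 1 x0 x"
  defines "\<eta> \<equiv> \<lambda>x. flat_exp 0 (quad (4 * r\<^sup>2) 1 x0 x)"
  assumes r: "0 < r" "r \<le> R" and L: "L = 128 * R ^ 5 + 16 * R\<^sup>2 + 128 * R ^ 4 + 32 * CARD('n) * R ^ 4 + 64 * R ^ 8" and Q: "Q > 0"
  shows "\<bar>2 * (\<Sum>i\<in>UNIV. grad $ i * partial i \<eta> x) + a * laplacian \<eta> x\<bar> \<le> \<eta> x * (L / Q ^ 4 * (\<bar>a\<bar> + norm grad))"
    and "1 \<le> 4 * L / Q ^ 4"
proof -
  have R: "R > 0" using r by simp
  define n where "n = norm (x - x0)"
  have n: "0 \<le> n" by (simp add: n_def)
  have Qn: "Q = 4 * r\<^sup>2 - n\<^sup>2" by (simp add: Q_def quad_def n_def)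
  have rR: "r\<^sup>2 \<le> R\<^sup>2" using r by (intro power_mono) auto
  have QR: "Q \<le> 4 * R\<^sup>2" using Qn rR zero_le_power2[of n] by linarith
  have n2: "n\<^sup>2 \<le> 4 * R\<^sup>2" using Qn rR Q by linarith
  then have "n\<^sup>2 \<le> (2 * R)\<^sup>2" by (simp add: power_mult_distrib)
  then have nR: "n \<le> 2 * R" using R by (meson less_eq_real_def mult_pos_pos power2_le_imp_le zero_less_numeral)
  \<comment> \<open>Indices 2 and 3, which occur in the first and second derivatives, are powers of
    Q times index 4, and \<eta> is Q^4 times it. This is the origin of the factor 1 / Q^4.\<close>
  define e4 where "e4 = flat_exp 4 Q"
  have e4: "0 \<le> e4" by (simp add: e4_def flat_exp_nonneg)
  have E3: "flat_exp 3 Q = e4 * Q" using flat_exp_shift[of 3 Q 1] by (simp add: e4_def)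
  have E2: "flat_exp 2 Q = e4 * Q\<^sup>2" using flat_exp_shift[of 2 Q 2] by (simp add: e4_def)
  have E0: "\<eta> x = e4 * Q ^ 4" using flat_exp_shift[of 0 Q 4] by (simp add: e4_def \<eta>_def Q_def)
  have Q2: "Q\<^sup>2 \<le> 16 * R ^ 4"
    using power_mono[OF QR, of 2] Q by (simp add: power_mult_distrib power_mult[symmetric])
  have Q4: "Q ^ 4 \<le> 256 * R ^ 8"
    using power_mono[OF QR, of 4] Q by (simp add: power_mult_distrib power_mult[symmetric])
  \<comment> \<open>In L, 128 R^5 covers the gradient term, and 16 R^2 + 128 R^4 + 32 n R^4, n the
    dimension, covers the Laplacian, using |x - x0| \<le> 2 R and Q \<le> 4 R^2. The summand 64 R^8
    makes 4 L at least Q^4, so that 4 L / Q^4 is an admissible dilation factor in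
    \<open>Phi_scale\<close>.\<close>
  have L64: "64 * R ^ 8 \<le> L" unfolding L using R by simp
  show "1 \<le> 4 * L / Q ^ 4" using Q4 L64 Q by (simp add: pos_le_divide_eq)
  have s: "(\<Sum>i\<in>UNIV. grad $ i * partial i \<eta> x) = - 2 * flat_exp 2 Q * (grad \<bullet> (x - x0))"
  proof -
    have "(\<Sum>i\<in>UNIV. grad $ i * partial i \<eta> x) = (\<Sum>i\<in>UNIV. - 2 * flat_exp 2 Q * (grad $ i * (x $ i - x0 $ i)))"
    proof (rule sum.cong[OF refl])
      fix i
      have "partial i \<eta> x = flat_exp 2 Q * (- 2 * (x $ i - x0 $ i))"
        unfolding \<eta>_def partial_flat_quad by (simp add: Q_def add_2_eq_Suc' numeral_2_eq_2)
      then show "grad $ i * partial i \<eta> x = - 2 * flat_exp 2 Q * (grad $ i * (x $ i - x0 $ i))"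
        by (simp only: mult_ac mult_minus_left mult_minus_right)
    qed
    also have "\<dots> = - 2 * flat_exp 2 Q * (grad \<bullet> (x - x0))" by (simp add: inner_vec_def sum_distrib_left)
    finally show ?thesis .
  qed
  have "\<bar>grad \<bullet> (x - x0)\<bar> \<le> norm grad * n" unfolding n_def by (rule Cauchy_Schwarz_ineq2)
  also have "\<dots> \<le> norm grad * (2 * R)" using nR by (intro mult_left_mono) auto
  finally have cs: "\<bar>grad \<bullet> (x - x0)\<bar> \<le> norm grad * (2 * R)" .
  have "\<bar>2 * (\<Sum>i\<in>UNIV. grad $ i * partial i \<eta> x)\<bar> = 4 * (e4 * Q\<^sup>2) * \<bar>grad \<bullet> (x - x0)\<bar>"
    unfolding s E2 using e4 by (simp add: abs_mult)
  also have "\<dots> \<le> 4 * (e4 * (16 * R ^ 4)) * (norm grad * (2 * R))"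
    using cs Q2 e4 R by (intro mult_mono mult_left_mono) auto
  also have "\<dots> = e4 * (128 * R ^ 5) * norm grad" by (simp add: numeral_eq_Suc)
  also have "\<dots> \<le> e4 * L * norm grad"
    unfolding L using R e4 by (intro mult_right_mono mult_left_mono) auto
  finally have t1: "\<bar>2 * (\<Sum>i\<in>UNIV. grad $ i * partial i \<eta> x)\<bar> \<le> e4 * L * norm grad" .
  have lap: "laplacian \<eta> x = 4 * n\<^sup>2 * (e4 - 2 * (e4 * Q)) - 2 * CARD('n) * (e4 * Q\<^sup>2)"
    unfolding \<eta>_def laplacian_flat_quad by (simp add: Q_def[symmetric] n_def e4_def E2[unfolded e4_def, symmetric] E3[unfolded e4_def, symmetric])
      (simp add: numeral_2_eq_2)?
  have "\<bar>laplacian \<eta> x\<bar> \<le> e4 * (4 * n\<^sup>2 + 8 * (n\<^sup>2 * Q) + 2 * CARD('n) * Q\<^sup>2)"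
  proof -
    have "0 \<le> e4 * n\<^sup>2" "0 \<le> e4 * (n\<^sup>2 * Q)" "0 \<le> e4 * (CARD('n) * Q\<^sup>2)" using e4 Q by auto
    moreover have "laplacian \<eta> x = 4 * (e4 * n\<^sup>2) - 8 * (e4 * (n\<^sup>2 * Q)) - 2 * (e4 * (CARD('n) * Q\<^sup>2))"
      unfolding lap by (simp add: algebra_simps)
    moreover have "e4 * (4 * n\<^sup>2 + 8 * (n\<^sup>2 * Q) + 2 * CARD('n) * Q\<^sup>2) = 4 * (e4 * n\<^sup>2) + 8 * (e4 * (n\<^sup>2 * Q)) + 2 * (e4 * (CARD('n) * Q\<^sup>2))"
      by (simp add: algebra_simps)
    ultimately show ?thesis by (simp only: abs_le_iff) linarith
  qed
  also have "\<dots> \<le> e4 * L"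
  proof (rule mult_left_mono[OF _ e4])
    have "n\<^sup>2 * Q \<le> (4 * R\<^sup>2) * (4 * R\<^sup>2)" using n2 QR Q by (intro mult_mono) auto
    also have "\<dots> = 16 * R ^ 4" by (simp add: numeral_eq_Suc)
    finally have "n\<^sup>2 * Q \<le> 16 * R ^ 4" .
    moreover have "2 * CARD('n) * Q\<^sup>2 \<le> 32 * CARD('n) * R ^ 4"
      using mult_left_mono[OF Q2, of "2 * real CARD('n)"] by simp
    moreover have "0 \<le> 128 * R ^ 5" "0 \<le> 64 * R ^ 8" using R by auto
    ultimately show "4 * n\<^sup>2 + 8 * (n\<^sup>2 * Q) + 2 * CARD('n) * Q\<^sup>2 \<le> L"
      using n2 unfolding L by linarith
  qed
  finally have "\<bar>a * laplacian \<eta> x\<bar> \<le> \<bar>a\<bar> * (e4 * L)" unfolding abs_mult by (intro mult_left_mono) auto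
  then have "\<bar>2 * (\<Sum>i\<in>UNIV. grad $ i * partial i \<eta> x) + a * laplacian \<eta> x\<bar> \<le> e4 * L * (\<bar>a\<bar> + norm grad)"
    using t1 abs_triangle_ineq[of "2 * (\<Sum>i\<in>UNIV. grad $ i * partial i \<eta> x)" "a * laplacian \<eta> x"]
    by (simp add: algebra_simps)
  also have "\<dots> = \<eta> x * (L / Q ^ 4 * (\<bar>a\<bar> + norm grad))" unfolding E0 using Q by simp
  finally show "\<bar>2 * (\<Sum>i\<in>UNIV. grad $ i * partial i \<eta> x) + a * laplacian \<eta> x\<bar> \<le> \<eta> x * (L / Q ^ 4 * (\<bar>a\<bar> + norm grad))" .
qed

context N_growth
begin

text \<open>With k = N + 2, doubling turns the factor 4 L / Q^4 into its k-th power, and the cut-off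
  absorbs the pole: \<open>flat_exp 0 Q\<close> divided by Q^(4k) is
  \<open>flat_exp (4 * k) Q\<close>, at most (4k)!.\<close>

lemma flat_exp_Phi:
  assumes "0 < Q" "1 \<le> 4 * L / Q ^ 4"
  shows "flat_exp 0 Q * Phi (4 * (L / Q ^ 4 * z)) \<le> (4 * L) ^ (N + 2) * fact (4 * (N + 2)) * Phi z"
proof -
  define k where "k = N + 2"
  have "Phi (4 * (L / Q ^ 4 * z)) \<le> (4 * L / Q ^ 4) ^ k * Phi z"
  proof -
    have "4 * (L / Q ^ 4 * z) = 4 * L / Q ^ 4 * z" by simp
    then show ?thesis using Phi_scale[OF assms(2), of z] by (simp only: k_def)
  qed
  then have "flat_exp 0 Q * Phi (4 * (L / Q ^ 4 * z)) \<le> flat_exp 0 Q * ((4 * L / Q ^ 4) ^ k * Phi z)"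
    by (intro mult_left_mono flat_exp_nonneg)
  also have "\<dots> = (4 * L) ^ k * flat_exp (4 * k) Q * Phi z"
    using flat_exp_shift[of 0 Q "4 * k"] assms(1) by (simp add: power_divide power_mult)
  also have "\<dots> \<le> (4 * L) ^ k * fact (4 * k) * Phi z"
  proof (intro mult_right_mono mult_left_mono flat_exp_le_fact Phi_nonneg)
    have "0 < 4 * L" using assms by (smt (verit) divide_nonpos_pos zero_less_power)
    then show "0 \<le> (4 * L) ^ k" by simp
  qed
  finally show ?thesis by (simp add: k_def)
qed

end

context weak_solution
begin

text \<open>The pointwise inequality is integrated over the ball of radius 2 r, where the term with
  W v drops out by \<open>weak_harmonic_identity\<close>. The kernel radius \<rho> / 2 fits because
  5/2 r + \<rho> / 2 \<le> 3 r, and the ball of radius 3 r is still compactly contained in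
  \<Omega>.\<close>

lemma caccioppoli:
  fixes \<rho> r R L :: real and x0 :: "real^'n"
  assumes r: "0 < \<rho>" "\<rho> \<le> r" "r \<le> R" and ball: "ball x0 (4 * r) \<subseteq> \<Omega>"
    and L: "L = 128 * R ^ 5 + 16 * R\<^sup>2 + 128 * R ^ 4 + 32 * CARD('n) * R ^ 4 + 64 * R ^ 8"
  shows "exp (- 4 / (7 * \<rho>\<^sup>2)) * (LINT x|lebesgue_on (ball x0 (3 / 2 * r)). Phi (d x)) \<le>
    (10 + 4 * ((4 * L) ^ (N + 2) * fact (4 * (N + 2)) * 2 ^ (N + 2))) *
     (LINT x|lebesgue_on (ball x0 (2 * r)). Psi x)"
proof -
  define B2 where "B2 = ball x0 (2 * r)"
  define B3 where "B3 = ball x0 (3 * r)"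
  define B1 where "B1 = ball x0 (3 / 2 * r)"
  define \<eta> where "\<eta> = (\<lambda>x. flat_exp 0 (quad (4 * r\<^sup>2) 1 x0 x))"
  define C1 where "C1 = (4 * L) ^ (N + 2) * fact (4 * (N + 2)) * 2 ^ (N + 2)"
  have r0: "r > 0" using r by simp
  have R0: "R > 0" using r by simp
  have L0: "L \<ge> 0" unfolding L using R0 by simp
  have cc2: "compactly_contained B2 \<Omega>" unfolding B2_def by (rule compactly_contained_ball[OF ball]) (use r0 in simp)
  have cc3: "compactly_contained B3 \<Omega>" unfolding B3_def by (rule compactly_contained_ball[OF ball]) (use r0 in simp)
  have B2s: "B2 \<in> sets lebesgue" "B1 \<in> sets lebesgue" by (auto simp: B2_def B1_def)
  have qpos: "0 < quad (4 * r\<^sup>2) 1 x0 x \<longleftrightarrow> x \<in> B2" for x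
  proof -
    have "0 < quad (4 * r\<^sup>2) 1 x0 x \<longleftrightarrow> (norm (x - x0))\<^sup>2 < (2 * r)\<^sup>2" by (simp add: quad_def power_mult_distrib)
    also have "\<dots> \<longleftrightarrow> norm (x - x0) < 2 * r"
      using power_mono_iff[of "2 * r" "norm (x - x0)" 2] r0 by (simp add: linorder_not_le[symmetric])
    finally show ?thesis by (simp add: B2_def dist_norm norm_minus_commute)
  qed
  have \<eta>e: "elementary \<eta>" unfolding \<eta>_def by (rule elementary_flat_quad)
  have \<eta>1: "0 \<le> \<eta> x" "\<eta> x \<le> 1" for x using flat_exp_nonneg[of 0] flat_exp_le_fact[of 0] by (auto simp: \<eta>_def)
  have \<eta>0: "\<eta> x = 0" if "x \<notin> B2" for x using qpos[of x] that by (simp add: \<eta>_def flat_exp_def)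
  define y where "y x = 2 * (\<Sum>i\<in>UNIV. weak_derivative \<Omega> [i] u x * partial i \<eta> x) + u x * laplacian \<eta> x" for x
  define v where "v x = \<eta> x * (\<Sum>i\<in>UNIV. weak_derivative \<Omega> [i, i] u x) + 2 * (\<Sum>i\<in>UNIV. weak_derivative \<Omega> [i] u x * partial i \<eta> x) + u x * laplacian \<eta> x" for x
  have vy: "v x = \<eta> x * d x + y x" for x by (simp add: v_def y_def weak_laplacian_def)
  define w where "w x = (if x \<in> B3 then W x else 0)" for x
  have D1: "has_weak_derivative \<Omega> [i] u (weak_derivative \<Omega> [i] u)" for i
    by (rule weak_derivative_W2G(1)[OF open_\<Omega> u_W2G]) simp
  have D2: "has_weak_derivative \<Omega> [i, i] u (weak_derivative \<Omega> [i, i] u)" for i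
    by (rule weak_derivative_W2G(1)[OF open_\<Omega> u_W2G]) simp
  have sub3: "cball x (\<rho> / 2) \<subseteq> B3" if "x \<in> ball x0 (5 / 2 * r)" for x
  proof
    fix z assume "z \<in> cball x (\<rho> / 2)"
    then show "z \<in> B3" using that r dist_triangle[of x0 z x] by (simp add: B3_def)
  qed
  have cb: "cball x0 (2 * r) \<subseteq> ball x0 (5 / 2 * r)" "cball x0 (2 * r) \<subseteq> \<Omega>"
    using r0 ball by (auto simp: subset_iff)
  have \<eta>S: "\<eta> x = 0" if "x \<notin> cball x0 (2 * r)" for x using \<eta>0[of x] that by (auto simp: B2_def)
  have w1: "integrable lebesgue w" unfolding w_def by (rule W_restrict(1)[OF cc3])
  have w2: "(LINT y|lebesgue. w y * laplacian \<phi> y) = 0" if "\<phi> \<in> test_functions B3" for \<phi>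
    unfolding w_def by (rule W_restrict(2)[OF cc3 that])
  have rho2: "0 < \<rho> / 2" using r by simp
  note id = weak_harmonic_identity[OF open_\<Omega> D1 D2 w1 w2 open_ball rho2 sub3 \<eta>e compact_cball cb \<eta>S]
  have wv: "integrable lebesgue (\<lambda>x. w x * v x)" "(LINT x|lebesgue. w x * v x) = 0"
    unfolding v_def by (rule id; assumption)+
  have AC: "(\<Sum>i\<in>UNIV. weak_derivative \<Omega> [i] u x * partial i \<eta> x) = (\<Sum>i\<in>UNIV. weak_gradient \<Omega> u x $ i * partial i \<eta> x)" for x
    by (simp add: weak_gradient_def)
  have pt: "\<eta> x * Phi (d x) / 2 \<le> W x * v x + (5 + 2 * C1) * Psi x" if x: "x \<in> B2" for x
  proof -
    define Q where "Q = quad (4 * r\<^sup>2) 1 x0 x"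
    have Q: "Q > 0" using x qpos by (simp add: Q_def)
    have cb: "\<bar>2 * (\<Sum>i\<in>UNIV. weak_gradient \<Omega> u x $ i * partial i \<eta> x) + u x * laplacian \<eta> x\<bar> \<le> \<eta> x * (L / Q ^ 4 * (\<bar>u x\<bar> + gr x))"
        "1 \<le> 4 * L / Q ^ 4"
      unfolding \<eta>_def Q_def by (rule cutoff_bound[OF r0 r(3) L Q[unfolded Q_def]])+
    define Z where "Z = L / Q ^ 4 * (\<bar>u x\<bar> + gr x)"
    have yb: "\<bar>y x\<bar> \<le> \<eta> x * Z"
      unfolding y_def AC Z_def by (rule cb(1))
    have "\<eta> x * Phi (d x) / 2 - 5 * (\<eta> x * Phi (f x)) - 2 * (\<eta> x * Phi (4 * Z)) \<le> W x * v x"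
      unfolding vy W_def by (rule caccioppoli_pointwise[OF \<eta>1(1) yb])
    moreover have "\<eta> x * Phi (4 * Z) \<le> C1 * (Phi (u x) + Phi (gr x))"
    proof -
      have "\<eta> x * Phi (4 * Z) \<le> (4 * L) ^ (N + 2) * fact (4 * (N + 2)) * Phi (\<bar>u x\<bar> + gr x)"
        unfolding Z_def \<eta>_def Q_def[symmetric] by (rule flat_exp_Phi[OF Q cb(2)])
      also have "\<dots> \<le> (4 * L) ^ (N + 2) * fact (4 * (N + 2)) * (2 ^ (N + 2) * (Phi \<bar>u x\<bar> + Phi (gr x)))"
        using L0 by (intro mult_left_mono Phi_add) auto
      finally show ?thesis by (simp add: C1_def Phi_abs mult.assoc)
    qed
    moreover have "\<eta> x * Phi (f x) \<le> Phi (f x)" using \<eta>1 Phi_nonneg by (simp add: mult_left_le_one_le)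
    moreover have C10: "0 \<le> C1" using L0 by (simp add: C1_def)
    moreover have "0 \<le> C1 * Phi (f x)" using C10 Phi_nonneg by simp
    ultimately show ?thesis using Phi_nonneg[of "u x"] Phi_nonneg[of "gr x"]
      by (simp add: algebra_simps)
  qed
  have C10: "0 \<le> C1" using L0 by (simp add: C1_def)
  have dL: "d \<in> borel_measurable (lebesgue_on B2)" "integrable (lebesgue_on B2) (\<lambda>x. Phi (d x))"
    using d_LG[OF cc2] by (auto simp: LG_iff)
  have fi: "integrable (lebesgue_on B2) (\<lambda>x. Psi x)"
    using f_LG[OF cc2] u_LG[OF cc2] gr_LG[OF cc2] by (auto simp: LG_iff)
  have \<eta>d: "integrable (lebesgue_on B2) (\<lambda>x. \<eta> x * Phi (d x))"
  proof (rule Bochner_Integration.integrable_bound[OF dL(2)])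
    show "(\<lambda>x. \<eta> x * Phi (d x)) \<in> borel_measurable (lebesgue_on B2)"
    proof (rule borel_measurable_times)
      show "\<eta> \<in> borel_measurable (lebesgue_on B2)"
        using elementary_continuous[OF \<eta>e] B2s(1) by (rule continuous_imp_measurable_on_sets_lebesgue)
    qed (use dL(2) in auto)
    show "AE x in lebesgue_on B2. norm (\<eta> x * Phi (d x)) \<le> norm (Phi (d x))"
      using \<eta>1 Phi_nonneg by (intro AE_I2) (auto simp: abs_mult intro!: mult_left_le_one_le)
  qed
  have wvB: "integrable (lebesgue_on B2) (\<lambda>x. W x * v x)" "(LINT x|lebesgue_on B2. W x * v x) = 0"
  proof -
    have v0: "v x = 0" if "x \<notin> cball x0 (2 * r)" for x
    proof -
      have "partials \<alpha> \<eta> x = 0" for \<alpha> by (rule elementary_support[OF closed_cball \<eta>S that])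
      from this[of "[_]"] this[of "[_, _]"] show ?thesis
        using \<eta>S[OF that] by (simp add: v_def laplacian_def) (simp add: partials_def)
    qed
    \<comment> \<open>The support argument covers only the exterior of the closed ball. On the
      bounding sphere the argument of the flat exponential is 0, and the explicit derivative
      formulas give 0.\<close>
    have vB: "v x = 0" if "x \<notin> B2" for x
    proof (cases "x \<in> cball x0 (2 * r)")
      case True
      with that have q0: "quad (4 * r\<^sup>2) 1 x0 x = 0"
        by (simp add: B2_def quad_def dist_norm norm_minus_commute power_mult_distrib)
      have "partial i \<eta> x = 0" for i unfolding \<eta>_def partial_flat_quad q0 by (simp add: flat_exp_def)
      moreover have "laplacian \<eta> x = 0" unfolding \<eta>_def laplacian_flat_quad q0 by (simp add: flat_exp_def)
      ultimately show ?thesis using \<eta>0[OF that] by (simp add: v_def)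
    qed (rule v0)
    have eq: "w x * v x = (if x \<in> B2 then W x * v x else 0)" for x
      using vB[of x] r0 by (auto simp: w_def B2_def B3_def)
    show "integrable (lebesgue_on B2) (\<lambda>x. W x * v x)"
      using wv(1) B2s(1) unfolding eq by (simp add: Lebesgue_Measure.integrable_restrict_UNIV)
    show "(LINT x|lebesgue_on B2. W x * v x) = 0"
      using wv(2) B2s(1) unfolding eq by (simp add: Lebesgue_Measure.integral_restrict_UNIV)
  qed
  have "(LINT x|lebesgue_on B2. \<eta> x * Phi (d x) / 2) \<le> (LINT x|lebesgue_on B2. W x * v x + (5 + 2 * C1) * Psi x)"
    using wvB fi \<eta>d pt by (intro integral_mono) auto
  also have "\<dots> = (5 + 2 * C1) * (LINT x|lebesgue_on B2. Psi x)"
    using wvB(2) by (simp only: Bochner_Integration.integral_add[OF wvB(1) integrable_mult_right[OF fi]] integral_mult_right_zero add_0)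
  finally have main: "(LINT x|lebesgue_on B2. \<eta> x * Phi (d x)) \<le> (10 + 4 * C1) * (LINT x|lebesgue_on B2. Psi x)"
    by (simp add: algebra_simps)
  \<comment> \<open>Lower bound of the cut-off on the inner ball: its argument is at least 4 r^2 -
    9/4 r^2 = 7/4 r^2 \<ge> 7/4 \<rho>^2, and exp (-1 / Q) increases with Q.\<close>
  define c where "c = exp (- 4 / (7 * \<rho>\<^sup>2))"
  have c0: "c > 0" by (simp add: c_def)
  have \<eta>c: "c \<le> \<eta> x" if "x \<in> B1" for x
  proof -
    have n: "norm (x - x0) \<le> 3 / 2 * r" using that by (simp add: B1_def dist_norm norm_minus_commute)
    have "(norm (x - x0))\<^sup>2 \<le> (3 / 2 * r)\<^sup>2" using n by (intro power_mono) auto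
    then have q: "7 / 4 * r\<^sup>2 \<le> quad (4 * r\<^sup>2) 1 x0 x" by (simp add: quad_def power_mult_distrib power2_eq_square)
    have "\<rho>\<^sup>2 \<le> r\<^sup>2" using r by (intro power_mono) auto
    with q have q': "7 / 4 * \<rho>\<^sup>2 \<le> quad (4 * r\<^sup>2) 1 x0 x" by linarith
    have p: "0 < 7 / 4 * \<rho>\<^sup>2" using r by simp
    have "1 / quad (4 * r\<^sup>2) 1 x0 x \<le> 1 / (7 / 4 * \<rho>\<^sup>2)" using q' p by (intro frac_le) auto
    moreover have "0 < quad (4 * r\<^sup>2) 1 x0 x" using q' p by linarith
    ultimately show ?thesis by (simp add: c_def \<eta>_def flat_exp_def)
  qed
  have B12: "B1 \<subseteq> B2" using r0 by (auto simp: B1_def B2_def)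
  have d1: "integrable (lebesgue_on B1) (\<lambda>x. Phi (d x))" by (rule integrable_lebesgue_on_subset[OF dL(2) B12 B2s(2,1)])
  have "c * (LINT x|lebesgue_on B1. Phi (d x)) = (LINT x|lebesgue_on B1. c * Phi (d x))" by simp
  also have "\<dots> \<le> (LINT x|lebesgue_on B1. \<eta> x * Phi (d x))"
    using \<eta>c Phi_nonneg d1 integrable_lebesgue_on_subset[OF \<eta>d B12 B2s(2,1)]
    by (intro integral_mono) (auto intro!: mult_right_mono)
  also have "\<dots> \<le> (LINT x|lebesgue_on B2. \<eta> x * Phi (d x))"
    using \<eta>1 Phi_nonneg by (intro integral_lebesgue_on_mono_set[OF \<eta>d B12 B2s(2,1)]) simp
  finally show ?thesis using main by (simp add: c_def C1_def B1_def B2_def)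
qed

end

section \<open>The estimate\<close>

text \<open>Jensen's inequality up to a constant. Where a > h, one has a \<le> h^(1-q) a^q; with h =
  F / (2 b) the constant part integrates to at most F / 2 and is absorbed, which leaves the factor
  2^q b^(q-1).\<close>

lemma powr_integral_le:
  fixes a :: "'a \<Rightarrow> real"
  assumes fin: "finite_measure M" and b: "measure M (space M) \<le> b" "0 < b"
    and a: "\<And>x. 0 \<le> a x" "integrable M a" "integrable M (\<lambda>x. a x powr q)" and q: "1 \<le> q"
  shows "(LINT x|M. a x) powr q \<le> 2 powr q * b powr (q - 1) * (LINT x|M. a x powr q)"
proof -
  interpret finite_measure M by fact
  define F where "F = (LINT x|M. a x)"
  have F0: "0 \<le> F" using a(1) by (simp add: F_def)
  have H0: "0 \<le> (LINT x|M. a x powr q)" by (simp add: integral_nonneg_AE)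
  show ?thesis
  proof (cases "F = 0")
    case True
    then show ?thesis using H0 by (simp add: F_def)
  next
    case False
    then have F: "F > 0" using F0 by simp
    define h where "h = F / (2 * b)"
    have h: "h > 0" using F b by (simp add: h_def)
    have pt: "a x \<le> h + h powr (1 - q) * a x powr q" for x
    proof (cases "a x \<le> h")
      case True
      then show ?thesis by (simp add: add_increasing2)
    next
      case False
      then have "a x powr (1 - q) \<le> h powr (1 - q)" using h q by (intro powr_mono2') auto
      then have "a x powr (1 - q) * a x powr q \<le> h powr (1 - q) * a x powr q" by (intro mult_right_mono) auto
      moreover have "a x powr (1 - q) * a x powr q = a x" using False h by (simp add: powr_add[symmetric])
      ultimately show ?thesis using h by linarith
    qed
    have "F \<le> (LINT x|M. h + h powr (1 - q) * a x powr q)"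
      unfolding F_def using a pt by (intro integral_mono) auto
    also have "\<dots> = measure M (space M) * h + h powr (1 - q) * (LINT x|M. a x powr q)" using a by simp
    also have "\<dots> \<le> b * h + h powr (1 - q) * (LINT x|M. a x powr q)" using b h by (intro add_mono mult_right_mono) auto
    also have "b * h = F / 2" using b by (simp add: h_def)
    finally have "F / 2 \<le> h powr (1 - q) * (LINT x|M. a x powr q)" by simp
    then have "F / 2 * h powr (q - 1) \<le> h powr (1 - q) * (LINT x|M. a x powr q) * h powr (q - 1)" by (intro mult_right_mono) auto
    also have "\<dots> = (LINT x|M. a x powr q) * (h powr (1 - q) * h powr (q - 1))" by (simp add: mult_ac)
    also have "\<dots> = (LINT x|M. a x powr q)" using h by (simp add: powr_add[symmetric])
    finally have I: "F / 2 * h powr (q - 1) \<le> (LINT x|M. a x powr q)" .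
    have "F powr q = 2 powr q * b powr (q - 1) * (F / 2 * h powr (q - 1))"
    proof -
      have "h powr (q - 1) = F powr (q - 1) / (2 powr (q - 1) * b powr (q - 1))"
        using F b by (simp add: h_def powr_divide powr_mult)
      moreover have "2 powr q = 2 * (2::real) powr (q - 1)" "F powr q = F * F powr (q - 1)"
        using powr_add[of 2 1 "q - 1"] powr_add[of F 1 "q - 1"] F by auto
      ultimately show ?thesis using b by simp
    qed
    also have "\<dots> \<le> 2 powr q * b powr (q - 1) * (LINT x|M. a x powr q)" using I by (intro mult_left_mono) auto
    finally show ?thesis by (simp add: F_def)
  qed
qed

lemma powr_sum3_le:
  fixes a b c :: real
  assumes "0 \<le> a" "0 \<le> b" "0 \<le> c" "0 \<le> C" "1 \<le> q"
  shows "(C * (a + b + c)) powr q \<le> (3 * C) powr q * (a powr q + b powr q + c powr q)"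
proof -
  define m where "m = max a (max b c)"
  have m: "m powr q \<le> a powr q + b powr q + c powr q"
  proof -
    have "m = a \<or> m = b \<or> m = c" by (auto simp: m_def max_def)
    then show ?thesis using powr_ge_zero[of a q] powr_ge_zero[of b q] powr_ge_zero[of c q] by auto
  qed
  have m0: "0 \<le> m" using assms(1) by (simp add: m_def)
  have "C * (a + b + c) \<le> C * (3 * m)" using assms(4) by (intro mult_left_mono) (auto simp: m_def)
  then have "(C * (a + b + c)) powr q \<le> (3 * C * m) powr q" using assms by (intro powr_mono2) (auto simp: mult_ac)
  also have "\<dots> = (3 * C) powr q * m powr q" using assms m0 by (simp add: powr_mult)
  also have "\<dots> \<le> (3 * C) powr q * (a powr q + b powr q + c powr q)" using m by (intro mult_left_mono) auto
  finally show ?thesis .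
qed

context weak_solution
begin

text \<open>Where f does not control d, the flux of d is bounded by W and thus by a mean of fluxes
  over the ball of radius 3/2 r; \<open>Phi_le_modular_mean\<close> turns this into a mean of
  modulars. The intermediate radius leaves r / 2 \<ge> \<rho> / 2 for the kernel. The Caccioppoli
  inequality enters as the hypothesis \<open>kc\<close>, so its constant stays opaque.\<close>

lemma Phi_laplacian_bound:
  fixes \<rho> r R L b :: real and x0 :: "real^'n"
  assumes r: "0 < \<rho>" "\<rho> \<le> r" "r \<le> R" and ball: "ball x0 (4 * r) \<subseteq> \<Omega>"
    and b: "\<Omega> \<in> lmeasurable" "measure lebesgue \<Omega> \<le> b"
    and m: "m = 2 / (\<rho> / 2) ^ CARD('n) / moll_mass TYPE('n)"
    and kc: "\<And>x0 r. \<rho> \<le> r \<Longrightarrow> r \<le> R \<Longrightarrow> ball x0 (4 * r) \<subseteq> \<Omega> \<Longrightarrow>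
       (LINT x|lebesgue_on (ball x0 (3 / 2 * r)). Phi (d x)) \<le> kc * (LINT x|lebesgue_on (ball x0 (2 * r)). Psi x)"
  shows "AE x in lebesgue. x \<in> ball x0 r \<longrightarrow> Phi (d x) \<le> 2 ^ (N + 2) * Phi (f x) +
     4 * m * (1 + 8 * m * b) * ((kc + 1) * (LINT x|lebesgue_on (ball x0 (2 * r)). Psi x))"
proof -
  define B1 where "B1 = ball x0 (3 / 2 * r)"
  define B2 where "B2 = ball x0 (2 * r)"
  have r0: "r > 0" using r by simp
  have cc1: "compactly_contained B1 \<Omega>" unfolding B1_def by (rule compactly_contained_ball[OF ball]) (use r0 in simp)
  have cc2: "compactly_contained B2 \<Omega>" unfolding B2_def by (rule compactly_contained_ball[OF ball]) (use r0 in simp)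
  have B12: "B1 \<subseteq> B2" using r0 by (auto simp: B1_def B2_def)
  have Bs: "B1 \<in> sets lebesgue" "B2 \<in> sets lebesgue" by (auto simp: B1_def B2_def)
  have m0: "m > 0" unfolding m using r moll_mass_pos[where 'n='n] by simp
  have b0: "b \<ge> 0" using b(2) measure_nonneg[of lebesgue \<Omega>] by linarith
  have sub: "cball x (\<rho> / 2) \<subseteq> B1" if "x \<in> ball x0 r" for x
  proof
    fix z assume "z \<in> cball x (\<rho> / 2)"
    then show "z \<in> B1" using that r dist_triangle[of x0 z x] by (simp add: B1_def)
  qed
  define Y where "Y = (LINT x|lebesgue_on B2. Psi x)"
  define J where "J = (LINT y|lebesgue_on B1. Phi (d y) + Phi (f y))"
  have d1: "integrable (lebesgue_on B1) (\<lambda>y. Phi (d y))" "d \<in> borel_measurable (lebesgue_on B1)"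
    using d_LG[OF cc1] by (auto simp: LG_iff)
  have f1: "integrable (lebesgue_on B1) (\<lambda>y. Phi (f y))" "f \<in> borel_measurable (lebesgue_on B1)"
    using f_LG[OF cc1] by (auto simp: LG_iff)
  have J: "J \<le> (kc + 1) * Y"
  proof -
    have Yi: "integrable (lebesgue_on B2) (\<lambda>x. Psi x)"
      using f_LG[OF cc2] u_LG[OF cc2] gr_LG[OF cc2] by (auto simp: LG_iff)
    have "(LINT y|lebesgue_on B1. Phi (f y)) \<le> (LINT x|lebesgue_on B1. Psi x)"
      using f1 integrable_lebesgue_on_subset[OF Yi B12 Bs] Phi_nonneg by (intro integral_mono) auto
    also have "\<dots> \<le> Y"
      unfolding Y_def using Phi_nonneg by (intro integral_lebesgue_on_mono_set[OF Yi B12 Bs]) auto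
    finally have "(LINT y|lebesgue_on B1. Phi (f y)) \<le> Y" .
    moreover have "(LINT x|lebesgue_on B1. Phi (d x)) \<le> kc * Y"
      unfolding B1_def B2_def Y_def by (rule kc[OF r(2,3) ball])
    moreover have "J = (LINT y|lebesgue_on B1. Phi (d y)) + (LINT y|lebesgue_on B1. Phi (f y))"
      unfolding J_def using d1(1) f1(1) by simp
    ultimately show ?thesis by (simp add: algebra_simps)
  qed
  have fm: "finite_measure (lebesgue_on B1)"
    by (rule finite_measure_lebesgue_on[OF compactly_contained_lmeasurable[OF cc1]])
  have mb: "measure (lebesgue_on B1) (space (lebesgue_on B1)) \<le> b"
    using measure_lebesgue_on_compactly_contained[OF cc1 b(1)] b(2) by linarith
  define X where "X = (LINT y|lebesgue_on B1. \<bar>g (d y) * d y\<bar> + \<bar>g (f y) * f y\<bar>)"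
  have "0 < \<rho> / 2" using r by simp
  from W_sup_bound[OF cc1 open_ball this sub, folded m X_def]
  have "AE x in lebesgue. x \<in> ball x0 r \<longrightarrow> \<bar>W x\<bar> \<le> m * X" by blast
  then show ?thesis
  proof eventually_elim
    case (elim x)
    show ?case
    proof
      assume x: "x \<in> ball x0 r"
      have cn: "0 \<le> 4 * m * (1 + 8 * m * b)" using m0 b0 by simp
      have J0: "0 \<le> J" unfolding J_def using Phi_nonneg by (intro integral_nonneg_AE AE_I2) auto
      have "Phi (d x) \<le> 2 ^ (N + 2) * Phi (f x) + 4 * m * (1 + 8 * m * b) * J"
      proof (cases "\<bar>g (d x) * d x\<bar> \<le> 2 * \<bar>g (f x) * f x\<bar>")
        case True
        then show ?thesis using Phi_le_of_A_le[OF True] mult_nonneg_nonneg[OF cn J0] by linarith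
      next
        case False
        then have "\<bar>g (d x) * d x\<bar> \<le> 2 * \<bar>W x\<bar>" using flux_dichotomy[of x] by blast
        then have "\<bar>g (d x) * d x\<bar> \<le> 2 * m * X" using elim x by linarith
        then have "Phi (d x) \<le> 4 * m * (1 + 8 * m * b) * J"
          unfolding X_def J_def by (intro Phi_le_modular_mean[OF fm mb _ d1 f1]) (use m0 in auto)
        moreover have "0 \<le> 2 ^ (N + 2) * Phi (f x)" using Phi_nonneg by simp
        ultimately show ?thesis by linarith
      qed
      also have "4 * m * (1 + 8 * m * b) * J \<le> 4 * m * (1 + 8 * m * b) * ((kc + 1) * Y)"
        using J cn by (rule mult_left_mono)
      finally show "Phi (d x) \<le> 2 ^ (N + 2) * Phi (f x) +
         4 * m * (1 + 8 * m * b) * ((kc + 1) * (LINT x|lebesgue_on (ball x0 (2 * r)). Psi x))"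
        by (simp add: Y_def B2_def)
    qed
  qed
qed

text \<open>Passing to the scaled arguments is a dilation by r^2 for u and by r for the gradient;
  both factors are at most R^2, the second one because R \<ge> 1.\<close>

lemma modular_le:
  fixes r R :: real and x0 :: "real^'n"
  assumes r: "0 < r" "r \<le> R" "1 \<le> R" and ball: "ball x0 (4 * r) \<subseteq> \<Omega>"
  shows "(LINT x|lebesgue_on (ball x0 (2 * r)). Psi x) \<le>
     2 ^ (N + 2) * (R\<^sup>2) ^ (N + 2) * ((LINT x|lebesgue_on (ball x0 (2 * r)). N_function g (f x)) +
       ((LINT x|lebesgue_on (ball x0 (2 * r)). N_function g (1 / r\<^sup>2 * u x)) +
        (LINT x|lebesgue_on (ball x0 (2 * r)). N_function g (1 / r * gr x))))"
proof -
  let ?M = "lebesgue_on (ball x0 (2 * r))"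
  have cc: "compactly_contained (ball x0 (2 * r)) \<Omega>" by (rule compactly_contained_ball[OF ball]) (use r in simp)
  have R2: "1 \<le> R\<^sup>2" using r(3) by simp
  have scale: "Phi t \<le> 2 ^ (N + 2) * (R\<^sup>2) ^ (N + 2) * N_function g (c * t)" if c: "0 < c" "1 / c \<le> R\<^sup>2" for c t
  proof -
    have "Phi t \<le> Phi (R\<^sup>2 * (c * t))"
    proof (rule Phi_mono)
      have "1 \<le> R\<^sup>2 * c" using c by (simp add: pos_divide_le_eq)
      then show "\<bar>t\<bar> \<le> \<bar>R\<^sup>2 * (c * t)\<bar>"
        using mult_right_mono[of 1 "R\<^sup>2 * c" "\<bar>t\<bar>"] c(1) by (simp add: abs_mult mult.assoc)
    qed
    also have "\<dots> \<le> (R\<^sup>2) ^ (N + 2) * Phi (c * t)" by (rule Phi_scale[OF R2])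
    also have "\<dots> \<le> (R\<^sup>2) ^ (N + 2) * (2 ^ (N + 2) * N_function g (c * t))" by (intro mult_left_mono Phi_le_G) auto
    finally show ?thesis by (simp only: mult_ac)
  qed
  have rR: "1 / (1 / r\<^sup>2) \<le> R\<^sup>2" using r by (simp add: power_mono)
  have "r \<le> R * R" using r mult_right_mono[of 1 R R] by linarith
  then have rR': "1 / (1 / r) \<le> R\<^sup>2" by (simp add: power2_eq_square)
  have G: "integrable ?M (\<lambda>x. N_function g (c * h x))" if h: "h \<in> LG g (ball x0 (2 * r))" for h c
  proof -
    have hm: "h \<in> borel_measurable ?M" and hi: "integrable ?M (\<lambda>x. Phi (h x))" using h by (auto simp: LG_iff)
    have cm: "(\<lambda>x. c * h x) \<in> borel_measurable ?M" using hm by simp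
    have "integrable ?M (\<lambda>x. Phi (c * h x))"
      by (rule integrable_Phi_bound[OF hi cm, of "max 1 \<bar>c\<bar>"]) (auto simp: abs_mult intro!: mult_right_mono)
    then show ?thesis using integrable_G_iff[OF cm] by blast
  qed
  have Gi: "integrable ?M (\<lambda>x. N_function g (f x))" "integrable ?M (\<lambda>x. N_function g (1 / r\<^sup>2 * u x))" "integrable ?M (\<lambda>x. N_function g (1 / r * gr x))"
    using G[OF f_LG[OF cc], of 1] G[OF u_LG[OF cc]] G[OF gr_LG[OF cc]] by (simp_all only: mult_1)
  have Pi: "integrable ?M (\<lambda>x. Psi x)"
    using f_LG[OF cc] u_LG[OF cc] gr_LG[OF cc] by (auto simp: LG_iff)
  have "(LINT x|?M. Psi x) \<le>
     (LINT x|?M. 2 ^ (N + 2) * (R\<^sup>2) ^ (N + 2) * (N_function g (f x) + (N_function g (1 / r\<^sup>2 * u x) + N_function g (1 / r * gr x))))"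
  proof (rule integral_mono[OF Pi])
    show "integrable ?M (\<lambda>x. 2 ^ (N + 2) * (R\<^sup>2) ^ (N + 2) * (N_function g (f x) + (N_function g (1 / r\<^sup>2 * u x) + N_function g (1 / r * gr x))))"
      by (intro integrable_mult_right Bochner_Integration.integrable_add Gi)
    fix x
    have "Phi (f x) \<le> 2 ^ (N + 2) * (R\<^sup>2) ^ (N + 2) * N_function g (f x)" using scale[of 1 "f x"] R2 by simp
    moreover have "Phi (u x) \<le> 2 ^ (N + 2) * (R\<^sup>2) ^ (N + 2) * N_function g (1 / r\<^sup>2 * u x)"
      by (rule scale[OF _ rR]) (use r in simp)
    moreover have "Phi (gr x) \<le> 2 ^ (N + 2) * (R\<^sup>2) ^ (N + 2) * N_function g (1 / r * gr x)"
      by (rule scale[OF _ rR']) (use r in simp)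
    ultimately show "Psi x \<le> 2 ^ (N + 2) * (R\<^sup>2) ^ (N + 2) * (N_function g (f x) + (N_function g (1 / r\<^sup>2 * u x) + N_function g (1 / r * gr x)))"
      unfolding distrib_left by linarith
  qed
  then show ?thesis
    by (simp only: integral_mult_right_zero Bochner_Integration.integral_add[OF Gi(1) Bochner_Integration.integrable_add[OF Gi(2,3)]] Bochner_Integration.integral_add[OF Gi(2,3)])
qed

text \<open>In the pointwise bound raised to the power q, the integrals over the larger ball are
  constants, integrated against a measure of at most b. The one of G(f) is merged into the integral
  of G(f)^q by \<open>powr_integral_le\<close>.\<close>

lemma Lq_estimate:
  fixes \<rho> r R b q D :: real and x0 :: "real^'n"
  assumes r: "0 < \<rho>" "\<rho> \<le> r" "r \<le> R" "1 \<le> R" and ball: "ball x0 (4 * r) \<subseteq> \<Omega>"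
    and b: "\<Omega> \<in> lmeasurable" "measure lebesgue \<Omega> \<le> b" "0 < b"
    and q: "1 \<le> q" and f: "(\<lambda>x. N_function g (f x)) \<in> Lq_loc q \<Omega>"
    and D: "0 \<le> D" "AE x in lebesgue. x \<in> ball x0 r \<longrightarrow> Phi (d x) \<le> 2 ^ (N + 2) * Phi (f x) +
        D * (LINT x|lebesgue_on (ball x0 (2 * r)). Psi x)"
    and C: "C = 2 ^ (N + 2) * 2 ^ (N + 2) + D * (2 ^ (N + 2) * (R\<^sup>2) ^ (N + 2))"
  shows "(LINT x|lebesgue_on (ball x0 r). N_function g (d x) powr q) \<le>
     (3 * C) powr q * (1 + b + b * (2 powr q * b powr (q - 1))) *
      (((LINT x|lebesgue_on (ball x0 (2 * r)). N_function g (1 / r\<^sup>2 * u x)) +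
        (LINT x|lebesgue_on (ball x0 (2 * r)). N_function g (1 / r * gr x))) powr q
       + (LINT x|lebesgue_on (ball x0 (2 * r)). N_function g (f x) powr q))"
proof -
  define B where "B = ball x0 r"
  define B2 where "B2 = ball x0 (2 * r)"
  have r0: "r > 0" using r by simp
  have cc: "compactly_contained B \<Omega>" unfolding B_def by (rule compactly_contained_ball[OF ball]) (use r0 in simp)
  have cc2: "compactly_contained B2 \<Omega>" unfolding B2_def by (rule compactly_contained_ball[OF ball]) (use r0 in simp)
  have BB: "B \<subseteq> B2" using r0 by (auto simp: B_def B2_def)
  have Bs: "B \<in> sets lebesgue" "B2 \<in> sets lebesgue" by (auto simp: B_def B2_def)
  define F where "F = (LINT x|lebesgue_on B2. N_function g (f x))"
  define S where "S = (LINT x|lebesgue_on B2. N_function g (1 / r\<^sup>2 * u x)) + (LINT x|lebesgue_on B2. N_function g (1 / r * gr x))"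
  define H where "H = (LINT x|lebesgue_on B2. N_function g (f x) powr q)"
  have F0: "0 \<le> F" unfolding F_def using G_nonneg by (simp add: integral_nonneg_AE)
  have S0: "0 \<le> S" unfolding S_def using G_nonneg by (simp add: integral_nonneg_AE)
  have H0: "0 \<le> H" unfolding H_def by (simp add: integral_nonneg_AE)
  have C0: "0 \<le> C" unfolding C using D by simp
  have Y: "(LINT x|lebesgue_on B2. Psi x) \<le> 2 ^ (N + 2) * (R\<^sup>2) ^ (N + 2) * (F + S)"
    unfolding B2_def F_def S_def by (rule modular_le[OF r0 r(3,4) ball])
  have pt: "AE x in lebesgue. x \<in> B \<longrightarrow> N_function g (d x) powr q \<le> (3 * C) powr q * (N_function g (f x) powr q + F powr q + S powr q)"
    using D(2)
  proof eventually_elim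
    case (elim x)
    show ?case
    proof
      assume "x \<in> B"
      then have "Phi (d x) \<le> 2 ^ (N + 2) * Phi (f x) + D * (LINT x|lebesgue_on B2. Psi x)"
        using elim by (simp add: B_def B2_def)
      also have "\<dots> \<le> 2 ^ (N + 2) * (2 ^ (N + 2) * N_function g (f x)) + D * (2 ^ (N + 2) * (R\<^sup>2) ^ (N + 2) * (F + S))"
        using Y D(1) by (intro add_mono mult_left_mono Phi_le_G) auto
      also have "\<dots> \<le> C * (N_function g (f x) + F + S)"
      proof -
        define P where "P = (2::real) ^ (N + 2) * 2 ^ (N + 2)"
        define E where "E = D * (2 ^ (N + 2) * (R\<^sup>2) ^ (N + 2))"
        have "0 \<le> P * (F + S)" "0 \<le> E * N_function g (f x)" using F0 S0 G_nonneg D by (auto simp: P_def E_def)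
        then have "P * N_function g (f x) + E * (F + S) \<le> (P + E) * (N_function g (f x) + F + S)"
          by (simp add: algebra_simps)
        then show ?thesis unfolding C P_def E_def by (simp only: mult.assoc)
      qed
      finally have "N_function g (d x) \<le> C * (N_function g (f x) + F + S)" using G_le_Phi[of "d x"] by linarith
      then have "N_function g (d x) powr q \<le> (C * (N_function g (f x) + F + S)) powr q"
        using q G_nonneg by (intro powr_mono2) auto
      also have "\<dots> \<le> (3 * C) powr q * (N_function g (f x) powr q + F powr q + S powr q)"
        by (rule powr_sum3_le[OF G_nonneg F0 S0 C0 q])
      finally show "N_function g (d x) powr q \<le> (3 * C) powr q * (N_function g (f x) powr q + F powr q + S powr q)" .
    qed
  qed
  have fin: "finite_measure (lebesgue_on U)" if "compactly_contained U \<Omega>" for U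
    by (rule finite_measure_lebesgue_on[OF compactly_contained_lmeasurable[OF that]])
  have mU: "measure (lebesgue_on U) (space (lebesgue_on U)) \<le> b" if "compactly_contained U \<Omega>" for U
    using measure_lebesgue_on_compactly_contained[OF that b(1)] b(2) by linarith
  have fq: "integrable (lebesgue_on U) (\<lambda>x. N_function g (f x) powr q)" if "compactly_contained U \<Omega>" for U
    using f that G_nonneg by (auto simp: Lq_loc_def Lq_def)
  have dq: "integrable (lebesgue_on B) (\<lambda>x. N_function g (d x) powr q)"
    using G_laplacian_Lq_loc[OF f q] cc G_nonneg by (auto simp: Lq_loc_def Lq_def)
  interpret finite_measure "lebesgue_on B" by (rule fin[OF cc])
  have FH: "F powr q \<le> 2 powr q * b powr (q - 1) * H"
    unfolding F_def H_def using f_LG[OF cc2]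
    by (intro powr_integral_le[OF fin[OF cc2] mU[OF cc2] b(3) G_nonneg _ fq[OF cc2] q]) (simp add: LG_def)
  have "(LINT x|lebesgue_on B. N_function g (d x) powr q) \<le> (LINT x|lebesgue_on B. (3 * C) powr q * (N_function g (f x) powr q + F powr q + S powr q))"
  proof (rule integral_mono_AE[OF dq])
    show "integrable (lebesgue_on B) (\<lambda>x. (3 * C) powr q * (N_function g (f x) powr q + F powr q + S powr q))"
      using fq[OF cc] by simp
    show "AE x in lebesgue_on B. N_function g (d x) powr q \<le> (3 * C) powr q * (N_function g (f x) powr q + F powr q + S powr q)"
      using pt Bs by (simp add: AE_restrict_space_iff)
  qed
  also have "\<dots> = (3 * C) powr q * ((LINT x|lebesgue_on B. N_function g (f x) powr q) + measure (lebesgue_on B) (space (lebesgue_on B)) * (F powr q + S powr q))"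
    using fq[OF cc] by (simp add: algebra_simps)
  also have "\<dots> \<le> (3 * C) powr q * (H + b * (2 powr q * b powr (q - 1) * H + S powr q))"
  proof (intro mult_left_mono add_mono)
    show "(LINT x|lebesgue_on B. N_function g (f x) powr q) \<le> H"
      unfolding H_def by (rule integral_lebesgue_on_mono_set[OF fq[OF cc2] BB Bs]) simp
    show "measure (lebesgue_on B) (space (lebesgue_on B)) * (F powr q + S powr q) \<le> b * (2 powr q * b powr (q - 1) * H + S powr q)"
      using mU[OF cc] FH b(3) by (intro mult_mono) auto
  qed auto
  also have "\<dots> \<le> (3 * C) powr q * ((1 + b + b * (2 powr q * b powr (q - 1))) * (S powr q + H))"
  proof (intro mult_left_mono)
    have "0 \<le> b * H" "0 \<le> S powr q" "0 \<le> b * (2 powr q * b powr (q - 1)) * S powr q" using b H0 by auto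
    then show "H + b * (2 powr q * b powr (q - 1) * H + S powr q) \<le> (1 + b + b * (2 powr q * b powr (q - 1))) * (S powr q + H)"
      by (simp add: algebra_simps)
  qed auto
  finally show ?thesis by (simp add: S_def H_def B_def B2_def mult.assoc)
qed

end

theorem theorem1p1:
  fixes \<Omega> :: "(real^'n::finite) set" and g :: "real \<Rightarrow> real" and q :: real
  assumes "bounded_domain \<Omega>"
    and "N_function_generator g"
    and "condition_A1 g" and "condition_A2 g" and "condition_A3 CARD('n) g"
    and "q \<ge> 1"
  shows "(\<forall>u f. local_weak_solution g \<Omega> f u \<and> (\<lambda>x. N_function g (f x)) \<in> Lq_loc q \<Omega> \<longrightarrow>
            (\<lambda>x. N_function g (weak_laplacian \<Omega> u x)) \<in> Lq_loc q \<Omega>) \<and>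
         (\<forall>\<rho>>0. \<exists>C>0. \<forall>u f. local_weak_solution g \<Omega> f u \<and> (\<lambda>x. N_function g (f x)) \<in> Lq_loc q \<Omega> \<longrightarrow>
            (\<forall>r\<ge>\<rho>. \<forall>x0\<in>\<Omega>. ball x0 (4 * r) \<subseteq> \<Omega> \<longrightarrow>
               (LINT x|lebesgue_on (ball x0 r). N_function g (weak_laplacian \<Omega> u x) powr q)
               \<le> C * (((LINT x|lebesgue_on (ball x0 (2 * r)). N_function g (1 / r\<^sup>2 * u x))
                        + (LINT x|lebesgue_on (ball x0 (2 * r)). N_function g (1 / r * norm (weak_gradient \<Omega> u x)))) powr q
                      + (LINT x|lebesgue_on (ball x0 (2 * r)). N_function g (f x) powr q))))" (is "_ \<and> (\<forall>\<rho>>0. \<exists>C>0. ?P \<rho> C)")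
proof -
  have \<Omega>: "open \<Omega>" "bounded \<Omega>" using assms(1) by (auto simp: bounded_domain_def)
  obtain N where "N_growth g N" using N_growth_of_A1[OF assms(2,3)] by blast
  then interpret N_growth g N .
  have ws: "weak_solution g N \<Omega> u f" if "local_weak_solution g \<Omega> f u" "(\<lambda>x. N_function g (f x)) \<in> Lq_loc q \<Omega>" for u f
  proof
    show "f \<in> LG g U" if "compactly_contained U \<Omega>" for U
      using LG_of_Lq_loc[OF _ \<open>(\<lambda>x. N_function g (f x)) \<in> Lq_loc q \<Omega>\<close> assms(6) that] \<open>local_weak_solution g \<Omega> f u\<close>
      by (simp add: local_weak_solution_def)
  qed (use \<Omega> that in auto)
  have \<Omega>m: "\<Omega> \<in> lmeasurable" using \<Omega> by (intro lmeasurable_open)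
  \<comment> \<open>The added 1 secures \<open>0 < b\<close>, as \<open>powr_integral_le\<close>
    asks.\<close>
  define b where "b = measure lebesgue \<Omega> + 1"
  have b: "measure lebesgue \<Omega> \<le> b" "0 < b" by (auto simp: b_def add_nonneg_pos)
  obtain R0 where R0: "\<Omega> \<subseteq> cball 0 R0" using \<Omega>(2) by (auto simp: bounded_iff subset_iff)
  \<comment> \<open>An upper bound for all admissible radii, since \<open>ball x0 (4 * r)\<close>
    lies in \<open>cball 0 R0\<close>; the 1 is required by \<open>modular_le\<close>.\<close>
  define R where "R = max 1 R0"
  define L where "L = 128 * R ^ 5 + 16 * R\<^sup>2 + 128 * R ^ 4 + 32 * CARD('n) * R ^ 4 + 64 * R ^ 8"
  have L0: "0 \<le> L" by (simp add: L_def R_def)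
  have rR: "r \<le> R" if "0 < r" "ball x0 (4 * r) \<subseteq> \<Omega>" for r and x0 :: "real^'n"
  proof -
    have "ball x0 (4 * r) \<subseteq> cball 0 R0" using that R0 by blast
    then have "dist x0 0 + 4 * r \<le> R0" using that(1) by (simp add: ball_subset_cball_iff)
    then have "r \<le> R0" using that(1) zero_le_dist[of x0 0] by linarith
    then show ?thesis by (simp add: R_def)
  qed
  show ?thesis
  proof (intro conjI allI impI)
    fix u f assume "local_weak_solution g \<Omega> f u \<and> (\<lambda>x. N_function g (f x)) \<in> Lq_loc q \<Omega>"
    then show "(\<lambda>x. N_function g (weak_laplacian \<Omega> u x)) \<in> Lq_loc q \<Omega>"
      using weak_solution.G_laplacian_Lq_loc[OF ws _ assms(6)] by blast
  next
    fix \<rho> :: real assume \<rho>: "0 < \<rho>"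
    \<comment> \<open>Every constant is fixed here, in terms of \<rho>, R, b, N, q and the
      dimension, before u, f, r and x0 are introduced; this gives the uniformity of the
      estimate.\<close>
    define m where "m = 2 / (\<rho> / 2) ^ CARD('n) / moll_mass TYPE('n)"
    define kc where "kc = (10 + 4 * ((4 * L) ^ (N + 2) * fact (4 * (N + 2)) * 2 ^ (N + 2))) / exp (- 4 / (7 * \<rho>\<^sup>2))"
    define D where "D = 4 * m * (1 + 8 * m * b) * (kc + 1)"
    define C where "C = 2 ^ (N + 2) * 2 ^ (N + 2) + D * (2 ^ (N + 2) * (R\<^sup>2) ^ (N + 2))"
    have kc0: "0 \<le> kc" using L0 by (simp add: kc_def)
    have m0: "0 \<le> m" using \<rho> moll_mass_pos[where 'n='n] by (simp add: m_def)
    have D0: "0 \<le> D" using m0 b kc0 by (simp add: D_def)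
    have C0: "0 < C" unfolding C_def using D0 by (intro add_pos_nonneg) auto
    define K where "K = (3 * C) powr q * (1 + b + b * (2 powr q * b powr (q - 1)))"
    have K0: "0 < K" unfolding K_def using C0 b by (intro mult_pos_pos add_pos_nonneg) auto
    show "\<exists>C>0. ?P \<rho> C"
    proof (intro exI[of _ K] conjI K0 allI impI ballI)
      fix u f r and x0 :: "real^'n"
      assume a: "local_weak_solution g \<Omega> f u \<and> (\<lambda>x. N_function g (f x)) \<in> Lq_loc q \<Omega>"
        and r: "\<rho> \<le> r" and ball: "ball x0 (4 * r) \<subseteq> \<Omega>"
      interpret weak_solution g N \<Omega> u f using ws a by blast
      have r0: "0 < r" using r \<rho> by simp
      have kc: "(LINT x|lebesgue_on (ball x0 (3 / 2 * r)). Phi (d x)) \<le> kc * (LINT x|lebesgue_on (ball x0 (2 * r)). Psi x)"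
        if "\<rho> \<le> r" "r \<le> R" "ball x0 (4 * r) \<subseteq> \<Omega>" for x0 r
        using caccioppoli[OF \<rho> that L_def] by (simp add: kc_def pos_le_divide_eq mult.commute)
      have "AE x in lebesgue. x \<in> ball x0 r \<longrightarrow> Phi (d x) \<le> 2 ^ (N + 2) * Phi (f x) +
          D * (LINT x|lebesgue_on (ball x0 (2 * r)). Psi x)"
        using Phi_laplacian_bound[OF \<rho> r rR[OF r0 ball] ball \<Omega>m b(1) m_def kc] by (simp only: D_def mult.assoc)
      from Lq_estimate[OF \<rho> r rR[OF r0 ball] _ ball \<Omega>m b assms(6) _ D0 this C_def] a
      show "(LINT x|lebesgue_on (ball x0 r). N_function g (weak_laplacian \<Omega> u x) powr q)
               \<le> K * (((LINT x|lebesgue_on (ball x0 (2 * r)). N_function g (1 / r\<^sup>2 * u x))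
                        + (LINT x|lebesgue_on (ball x0 (2 * r)). N_function g (1 / r * norm (weak_gradient \<Omega> u x)))) powr q
                      + (LINT x|lebesgue_on (ball x0 (2 * r)). N_function g (f x) powr q))"
        by (simp add: K_def R_def)
    qed
  qed
qed

end
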